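(* Let $C_0>0$ be a constant. There exists a constant $c>0$ (depending only on $C_0$) such that the following holds. Let $p_1,p_2,p_3,r_1,r_2,r_3$ be positive integers, $p=\min\{p_1,p_2,p_3\}$, and suppose $\max\{p_1,p_2,p_3\}\le C_0p$, $\max\{r_1,r_2,r_3\}\le C_0\min\{r_1,r_2,r_3\}$, $4r_1\le r_2r_3$, $4r_2\le r_3r_1$, $4r_3\le r_1r_2$, $1\le r_k\le p_k/3$ for $k=1,2,3$, and $\lambda>0$, $\sigma>0$. Suppose one observes $\mathbf{Y}=\mathbf{X}+\mathbf{Z}\in\mathbb{R}^{p_1\times p_2\times p_3}$ with $\mathbf{Z}$ having i.i.d. $N(0,\sigma^2)$ entries, and let $$\mathcal{F}_{\boldsymbol p,\boldsymbol r}(\lambda)=\left\{\mathbf{X}\in\mathbb{R}^{p_1\times p_2\times p_3}:\ \mathrm{rank}_k(\mathbf{X})\le r_k,\ \sigma_{r_k}(\mathcal{M}_k(\mathbf{X}))\ge\lambda,\ k=1,2,3\right\}.$$ Then for every $1\le q\le\infty$, $$\inf_{\tilde U_k}\sup_{\mathbf{X}\in\mathcal{F}_{\boldsymbol p,\boldsymbol r}(\lambda)}\mathbb{E}\,r_k^{-1/q}\left\|\sin\Theta(\tilde U_k,U_k)\right\|_q\ge c\left(\frac{\sqrt{p_k}}{\lambda/\sigma}\wedge1\right),\qquad k=1,2,3,$$ and $$\inf_{\hat{\mathbf{X}}}\sup_{\mathbf{X}\in\mathcal{F}_{\boldsymbol p,\boldsymbol r}(\lambda)}\mathbb{E}\|\hat{\mathbf{X}}-\mathbf{X}\|_{\rm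 F}^2\ge c\,\sigma^2(p_1r_1+p_2r_2+p_3r_3),$$ $$\inf_{\hat{\mathbf{X}}}\sup_{\mathbf{X}\in\mathcal{F}_{\boldsymbol p,\boldsymbol r}(\lambda)}\mathbb{E}\frac{\|\hat{\mathbf{X}}-\mathbf{X}\|_{\rm F}^2}{\|\mathbf{X}\|_{\rm F}^2}\ge c\left(\frac{p_1+p_2+p_3}{\lambda^2/\sigma^2}\wedge1\right).$$ Here the infima are over all estimators (measurable functions of $\mathbf{Y}$) $\tilde U_k$ with values in $\mathbb{O}_{p_k,r_k}$ and $\hat{\mathbf{X}}$ with values in $\mathbb{R}^{p_1\times p_2\times p_3}$, and $U_k\in\mathbb{O}_{p_k,r_k}$ denotes the matrix of left singular vectors of $\mathcal{M}_k(\mathbf{X})$ associated with its nonzero singular values.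
   Context: Notation. $a\wedge b=\min\{a,b\}$; $\boldsymbol p=(p_1,p_2,p_3)$, $\boldsymbol r=(r_1,r_2,r_3)$. $\mathbb{O}_{p,r}=\{U\in\mathbb{R}^{p\times r}:U^\top U=I_r\}$. $\sigma_j(A)$ is the $j$-th largest singular value of $A$. For $U,\hat U\in\mathbb{O}_{p,r}$ with $\sigma_1\ge\dots\ge\sigma_r\ge0$ the singular values of $U^\top\hat U$, $\|\sin\Theta(U,\hat U)\|_q=\left(\sum_{i=1}^r(1-\sigma_i^2)^{q/2}\right)^{1/q}$ for $1\le q<\infty$, and $\|\sin\Theta(U,\hat U)\|_\infty=\sqrt{1-\sigma_r^2}$. For $\mathbf{X}\in\mathbb{R}^{p_1\times p_2\times p_3}$, the mode-$1$ matricization $\mathcal{M}_1(\mathbf{X})\in\mathbb{R}^{p_1\times(p_2p_3)}$ is $[\mathcal{M}_1(\mathbf{X})]_{i,(j-1)p_3+k}=X_{ijk}$; $\mathcal{M}_2(\mathbf{X})\in\mathbb{R}^{p_2\times(p_3p_1)}$ and $\mathcal{M}_3(\mathbf{X})\in\mathbb{R}^{p_3\times(p_1p_2)}$ are defined in the same fashion; $\mathrm{rank}_k(\mathbf{X})=\mathrm{rank}(\mathcal{M}_k(\mathbf{X}))$. $\|\mathbf{X}\|_{\rm F}=(\sum_{i,j,k}X_{ijk}^2)^{1/2}$. *)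

theory Defs
  imports
    "HOL-Probability.Probability"
    "Jordan_Normal_Form.Char_Poly"
    "Jordan_Normal_Form.DL_Rank"
begin

text \<open>Dimensions and ranks are functions on mode numbers, of which only the values
  at \<open>1\<close>, \<open>2\<close>, \<open>3\<close> matter. Indices of tensors and matrices start at \<open>0\<close>; mode numbers
  and the positions of singular values start at \<open>1\<close>.\<close>

type_synonym tensor = "nat \<times> nat \<times> nat \<Rightarrow> real"

definition tensor_index :: "(nat \<Rightarrow> nat) \<Rightarrow> (nat \<times> nat \<times> nat) set" where
  "tensor_index p = {..<p 1} \<times> {..<p 2} \<times> {..<p 3}"

definition tensor_space :: "(nat \<Rightarrow> nat) \<Rightarrow> tensor measure" where
  "tensor_space p = (\<Pi>\<^sub>M x\<in>tensor_index p. borel)"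

definition frobenius_norm :: "(nat \<Rightarrow> nat) \<Rightarrow> tensor \<Rightarrow> real" where
  "frobenius_norm p X = L2_set X (tensor_index p)"

text \<open>The columns of the mode-\<open>k\<close> matricization are indexed by the two other modes, in
  cyclic order after \<open>k\<close>, the last of them varying fastest.\<close>

definition matricization :: "(nat \<Rightarrow> nat) \<Rightarrow> nat \<Rightarrow> tensor \<Rightarrow> real mat" where
  "matricization p k X =
    (if k = 1 then Matrix.mat (p 1) (p 2 * p 3) (\<lambda>(i, c). X (i, c div p 3, c mod p 3))
     else if k = 2 then Matrix.mat (p 2) (p 3 * p 1) (\<lambda>(j, c). X (c mod p 1, j, c div p 1))
     else Matrix.mat (p 3) (p 1 * p 2) (\<lambda>(l, c). X (c div p 2, c mod p 2, l)))"

definition mat_rank :: "real mat \<Rightarrow> nat" where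
  "mat_rank A = vec_space.rank (dim_row A) A"

text \<open>The list has one entry for each column of \<open>A\<close>, so for a wide matrix it is padded with
  zeros at the end compared with the usual list of length \<open>min (dim_row A) (dim_col A)\<close>.\<close>

definition singular_values :: "real mat \<Rightarrow> real list" where
  "singular_values A =
    rev (sorted_list_of_multiset
      (image_mset sqrt (proots (char_poly (transpose_mat A * A)))))"

definition singular_value :: "nat \<Rightarrow> real mat \<Rightarrow> real" where
  "singular_value j A = singular_values A ! (j - 1)"

definition orthonormal_mats :: "nat \<Rightarrow> nat \<Rightarrow> real mat set" where
  "orthonormal_mats p r = {U \<in> carrier_mat p r. transpose_mat U * U = 1\<^sub>m r}"

text \<open>\<open>U\<close> is the left factor of a compact singular value decomposition of \<open>A\<close>. It is not
  determined by \<open>A\<close>, but its column space is.\<close>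

definition left_singular_mat :: "real mat \<Rightarrow> real mat \<Rightarrow> bool" where
  "left_singular_mat A U \<longleftrightarrow>
    (\<exists>s V. U \<in> orthonormal_mats (dim_row A) (dim_col U) \<and>
           V \<in> orthonormal_mats (dim_col A) (dim_col U) \<and>
           (\<forall>i<dim_col U. 0 < s i) \<and>
           A = U * mat_diag (dim_col U) s * transpose_mat V)"

definition sin_theta_norm :: "ereal \<Rightarrow> real mat \<Rightarrow> real mat \<Rightarrow> real" where
  "sin_theta_norm q U V =
    (let r = dim_col U; \<sigma> = (\<lambda>i. singular_value i (transpose_mat U * V)) in
     if q = \<infinity> then sqrt (1 - (\<sigma> r)\<^sup>2)
     else (\<Sum>i = 1..r. (1 - (\<sigma> i)\<^sup>2) powr (real_of_ereal q / 2)) powr (1 / real_of_ereal q))"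

definition low_rank_tensors :: "(nat \<Rightarrow> nat) \<Rightarrow> (nat \<Rightarrow> nat) \<Rightarrow> real \<Rightarrow> tensor set" where
  "low_rank_tensors p r lam =
    {X \<in> space (tensor_space p). \<forall>k\<in>{1, 2, 3}.
       mat_rank (matricization p k X) \<le> r k \<and>
       singular_value (r k) (matricization p k X) \<ge> lam}"

definition noise :: "(nat \<Rightarrow> nat) \<Rightarrow> real \<Rightarrow> tensor measure" where
  "noise p \<sigma> = (\<Pi>\<^sub>M x\<in>tensor_index p. density lborel (normal_density 0 \<sigma>))"

text \<open>The expectation of a nonnegative function of the observation \<open>Y = X + Z\<close>. As an
  integral in \<open>[0, \<infinity>]\<close> it is also meaningful when the loss is not integrable.\<close>

definition risk :: "(nat \<Rightarrow> nat) \<Rightarrow> real \<Rightarrow> tensor \<Rightarrow> (tensor \<Rightarrow> real) \<Rightarrow> ennreal" where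
  "risk p \<sigma> X loss =
    (\<integral>\<^sup>+ Z. ennreal (loss (\<lambda>x\<in>tensor_index p. X x + Z x)) \<partial>noise p \<sigma>)"

definition tensor_estimators :: "(nat \<Rightarrow> nat) \<Rightarrow> (tensor \<Rightarrow> tensor) set" where
  "tensor_estimators p = measurable (tensor_space p) (tensor_space p)"

text \<open>Measurability of a matrix-valued map is measurability of its entries.\<close>

definition subspace_estimators :: "(nat \<Rightarrow> nat) \<Rightarrow> nat \<Rightarrow> nat \<Rightarrow> (tensor \<Rightarrow> real mat) set" where
  "subspace_estimators p m r =
    {U. (\<forall>Y\<in>space (tensor_space p). U Y \<in> orthonormal_mats m r) \<and>
        (\<forall>i<m. \<forall>j<r. (\<lambda>Y. U Y $$ (i, j)) \<in> borel_measurable (tensor_space p))}"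

end

theory Submission
  imports Defs "HOL-Number_Theory.Cong"
begin

text \<open>The hypotheses are indexed by sign matrices \<open>W\<close>: the mode-\<open>k\<close> matricization of the tensor is
  \<open>\<lambda> [I; \<epsilon> W] S\<close>, where the core \<open>S\<close> is a 0/1 array in which any two coordinates of a nonzero cell
  determine the third, so that all its matricizations have orthogonal rows. With \<open>\<epsilon>\<close> of order
  \<open>min (\<sigma> / \<lambda>) (1 / sqrt p)\<close>, flipping one sign moves the tensor by \<open>O(\<sigma>)\<close>, so two independent draws
  from the posterior still differ in a constant fraction of the signs. As the average of the losses
  of an estimate at two hypotheses is at least a multiple of their distance, the distance of
  the two draws bounds the Bayes risk from below; no packing of the hypotheses is needed.

  For the Frobenius losses the distance is the Hamming distance of the signs. For the subspace
  losses, all of which dominate the mean of the sines of the principal angles, it is the nuclear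
  norm of a difference of projections. That norm is bounded from below by pairing with contractions,
  which yields the nuclear norm of \<open>W - W'\<close> up to terms of higher order in \<open>\<epsilon>\<close>, and the latter is
  controlled by second and fourth moments of the signs.\<close>

section \<open>The spectral theorem for real symmetric matrices\<close>

text \<open>Averaging over two posterior draws needs a lower bound linear in the Hamming distance,
  and the nuclear norm is not additive over signs. The inequality
  \<open>s \<ge> s^2/t - s^4/(4 t^3)\<close> for singular values supplies one: the squares add up to
  four times the Hamming distance, and the fourth powers split into one term for each hypothesis.
  Those terms only have to be small on average over all signs, so atypical sign matrices need not be
  discarded. The scale \<open>t\<close> is of order \<open>sqrt n\<close>, typical for the singular
  values of an \<open>n\<close> by \<open>r\<close> sign matrix with \<open>2 r \<le> n\<close>. The
  assumptions enter as follows. Each rank is at most the product of the others, so the core has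
  room; comparable ranks bound the core cells per row by \<open>\<mu> = C0 + 1\<close>, so
  neighbouring hypotheses have affinity at least \<open>exp (- \<mu> / 2)\<close>; and
  \<open>r_k \<le> p_k / 3\<close> leaves \<open>n = p_k - r_k \<ge> 2 r_k\<close> rows for signs, a
  constant fraction of \<open>p_k\<close>. Only one mode carries signs; both Frobenius bounds use
  mode 1, which represents all three up to powers of \<open>C0\<close>.\<close>

abbreviation sumsq :: "nat \<Rightarrow> (nat \<Rightarrow> real) \<Rightarrow> real" where
  "sumsq n x \<equiv> \<Sum>i<n. (x i)\<^sup>2"

abbreviation dot :: "nat \<Rightarrow> (nat \<Rightarrow> real) \<Rightarrow> (nat \<Rightarrow> real) \<Rightarrow> real" where
  "dot n x y \<equiv> \<Sum>i<n. x i * y i"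

text \<open>Padding the \<open>k\<close> vectors by zero rows to a square matrix makes row
  \<open>k\<close> vanish, so the determinant is zero and the kernel nontrivial. The values past
  \<open>n\<close> are pinned to \<open>0\<close> so that the witness can lie in a compact set of
  functions.\<close>

lemma orthogonal_vector_exists:
  fixes u :: "nat \<Rightarrow> nat \<Rightarrow> real"
  assumes "k < n"
  obtains x where "\<And>i. i \<ge> n \<Longrightarrow> x i = 0" "sumsq n x = 1"
    "\<And>l. l < k \<Longrightarrow> dot n (u l) x = 0"
proof -
  define A where "A = Matrix.mat n n (\<lambda>(l, i). if l < k then u l i else 0)"
  have A: "A \<in> carrier_mat n n" by (simp add: A_def)
  have "row A k = 0\<^sub>v n" using assms by (auto simp: A_def)
  then have "mat\<^sub>r n n (\<lambda>i. if i = k then 0\<^sub>v n else row A i) = A"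
    using A by (intro eq_rowI) auto
  then have "det A = 0"
    using det_row_0[OF assms, of "row A"] A by auto
  then have "\<exists>v. v \<in> carrier_vec n \<and> v \<noteq> 0\<^sub>v n \<and> A *\<^sub>v v = 0\<^sub>v n"
    using det_0_iff_vec_prod_zero_field[OF A] by blast
  then obtain v where v: "v \<in> carrier_vec n" "v \<noteq> 0\<^sub>v n" "A *\<^sub>v v = 0\<^sub>v n" by blast
  obtain i0 where i0: "i0 < n" "v $ i0 \<noteq> 0" using v by (metis eq_vecI carrier_vecD index_zero_vec)
  define s where "s = (\<Sum>i<n. (v $ i)\<^sup>2)"
  have "s > 0" unfolding s_def by (rule sum_pos2[of _ i0]) (use i0 in auto)
  define x where "x i = (if i < n then v $ i / sqrt s else 0)" for i
  show ?thesis
  proof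
    show "x i = 0" if "i \<ge> n" for i using that by (simp add: x_def)
    have "sumsq n x = (\<Sum>i<n. (v $ i)\<^sup>2 / s)"
      by (rule sum.cong) (use \<open>s > 0\<close> in \<open>auto simp: x_def power_divide\<close>)
    also have "\<dots> = 1" using \<open>s > 0\<close> by (simp add: s_def flip: sum_divide_distrib)
    finally show "sumsq n x = 1" .
    fix l assume l: "l < k"
    have "(A *\<^sub>v v) $ l = (\<Sum>i<n. u l i * v $ i)"
      using l assms v(1) by (simp add: A_def scalar_prod_def lessThan_atLeast0)
    then have "(\<Sum>i<n. u l i * v $ i) = 0" using v l assms by simp
    moreover have "dot n (u l) x = (\<Sum>i<n. u l i * v $ i) / sqrt s"
      by (simp add: x_def sum_divide_distrib)
    ultimately show "dot n (u l) x = 0" by simp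
  qed
qed

lemma rayleigh_maximizer_exists:
  fixes a :: "nat \<Rightarrow> nat \<Rightarrow> real" and u :: "nat \<Rightarrow> nat \<Rightarrow> real"
  assumes "k < n"
  obtains x where "sumsq n x = 1" "\<And>l. l < k \<Longrightarrow> dot n (u l) x = 0"
    "\<And>y. (sumsq n y) = 1 \<Longrightarrow> (\<And>l. l < k \<Longrightarrow> dot n (u l) y = 0) \<Longrightarrow>
       (\<Sum>i<n. \<Sum>j<n. a i j * y i * y j) \<le> (\<Sum>i<n. \<Sum>j<n. a i j * x i * x j)"
proof -
  \<comment> \<open>Vectors are functions on all of \<open>nat\<close>; fixing the coordinates past
    \<open>n\<close> at \<open>0\<close> keeps this box compact in the product topology, by
    Tychonoff's theorem.\<close>
  define B :: "(nat \<Rightarrow> real) set" where "B = Pi\<^sub>E UNIV (\<lambda>i. if i < n then {-1..1} else {0})"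
  have "compactin (product_topology (\<lambda>i. euclidean) UNIV) B"
    unfolding B_def compactin_PiE by (auto simp: compactin_euclidean_iff)
  then have "compact B" by (simp add: euclidean_product_topology compactin_euclidean_iff)
  define S where "S = B \<inter> ({x. (sumsq n x) = 1} \<inter> (\<Inter>l<k. {x. (dot n (u l) x) = 0}))"
  have c: "continuous_on UNIV (\<lambda>x::nat \<Rightarrow> real. x i)" for i
    by (rule continuous_on_product_coordinates)
  have "closed ({x::nat \<Rightarrow> real. (sumsq n x) = 1} \<inter> (\<Inter>l<k. {x. (dot n (u l) x) = 0}))"
    by (intro closed_Int closed_INT ballI closed_Collect_eq continuous_intros c)
  then have "compact S" unfolding S_def using \<open>compact B\<close> by (rule compact_Int_closed[rotated])
  have inS: "x \<in> S" if "\<And>i. i \<ge> n \<Longrightarrow> x i = 0" "sumsq n x = 1"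
    "\<And>l. l < k \<Longrightarrow> dot n (u l) x = 0" for x
  proof -
    have "\<bar>x i\<bar> \<le> 1" if "i < n" for i
    proof -
      have "(x i)\<^sup>2 \<le> sumsq n x" using that by (intro member_le_sum) auto
      then show ?thesis using \<open>(sumsq n x) = 1\<close> by (simp add: abs_square_le_1)
    qed
    then show ?thesis using that by (auto simp: S_def B_def abs_le_iff)
  qed
  obtain x0 where "x0 \<in> S" using orthogonal_vector_exists[OF assms, of u] inS by metis
  have "continuous_on S (\<lambda>x. \<Sum>i<n. \<Sum>j<n. a i j * x i * x j)"
    by (intro continuous_intros continuous_on_subset[OF c]) auto
  then obtain x where x: "x \<in> S"
    "\<And>y. y \<in> S \<Longrightarrow> (\<Sum>i<n. \<Sum>j<n. a i j * y i * y j) \<le> (\<Sum>i<n. \<Sum>j<n. a i j * x i * x j)"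
    using continuous_attains_sup[OF \<open>compact S\<close>] \<open>x0 \<in> S\<close> by blast
  show ?thesis
  proof
    show "sumsq n x = 1" "\<And>l. l < k \<Longrightarrow> dot n (u l) x = 0"
      using x(1) by (auto simp: S_def)
    fix y :: "nat \<Rightarrow> real"
    assume y: "sumsq n y = 1" "\<And>l. l < k \<Longrightarrow> dot n (u l) y = 0"
    define y' where "y' i = (if i < n then y i else 0)" for i
    have "y' \<in> S" by (rule inS) (use y in \<open>auto simp: y'_def\<close>)
    from x(2)[OF this] show "(\<Sum>i<n. \<Sum>j<n. a i j * y i * y j) \<le> (\<Sum>i<n. \<Sum>j<n. a i j * x i * x j)"
      by (simp add: y'_def)
  qed
qed

lemma sum_sq_eq_0_imp:
  fixes z :: "nat \<Rightarrow> real"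
  assumes "sumsq n z = 0" "i < n" shows "z i = 0"
  using assms by (simp add: sum_nonneg_eq_0_iff)

text \<open>The residual \<open>z = a x - m x\<close> of the Rayleigh maximizer is orthogonal to the
  earlier eigenvectors, so \<open>x + t z\<close> stays admissible for every \<open>t\<close>. The
  first variation \<open>2 t |z|^2\<close> is then bounded by a multiple of \<open>t^2\<close>,
  which forces \<open>z = 0\<close>.\<close>

lemma next_eigenvector_exists:
  fixes a :: "nat \<Rightarrow> nat \<Rightarrow> real" and u :: "nat \<Rightarrow> nat \<Rightarrow> real"
  assumes sym: "\<And>i j. i < n \<Longrightarrow> j < n \<Longrightarrow> a i j = a j i"
  assumes "k < n"
    and ev: "\<And>l i. l < k \<Longrightarrow> i < n \<Longrightarrow> dot n (a i) (u l) = e l * u l i"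
  obtains x m where "sumsq n x = 1" "\<And>l. l < k \<Longrightarrow> dot n (u l) x = 0"
    "\<And>i. i < n \<Longrightarrow> dot n (a i) x = m * x i"
proof -
  obtain x where x: "sumsq n x = 1" "\<And>l. l < k \<Longrightarrow> dot n (u l) x = 0"
    "\<And>y. (sumsq n y) = 1 \<Longrightarrow> (\<And>l. l < k \<Longrightarrow> dot n (u l) y = 0) \<Longrightarrow>
       (\<Sum>i<n. \<Sum>j<n. a i j * y i * y j) \<le> (\<Sum>i<n. \<Sum>j<n. a i j * x i * x j)"
    by (rule rayleigh_maximizer_exists[OF \<open>k < n\<close>, where a = a and u = u]) blast
  define Q where "Q y z = (\<Sum>i<n. \<Sum>j<n. a i j * y i * z j)" for y z
  define m where "m = Q x x"
  have Qsym: "Q y z = Q z y" for y z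
    unfolding Q_def by (subst sum.swap) (auto intro!: sum.cong simp: sym)
  have Qadd: "Q (\<lambda>i. y i + t * z i) (\<lambda>i. y i + t * z i) = Q y y + 2 * t * Q y z + t\<^sup>2 * Q z z" for y z t
  proof -
    have "Q (\<lambda>i. y i + t * z i) (\<lambda>i. y i + t * z i) = Q y y + t * Q y z + t * Q z y + t\<^sup>2 * Q z z"
      by (simp add: Q_def algebra_simps sum.distrib sum_distrib_left power2_eq_square)
    then show ?thesis using Qsym[of z y] by simp
  qed
  have bound: "Q y y \<le> m * sumsq n y" if "\<And>l. l < k \<Longrightarrow> dot n (u l) y = 0" for y
  proof (cases "sumsq n y = 0")
    case True
    then have "y i = 0" if "i < n" for i using sum_sq_eq_0_imp that by blast
    then show ?thesis using True by (simp add: Q_def)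
  next
    case False
    define s where "s = sumsq n y"
    have "s > 0" using False by (simp add: s_def sum_nonneg order.not_eq_order_implies_strict)
    define y' where "y' i = y i / sqrt s" for i
    have "sumsq n y' = 1"
      using \<open>s > 0\<close> by (simp add: y'_def power_divide flip: sum_divide_distrib) (simp add: s_def)
    moreover have "dot n (u l) y' = 0" if "l < k" for l
      using \<open>\<And>l. l < k \<Longrightarrow> dot n (u l) y = 0\<close>[OF that] by (simp add: y'_def flip: sum_divide_distrib)
    ultimately have "Q y' y' \<le> m" using x(3) by (simp add: Q_def m_def)
    moreover have "Q y' y' = Q y y / s"
      using \<open>s > 0\<close> by (simp add: Q_def y'_def sum_divide_distrib)
    ultimately show ?thesis using \<open>s > 0\<close> by (simp add: s_def field_simps)
  qed
  define z where "z i = dot n (a i) x - m * x i" for i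
  have zu: "dot n (u l) z = 0" if "l < k" for l
  proof -
    have "(\<Sum>i<n. u l i * dot n (a i) x) = (\<Sum>j<n. (dot n (a j) (u l)) * x j)"
      by (simp add: sum_distrib_left sum_distrib_right, subst sum.swap) (auto intro!: sum.cong simp: sym)
    also have "\<dots> = e l * dot n (u l) x"
      by (simp add: ev[OF that] sum_distrib_left mult.assoc)
    finally have "(\<Sum>i<n. u l i * dot n (a i) x) = 0" using x(2)[OF that] by simp
    moreover have "dot n (u l) z
        = (\<Sum>i<n. u l i * dot n (a i) x) - m * dot n (u l) x"
      by (simp add: z_def right_diff_distrib sum_subtractf sum_distrib_left mult.left_commute)
    ultimately show ?thesis using x(2)[OF that] by simp
  qed
  define xz where "xz = dot n x z"
  define zz where "zz = sumsq n z"
  have "Q x z = (\<Sum>i<n. z i * dot n (a i) x)"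
    by (simp add: Qsym[of x z]) (simp add: Q_def sum_distrib_left ac_simps)
  moreover have "zz = (\<Sum>i<n. z i * ((dot n (a i) x) - m * x i))"
    by (simp add: zz_def power2_eq_square flip: z_def)
  ultimately have g: "Q x z - m * xz = zz"
    by (simp add: xz_def right_diff_distrib sum_subtractf sum_distrib_left mult_ac)
  have ineq: "2 * t * zz \<le> t\<^sup>2 * (m * zz - Q z z)" for t
  proof -
    have "(\<Sum>i<n. u l i * (x i + t * z i)) = 0" if "l < k" for l
    proof -
      have "(\<Sum>i<n. u l i * (x i + t * z i)) = dot n (u l) x + t * dot n (u l) z"
        by (simp add: distrib_left sum.distrib sum_distrib_left mult.left_commute)
      then show ?thesis using x(2) zu that by simp
    qed
    then have "Q (\<lambda>i. x i + t * z i) (\<lambda>i. x i + t * z i) \<le> m * (\<Sum>i<n. (x i + t * z i)\<^sup>2)"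
      by (rule bound)
    also have "(\<Sum>i<n. (x i + t * z i)\<^sup>2) = 1 + 2 * t * xz + t\<^sup>2 * zz"
      by (simp add: power2_sum power_mult_distrib sum.distrib x(1) xz_def zz_def sum_distrib_left ac_simps)
    finally have "Q x x + 2 * t * Q x z + t\<^sup>2 * Q z z \<le> m * (1 + 2 * t * xz + t\<^sup>2 * zz)"
      unfolding Qadd .
    moreover have "Q x z = zz + m * xz" using g by simp
    ultimately show ?thesis by (simp only: m_def[symmetric]) (simp add: algebra_simps)
  qed
  have "zz = 0"
  proof (rule ccontr)
    assume "zz \<noteq> 0"
    then have "zz > 0" by (simp add: zz_def sum_nonneg order.not_eq_order_implies_strict)
    \<comment> \<open>For \<open>t = zz / c\<close> the linear term is twice the bound on the
      quadratic one; adding \<open>1\<close> keeps \<open>c\<close> positive.\<close>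
    define c where "c = \<bar>m * zz - Q z z\<bar> + 1"
    have "c > 0" by (simp add: c_def)
    have "2 * (zz / c) * zz \<le> (zz / c)\<^sup>2 * c"
      by (rule order_trans[OF ineq mult_left_mono]) (auto simp: c_def)
    then have "2 * zz\<^sup>2 / c \<le> zz\<^sup>2 / c" using \<open>c > 0\<close> by (simp add: power2_eq_square)
    then show False using \<open>c > 0\<close> \<open>zz > 0\<close> by (simp add: divide_le_cancel)
  qed
  then have "dot n (a i) x = m * x i" if "i < n" for i
    using sum_sq_eq_0_imp[of z n i] that by (simp add: zz_def z_def)
  then show ?thesis using that x by blast
qed

abbreviation eigensystem ::
  "nat \<Rightarrow> (nat \<Rightarrow> nat \<Rightarrow> real) \<Rightarrow> nat \<Rightarrow> (nat \<Rightarrow> nat \<Rightarrow> real) \<Rightarrow> (nat \<Rightarrow> real) \<Rightarrow> bool" where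
  "eigensystem n a k u e \<equiv>
    (\<forall>l<k. \<forall>l'<k. (dot n (u l) (u l')) = (if l = l' then 1 else 0)) \<and>
    (\<forall>l<k. \<forall>i<n. (dot n (a i) (u l)) = e l * u l i)"

lemma orthonormal_eigenvectors_exist:
  fixes a :: "nat \<Rightarrow> nat \<Rightarrow> real"
  assumes sym: "\<And>i j. i < n \<Longrightarrow> j < n \<Longrightarrow> a i j = a j i"
  assumes "k \<le> n"
  shows "\<exists>u e. eigensystem n a k u e"
  using \<open>k \<le> n\<close>
proof (induction k)
  case (Suc k)
  have "\<exists>u e. eigensystem n a k u e"
    by (rule Suc.IH) (use Suc.prems in simp)
  then obtain u e where
    "eigensystem n a k u e"
    by (elim exE)
  then have ue: "\<And>l l'. l < k \<Longrightarrow> l' < k \<Longrightarrow> dot n (u l) (u l') = (if l = l' then 1 else 0)"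
    "\<And>l i. l < k \<Longrightarrow> i < n \<Longrightarrow> dot n (a i) (u l) = e l * u l i"
    by auto
  obtain x m where x: "sumsq n x = 1" "\<And>l. l < k \<Longrightarrow> dot n (u l) x = 0"
    "\<And>i. i < n \<Longrightarrow> dot n (a i) x = m * x i"
    by (rule next_eigenvector_exists[of n a k u e]) (use sym ue(2) Suc.prems in auto)
  define u' where "u' l = (if l = k then x else u l)" for l
  define e' where "e' l = (if l = k then m else e l)" for l
  have "dot n x (u l) = 0" if "l < k" for l using x(2)[OF that] by (simp add: mult.commute)
  then have "\<forall>l<Suc k. \<forall>l'<Suc k. (dot n (u' l) (u' l')) = (if l = l' then 1 else 0)"
    using x ue by (auto simp: u'_def less_Suc_eq power2_eq_square)
  moreover have "\<forall>l<Suc k. \<forall>i<n. (dot n (a i) (u' l)) = e' l * u' l i"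
    using x ue by (auto simp: u'_def e'_def less_Suc_eq)
  ultimately show ?case by blast
qed auto

text \<open>The second clause is completeness in coordinates, the form in which Parseval's identity
  uses a basis.\<close>

definition orthonormal_basis :: "nat \<Rightarrow> (nat \<Rightarrow> nat \<Rightarrow> real) \<Rightarrow> bool" where
  "orthonormal_basis n u \<longleftrightarrow>
    (\<forall>k<n. \<forall>l<n. (dot n (u k) (u l)) = (if k = l then 1 else 0)) \<and>
    (\<forall>i<n. \<forall>j<n. (\<Sum>k<n. u k i * u k j) = (if i = j then 1 else 0))"

text \<open>The eigenvalues are tied to the roots of the characteristic polynomial because
  \<open>singular_values\<close> is defined by such roots; similarity to a diagonal matrix carries
  the multiplicities along.\<close>

lemma spectral_theorem:
  fixes A :: "real mat"
  assumes A: "A \<in> carrier_mat n n" and sym: "transpose_mat A = A"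
  obtains u e where "orthonormal_basis n u"
    "\<And>i k. i < n \<Longrightarrow> k < n \<Longrightarrow> (\<Sum>j<n. A $$ (i, j) * u k j) = e k * u k i"
    "proots (char_poly A) = mset (map e [0..<n])"
proof -
  have s: "A $$ (i, j) = A $$ (j, i)" if "i < n" "j < n" for i j
    using that A sym by (metis carrier_matD index_transpose_mat(1))
  have "\<exists>u e. eigensystem n (\<lambda>i j. A $$ (i, j)) n u e"
    by (rule orthonormal_eigenvectors_exist) (use s in auto)
  then obtain u e where
    "eigensystem n (\<lambda>i j. A $$ (i, j)) n u e"
    by (elim exE)
  then have ue: "\<And>k l. k < n \<Longrightarrow> l < n \<Longrightarrow> dot n (u k) (u l) = (if k = l then 1 else 0 :: real)"
    "\<And>i k. i < n \<Longrightarrow> k < n \<Longrightarrow> (\<Sum>j<n. A $$ (i, j) * u k j) = e k * u k i"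
    by auto
  define U where "U = Matrix.mat n n (\<lambda>(i, k). u k i)"
  define D where "D = mat_diag n e"
  have [simp]: "U \<in> carrier_mat n n" "D \<in> carrier_mat n n" by (auto simp: U_def D_def)
  have UU: "transpose_mat U * U = 1\<^sub>m n"
    by (rule eq_matI) (auto simp: U_def scalar_prod_def ue(1) simp flip: lessThan_atLeast0)
  then have UU': "U * transpose_mat U = 1\<^sub>m n"
    by (rule mat_mult_left_right_inverse[rotated 2]) auto
  have "A * U = U * D"
    using A by (intro eq_matI) (auto simp: U_def D_def mat_diag_mult_right[of _ n] scalar_prod_def ue(2)
        lessThan_atLeast0[symmetric] mult.commute[of "e _"])
  then have "A * U * transpose_mat U = U * D * transpose_mat U" by simp
  then have AU: "A = U * D * transpose_mat U"
    using A UU' by (subst (asm) assoc_mult_mat[of A n n U n "transpose_mat U" n]) auto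
  have "similar_mat A D"
    unfolding similar_mat_def similar_mat_wit_def
    by (rule exI[of _ U], rule exI[of _ "transpose_mat U"]) (use A UU UU' AU[symmetric] in \<open>simp add: Let_def carrier_matD\<close>)
  then have "char_poly A = char_poly D" by (rule char_poly_similar)
  also have "\<dots> = (\<Prod>a\<leftarrow>diag_mat D. [:- a, 1:])"
    by (rule char_poly_upper_triangular[of _ n]) (auto simp: D_def mat_diag_def)
  also have "diag_mat D = map e [0..<n]" by (auto simp: diag_mat_def D_def mat_diag_def)
  finally have cp: "char_poly A = (\<Prod>a\<leftarrow>map e [0..<n]. [:- a, 1:])" .
  have pr: "proots (\<Prod>a\<leftarrow>xs. [:- a, 1:]) = mset xs" for xs :: "real list"
  proof (induction xs)
    case (Cons x xs)
    have "(\<Prod>a\<leftarrow>xs. [:- a, 1:]) \<noteq> 0" by (auto simp: prod_list_zero_iff)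
    then have "proots ([:- x, 1:] * (\<Prod>a\<leftarrow>xs. [:- a, 1:])) = add_mset x (mset xs)"
      by (subst proots_mult) (use Cons in auto)
    then show ?case by (simp only: list.map prod_list.Cons mset.simps)
  qed simp
  have pm: "proots (char_poly A) = mset (map e [0..<n])" unfolding cp by (rule pr)
  have on: "(\<Sum>k<n. u k i * u k j) = (if i = j then 1 else 0)" if "i < n" "j < n" for i j
  proof -
    have "(U * transpose_mat U) $$ (i, j) = (\<Sum>k<n. u k i * u k j)"
      using that by (simp add: U_def scalar_prod_def lessThan_atLeast0)
    then show ?thesis using that UU' by simp
  qed
  show ?thesis
  proof (rule that[of u e])
    show "orthonormal_basis n u" unfolding orthonormal_basis_def using ue(1) on by blast
    show "(\<Sum>j<n. A $$ (i, j) * u k j) = e k * u k i" if "i < n" "k < n" for i k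
      using that by (rule ue(2))
  qed (rule pm)
qed

section \<open>Ranks and singular values\<close>

text \<open>Both sides equal the determinant of the block matrix with blocks \<open>1\<close>,
  \<open>a\<close>, \<open>b\<close>, \<open>X\<close>: once by the formula for commuting lower
  blocks, as \<open>X\<close> is scalar, and once by eliminating \<open>b\<close>. Singular
  \<open>A\<close> and \<open>B\<close> are covered. It makes the principal angles symmetric in the
  two subspaces.\<close>

lemma char_poly_mult_commute:
  fixes A B :: "'a :: idom mat"
  assumes A: "A \<in> carrier_mat n n" and B: "B \<in> carrier_mat n n"
  shows "char_poly (A * B) = char_poly (B * A)"
proof -
  define a where "a = map_mat (\<lambda>x. [:x:]) A"
  define b where "b = map_mat (\<lambda>x. [:x:]) B"
  define X where "X = [:0, 1:] \<cdot>\<^sub>m (1\<^sub>m n :: 'a poly mat)"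
  have [simp]: "a \<in> carrier_mat n n" "b \<in> carrier_mat n n" "X \<in> carrier_mat n n"
    using A B by (auto simp: a_def b_def X_def)
  then have [simp]: "dim_row a = n" "dim_col a = n" "dim_row b = n" "dim_col b = n" "dim_row X = n" "dim_col X = n"
    by (blast dest: carrier_matD)+
  have cp: "char_poly (C * D) = det (X - map_mat (\<lambda>x. [:x:]) C * map_mat (\<lambda>x. [:x:]) D)"
    if "C \<in> carrier_mat n n" "D \<in> carrier_mat n n" for C D :: "'a mat"
  proof -
    have "char_poly_matrix (C * D) = X - map_mat (\<lambda>x. [:x:]) (C * D)"
      using that by (intro eq_matI) (auto simp: char_poly_matrix_def X_def)
    then show ?thesis using map_poly_mult(1)[OF that] by (simp add: char_poly_def)
  qed
  have X1: "X * c = c * X" "c * 1\<^sub>m n = c" "1\<^sub>m n * c = c" if "c \<in> carrier_mat n n" for c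
    using that by (auto simp: X_def mult_smult_assoc_mat[of _ n n _ n] mult_smult_distrib[of _ n n _ n])
  let ?F = "four_block_mat (1\<^sub>m n) a b X"
  let ?L = "four_block_mat (1\<^sub>m n) (0\<^sub>m n n) (- b) (1\<^sub>m n)"
  have "det ?F = det (1\<^sub>m n * X - a * b)"
    by (rule det_four_block_mat) (auto simp: X1)
  then have 1: "det ?F = det (X - a * b)" by (simp add: X1)
  have "?L * ?F = four_block_mat (1\<^sub>m n * 1\<^sub>m n + 0\<^sub>m n n * b) (1\<^sub>m n * a + 0\<^sub>m n n * X)
      (- b * 1\<^sub>m n + 1\<^sub>m n * b) (- b * a + 1\<^sub>m n * X)"
    by (rule mult_four_block_mat[of _ n n _ n _ n _ _ n _ n]) auto
  also have "\<dots> = four_block_mat (1\<^sub>m n) a (0\<^sub>m n n) (X - b * a)"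
  proof -
    have "1\<^sub>m n * a + 0\<^sub>m n n * X = a" "- b * 1\<^sub>m n + 1\<^sub>m n * b = 0\<^sub>m n n"
      "1\<^sub>m n * 1\<^sub>m n + 0\<^sub>m n n * b = 1\<^sub>m n" "- b * a + 1\<^sub>m n * X = X - b * a"
      by (auto simp: X1 intro!: eq_matI simp del: index_mult_mat(1) simp: left_mult_zero_mat[of _ n n])
    then show ?thesis by (simp only:)
  qed
  finally have "det ?L * det ?F = det (four_block_mat (1\<^sub>m n) a (0\<^sub>m n n) (X - b * a))"
    using det_mult[of ?L "n + n" ?F] four_block_carrier_mat[of "1\<^sub>m n" n n] by (metis \<open>X \<in> carrier_mat n n\<close> one_carrier_mat)
  also have "\<dots> = det (X - b * a)"
    by (subst det_four_block_mat_lower_left_zero[of _ n _ n]) auto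
  also have "det ?L = 1"
    by (subst det_four_block_mat_upper_right_zero[of _ n _ n]) auto
  finally have "det (X - a * b) = det (X - b * a)" using 1 by simp
  then show ?thesis using cp[OF A B] cp[OF B A] by (simp add: a_def b_def)
qed

text \<open>Induction on the number of rank-one summands, by subadditivity of the rank.\<close>

lemma mat_rank_le_factor:
  assumes A: "A \<in> carrier_mat m n"
    and fac: "\<And>i j. i < m \<Longrightarrow> j < n \<Longrightarrow> A $$ (i, j) = (\<Sum>l<d. f i l * g l j)"
  shows "mat_rank A \<le> d"
proof -
  define B where "B d = Matrix.mat m n (\<lambda>(i, j). \<Sum>l<d. f i l * g l j)" for d
  have "vec_space.rank m (B d) \<le> d"
  proof (induction d)
    case 0
    have "B 0 = 0\<^sub>m m n" unfolding B_def by (rule eq_matI) auto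
    then show ?case by (simp only: vec_space.rank_0I)
  next
    case (Suc d)
    define R where "R = Matrix.mat m n (\<lambda>(i, j). f i d * g d j)"
    have "B (Suc d) = B d + R" unfolding B_def R_def by (rule eq_matI) auto
    moreover have "vec_space.rank m R \<le> 1" unfolding R_def
      by (rule vec_space.rank_le_1_product_entries[of _ _ n "\<lambda>i. f i d" "\<lambda>j. g d j"]) auto
    moreover have "vec_space.rank m (B d + R) \<le> vec_space.rank m (B d) + vec_space.rank m R"
      by (rule vec_space.rank_subadditive[of _ _ n]) (auto simp: B_def R_def)
    ultimately show ?case using Suc by simp
  qed
  moreover have "A = B d"
    using A fac unfolding B_def by (intro eq_matI) auto
  ultimately show ?thesis using A by (simp add: mat_rank_def)
qed

lemma parseval:
  assumes "orthonormal_basis n u"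
  shows "(\<Sum>k<n. (dot n v (u k)) * dot n w (u k)) = dot n v w"
proof -
  have "(\<Sum>k<n. (dot n v (u k)) * dot n w (u k)) =
      (\<Sum>k<n. \<Sum>i<n. \<Sum>j<n. v i * w j * (u k i * u k j))"
    by (simp add: sum_product mult_ac)
  also have "\<dots> = (\<Sum>i<n. \<Sum>k<n. \<Sum>j<n. v i * w j * (u k i * u k j))"
    by (rule sum.swap)
  also have "\<dots> = (\<Sum>i<n. \<Sum>j<n. \<Sum>k<n. v i * w j * (u k i * u k j))"
    by (intro sum.cong refl sum.swap)
  also have "\<dots> = (\<Sum>i<n. \<Sum>j<n. v i * w j * (if i = j then 1 else 0))"
    using assms by (intro sum.cong refl) (auto simp: orthonormal_basis_def simp flip: sum_distrib_left)
  also have "\<dots> = dot n v w"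
    by (simp add: if_distrib[of "(*) _"] cong: if_cong)
  finally show ?thesis .
qed

lemma quadratic_form_eigenbasis:
  assumes "orthonormal_basis n u"
    and sym: "\<And>i j. i < n \<Longrightarrow> j < n \<Longrightarrow> g i j = g j i"
    and ev: "\<And>i k. i < n \<Longrightarrow> k < n \<Longrightarrow> dot n (g i) (u k) = e k * u k i"
  shows "(\<Sum>i<n. \<Sum>j<n. g i j * v i * v j) = (\<Sum>k<n. e k * (dot n v (u k))\<^sup>2)"
proof -
  have "(\<Sum>i<n. (dot n (g i) v) * u k i) = e k * dot n v (u k)" if "k < n" for k
  proof -
    have "(\<Sum>i<n. (dot n (g i) v) * u k i) = (\<Sum>j<n. \<Sum>i<n. g i j * v j * u k i)"
      by (simp add: sum_distrib_right, rule sum.swap)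
    also have "\<dots> = (\<Sum>j<n. v j * dot n (g j) (u k))"
      by (simp add: sum_distrib_left) (intro sum.cong refl, simp add: sym)
    also have "\<dots> = e k * dot n v (u k)"
      using that by (simp add: ev sum_distrib_left mult_ac)
    finally show ?thesis .
  qed
  moreover have "(\<Sum>i<n. \<Sum>j<n. g i j * v i * v j) = (\<Sum>i<n. (dot n (g i) v) * v i)"
    by (simp add: sum_distrib_left mult_ac)
  ultimately show ?thesis
    using parseval[OF assms(1), of "\<lambda>i. \<Sum>j<n. g i j * v j" v]
    by (simp add: power2_eq_square mult.assoc)
qed

text \<open>A singular value decomposition kept one-sided: \<open>u\<close> consists of right
  singular vectors and \<open>e\<close> of squared singular values. Normalized left singular
  vectors, problematic at zero singular values, are avoided.\<close>

lemma gram_eigenbasis: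
  fixes B :: "real mat"
  assumes B: "B \<in> carrier_mat m n"
  obtains u e where "orthonormal_basis n u"
    "proots (char_poly (B\<^sup>T * B)) = mset (map e [0..<n])"
    "\<And>v. (\<Sum>k<n. e k * (dot n v (u k))\<^sup>2) = (\<Sum>a<m. (\<Sum>i<n. B $$ (a, i) * v i)\<^sup>2)"
    "\<And>k. k < n \<Longrightarrow> e k = (\<Sum>a<m. (\<Sum>i<n. B $$ (a, i) * u k i)\<^sup>2)"
    "\<And>i k. i < n \<Longrightarrow> k < n \<Longrightarrow> (\<Sum>j<n. (\<Sum>a<m. B $$ (a, i) * B $$ (a, j)) * u k j) = e k * u k i"
proof -
  define G where "G = B\<^sup>T * B"
  have G: "G \<in> carrier_mat n n" "G\<^sup>T = G"
    using B by (auto simp: G_def transpose_mult[of _ n m _ n])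
  obtain u e where onb: "orthonormal_basis n u"
    and ev: "\<And>i k. i < n \<Longrightarrow> k < n \<Longrightarrow> (\<Sum>j<n. G $$ (i, j) * u k j) = e k * u k i"
    and pr: "proots (char_poly G) = mset (map e [0..<n])"
    using spectral_theorem[OF G] by metis
  have Gij: "G $$ (i, j) = (\<Sum>a<m. B $$ (a, i) * B $$ (a, j))" if "i < n" "j < n" for i j
    using B that by (simp add: G_def scalar_prod_def lessThan_atLeast0)
  have form: "(\<Sum>i<n. \<Sum>j<n. G $$ (i, j) * v i * v j) = (\<Sum>a<m. (\<Sum>i<n. B $$ (a, i) * v i)\<^sup>2)" for v
  proof -
    have "(\<Sum>a<m. (\<Sum>i<n. B $$ (a, i) * v i)\<^sup>2)
        = (\<Sum>a<m. \<Sum>i<n. \<Sum>j<n. B $$ (a, i) * B $$ (a, j) * (v i * v j))"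
      by (simp add: power2_eq_square sum_product mult_ac)
    also have "\<dots> = (\<Sum>i<n. \<Sum>a<m. \<Sum>j<n. B $$ (a, i) * B $$ (a, j) * (v i * v j))"
      by (rule sum.swap)
    also have "\<dots> = (\<Sum>i<n. \<Sum>j<n. \<Sum>a<m. B $$ (a, i) * B $$ (a, j) * (v i * v j))"
      by (intro sum.cong refl sum.swap)
    also have "\<dots> = (\<Sum>i<n. \<Sum>j<n. G $$ (i, j) * v i * v j)"
      by (intro sum.cong refl) (simp add: Gij sum_distrib_right sum_distrib_left mult_ac)
    finally show ?thesis by simp
  qed
  have q: "(\<Sum>k<n. e k * (dot n v (u k))\<^sup>2) = (\<Sum>a<m. (\<Sum>i<n. B $$ (a, i) * v i)\<^sup>2)" for v
    unfolding form[symmetric]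
    by (rule quadratic_form_eigenbasis[OF onb, symmetric], simp add: Gij mult.commute, erule (1) ev)
  show ?thesis
  proof (rule that[of u e])
    show "e k = (\<Sum>a<m. (\<Sum>i<n. B $$ (a, i) * u k i)\<^sup>2)" if "k < n" for k
    proof -
      have "(\<Sum>a<m. (\<Sum>i<n. B $$ (a, i) * u k i)\<^sup>2) = (\<Sum>l<n. e l * (if k = l then 1 else 0))"
        unfolding q[symmetric] using that onb by (intro sum.cong) (auto simp: orthonormal_basis_def)
      then show ?thesis using that by (simp add: if_distrib[of "(*) _"] cong: if_cong)
    qed
    show "(\<Sum>j<n. (\<Sum>a<m. B $$ (a, i) * B $$ (a, j)) * u k j) = e k * u k i" if "i < n" "k < n" for i k
      using ev[OF that] that by (simp add: Gij)
  qed (use onb q pr in \<open>auto simp: G_def\<close>)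
qed

lemma nth_rev_sorted_ge:
  fixes M :: "'a :: linorder multiset"
  assumes "r \<ge> 1" "r \<le> size (filter_mset (\<lambda>x. a \<le> x) M)"
  shows "a \<le> rev (sorted_list_of_multiset M) ! (r - 1)"
proof (rule ccontr)
  define xs where "xs = rev (sorted_list_of_multiset M)"
  have srt: "sorted (rev xs)" and M: "mset xs = M" by (auto simp: xs_def)
  assume "\<not> a \<le> rev (sorted_list_of_multiset M) ! (r - 1)"
  then have lt: "xs ! (r - 1) < a" by (simp add: xs_def)
  have len: "r \<le> length xs"
    using assms(2) size_filter_mset_lesseq[of "\<lambda>x. a \<le> x" M] by (simp flip: M)
  have "filter (\<lambda>x. a \<le> x) (drop (r - 1) xs) = []"
  proof -
    have "x < a" if x: "x \<in> set (drop (r - 1) xs)" for x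
    proof -
      obtain i where "i < length (drop (r - 1) xs)" "drop (r - 1) xs ! i = x"
        using x unfolding in_set_conv_nth by blast
      then have i: "i < length xs - (r - 1)" "x = xs ! (r - 1 + i)" using len by auto
      then have "x \<le> xs ! (r - 1)"
        using sorted_rev_nth_mono[OF srt, of "r - 1" "r - 1 + i"] by simp
      then show ?thesis using lt by simp
    qed
    then show ?thesis by (force simp: filter_empty_conv)
  qed
  then have "filter (\<lambda>x. a \<le> x) xs = filter (\<lambda>x. a \<le> x) (take (r - 1) xs)"
    by (metis append_Nil2 append_take_drop_id filter_append)
  then have "length (filter (\<lambda>x. a \<le> x) xs) \<le> r - 1"
    by (metis length_filter_le length_take min.bounded_iff order_trans)
  moreover have "size (filter_mset (\<lambda>x. a \<le> x) M) = length (filter (\<lambda>x. a \<le> x) xs)"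
    unfolding M[symmetric] mset_filter[symmetric] size_mset ..
  ultimately show False using assms by linarith
qed

text \<open>A Courant-Fischer argument on the first \<open>r\<close> rows. If fewer than
  \<open>r\<close> eigenvalues reach \<open>lam^2\<close>, some unit \<open>x\<close> combines these
  rows to a vector \<open>v\<close> orthogonal to the corresponding eigenvectors, so
  \<open>|A v|^2 < lam^2 |v|^2\<close>. But \<open>|v|^2\<close> is the inner product of
  \<open>x\<close> with the first \<open>r\<close> entries of \<open>A v\<close>, and Cauchy-Schwarz
  then contradicts \<open>|v|^2 \<ge> lam^2\<close>.\<close>

lemma singular_value_ge:
  fixes A :: "real mat"
  assumes A: "A \<in> carrier_mat m n" and "1 \<le> r" "r \<le> m" "lam > 0"
    and lower: "\<And>x. (\<Sum>c<n. (\<Sum>i<r. x i * A $$ (i, c))\<^sup>2) \<ge> lam\<^sup>2 * sumsq r x"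
  shows "singular_value r A \<ge> lam"
proof -
  obtain u e where onb: "orthonormal_basis n u"
    and pr: "proots (char_poly (A\<^sup>T * A)) = mset (map e [0..<n])"
    and q: "\<And>v. (\<Sum>k<n. e k * (dot n v (u k))\<^sup>2) = (\<Sum>a<m. (\<Sum>i<n. A $$ (a, i) * v i)\<^sup>2)"
    by (rule gram_eigenbasis[OF A]) blast
  define I where "I = {k. k < n \<and> lam\<^sup>2 \<le> e k}"
  have "finite I" by (simp add: I_def)
  have "r \<le> card I"
  proof (rule ccontr)
    assume "\<not> r \<le> card I"
    then have "card I < r" by simp
    obtain h where h: "bij_betw h {..<card I} I"
      using ex_bij_betw_nat_finite[OF \<open>finite I\<close>] by (auto simp: lessThan_atLeast0)
    obtain x where x: "sumsq r x = 1"
      "\<And>l. l < card I \<Longrightarrow> (\<Sum>i<r. (\<Sum>c<n. A $$ (i, c) * u (h l) c) * x i) = 0"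
      by (rule orthogonal_vector_exists[OF \<open>card I < r\<close>, of "\<lambda>l i. \<Sum>c<n. A $$ (i, c) * u (h l) c"]) blast
    define v where "v c = (\<Sum>i<r. x i * A $$ (i, c))" for c
    define N where "N = sumsq n v"
    have N: "N \<ge> lam\<^sup>2" using lower[of x] x(1) by (simp add: N_def v_def)
    have "N > 0" using N \<open>lam > 0\<close> by (meson less_le_trans zero_less_power)
    have z: "dot n v (u k) = 0" if k: "k \<in> I" for k
    proof -
      obtain l where l: "l < card I" "h l = k" using h k by (metis bij_betw_imp_surj_on imageE lessThan_iff)
      have "dot n v (u k) = (\<Sum>i<r. (\<Sum>c<n. A $$ (i, c) * u k c) * x i)"
        by (simp add: v_def sum_distrib_right, subst sum.swap) (simp add: mult_ac)
      then show ?thesis using x(2)[OF l(1)] l(2) by simp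
    qed
    have P: "(\<Sum>k<n. (dot n v (u k))\<^sup>2) = N"
      using parseval[OF onb, of v v] by (simp add: N_def power2_eq_square)
    have "(\<Sum>k<n. e k * (dot n v (u k))\<^sup>2) < (\<Sum>k<n. lam\<^sup>2 * (dot n v (u k))\<^sup>2)"
    proof (rule sum_strict_mono_ex1)
      show "\<forall>k\<in>{..<n}. e k * (dot n v (u k))\<^sup>2 \<le> lam\<^sup>2 * (dot n v (u k))\<^sup>2"
      proof
        fix k assume "k \<in> {..<n}"
        then show "e k * (dot n v (u k))\<^sup>2 \<le> lam\<^sup>2 * (dot n v (u k))\<^sup>2"
          using z[of k] by (cases "k \<in> I") (auto simp: I_def intro!: mult_right_mono)
      qed
      have "\<exists>k<n. (dot n v (u k)) \<noteq> 0"
        using P \<open>N > 0\<close> by (metis (no_types, lifting) lessThan_iff less_irrefl sum.neutral zero_power2)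
      then obtain k where k: "k < n" "dot n v (u k) \<noteq> 0" by blast
      then have "e k < lam\<^sup>2" using z[of k] by (force simp: I_def)
      then show "\<exists>k\<in>{..<n}. e k * (dot n v (u k))\<^sup>2 < lam\<^sup>2 * (dot n v (u k))\<^sup>2"
        using k by (intro bexI[of _ k]) (auto intro!: mult_strict_right_mono)
    qed simp
    also have "\<dots> = lam\<^sup>2 * N" by (simp add: P flip: sum_distrib_left)
    finally have up: "(\<Sum>a<m. (\<Sum>c<n. A $$ (a, c) * v c)\<^sup>2) < lam\<^sup>2 * N" unfolding q .
    have "N = (\<Sum>i<r. x i * (\<Sum>c<n. A $$ (i, c) * v c))"
    proof -
      have "N = (\<Sum>c<n. \<Sum>i<r. x i * A $$ (i, c) * v c)"
        by (simp add: N_def power2_eq_square sum_distrib_right) (simp add: v_def sum_distrib_right)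
      also have "\<dots> = (\<Sum>i<r. \<Sum>c<n. x i * A $$ (i, c) * v c)" by (rule sum.swap)
      finally show ?thesis by (simp add: sum_distrib_left mult.assoc)
    qed
    then have "N\<^sup>2 \<le> sumsq r x * (\<Sum>i<r. (\<Sum>c<n. A $$ (i, c) * v c)\<^sup>2)"
      using Cauchy_Schwarz_ineq_sum[of x "\<lambda>i. \<Sum>c<n. A $$ (i, c) * v c" "{..<r}"] by simp
    also have "\<dots> \<le> (\<Sum>a<m. (\<Sum>c<n. A $$ (a, c) * v c)\<^sup>2)"
      unfolding x(1) using \<open>r \<le> m\<close> by (simp, intro sum_mono2) auto
    finally have "N * N < lam\<^sup>2 * N" using up by (simp add: power2_eq_square)
    then show False using N \<open>N > 0\<close> by simp
  qed
  moreover have "size (filter_mset (\<lambda>x. lam \<le> x) (image_mset sqrt (mset (map e [0..<n])))) \<ge> card I"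
  proof -
    have "I \<subseteq> {k. k < n \<and> lam \<le> sqrt (e k)}"
      using \<open>lam > 0\<close> by (auto simp: I_def real_le_rsqrt)
    then have "card I \<le> card {k. k < n \<and> lam \<le> sqrt (e k)}" by (intro card_mono) auto
    also have "\<dots> = length (filter (\<lambda>k. lam \<le> sqrt (e k)) [0..<n])"
      by (subst length_filter_conv_card) (rule arg_cong[where f = card], auto)
    also have "\<dots> = size (mset (filter (\<lambda>x. lam \<le> x) (map sqrt (map e [0..<n]))))"
      by (simp only: filter_map size_mset length_map o_def)
    finally show ?thesis by (simp only: mset_filter mset_map)
  qed
  ultimately show ?thesis
    unfolding singular_value_def singular_values_def pr
    by (intro nth_rev_sorted_ge) (use \<open>1 \<le> r\<close> in auto)
qed

section \<open>Subspace distances and projections\<close>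

text \<open>Operator norm at most one, stated through the bilinear form so that transposition and
  padding by zeros are immediate. Contractions form the dual unit ball of the nuclear norm.\<close>

definition contraction :: "nat \<Rightarrow> nat \<Rightarrow> (nat \<Rightarrow> nat \<Rightarrow> real) \<Rightarrow> bool" where
  "contraction m n K \<longleftrightarrow> (\<forall>x y. \<bar>\<Sum>i<m. \<Sum>j<n. K i j * x i * y j\<bar>
     \<le> sqrt (sumsq m x) * sqrt (sumsq n y))"

text \<open>The entries of \<open>U U^T\<close>. For orthonormal columns it depends only on the
  column space, so the choice of singular vectors drops out.\<close>

definition proj :: "real mat \<Rightarrow> nat \<Rightarrow> nat \<Rightarrow> real" where
  "proj U a b = (\<Sum>l<dim_col U. U $$ (a, l) * U $$ (b, l))"

lemma proj_sym: "proj U a b = proj U b a"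
  by (simp add: proj_def mult.commute)

lemma contraction_transpose:
  assumes "contraction m n K" shows "contraction n m (\<lambda>i j. K j i)"
  unfolding contraction_def
proof (intro allI)
  fix x y :: "nat \<Rightarrow> real"
  have "(\<Sum>i<n. \<Sum>j<m. K j i * x i * y j) = (\<Sum>j<m. \<Sum>i<n. K j i * y j * x i)"
    by (subst sum.swap) (simp add: mult_ac)
  moreover have "\<bar>\<Sum>j<m. \<Sum>i<n. K j i * y j * x i\<bar> \<le> sqrt (sumsq m y) * sqrt (sumsq n x)"
    using assms unfolding contraction_def by blast
  ultimately show "\<bar>\<Sum>i<n. \<Sum>j<m. K j i * x i * y j\<bar> \<le> sqrt (sumsq n x) * sqrt (sumsq m y)"
    by (simp only: mult.commute[of "sqrt (sumsq m y)"])
qed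

lemma orthonormal_matsD:
  assumes "U \<in> orthonormal_mats p r"
  shows "U \<in> carrier_mat p r" "dim_col U = r"
    "\<And>l l'. l < r \<Longrightarrow> l' < r \<Longrightarrow> (\<Sum>a<p. U $$ (a, l) * U $$ (a, l')) = (if l = l' then 1 else 0)"
proof -
  show U: "U \<in> carrier_mat p r" and "dim_col U = r" using assms by (auto simp: orthonormal_mats_def)
  fix l l' assume l: "l < r" "l' < r"
  have "(U\<^sup>T * U) $$ (l, l') = (\<Sum>a<p. U $$ (a, l) * U $$ (a, l'))"
    using U l by (simp add: scalar_prod_def lessThan_atLeast0)
  then show "(\<Sum>a<p. U $$ (a, l) * U $$ (a, l')) = (if l = l' then 1 else 0)"
    using assms l by (simp add: orthonormal_mats_def)
qed

lemma orthonormal_comb_norm: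
  assumes "U \<in> orthonormal_mats p r"
  shows "(\<Sum>a<p. (\<Sum>l<r. U $$ (a, l) * x l)\<^sup>2) = sumsq r x"
proof -
  have "(\<Sum>a<p. (\<Sum>l<r. U $$ (a, l) * x l)\<^sup>2)
      = (\<Sum>a<p. \<Sum>l<r. \<Sum>l'<r. U $$ (a, l) * U $$ (a, l') * (x l * x l'))"
    by (simp add: power2_eq_square sum_product mult_ac)
  also have "\<dots> = (\<Sum>l<r. \<Sum>a<p. \<Sum>l'<r. U $$ (a, l) * U $$ (a, l') * (x l * x l'))"
    by (rule sum.swap)
  also have "\<dots> = (\<Sum>l<r. \<Sum>l'<r. \<Sum>a<p. U $$ (a, l) * U $$ (a, l') * (x l * x l'))"
    by (intro sum.cong refl sum.swap)
  also have "\<dots> = (\<Sum>l<r. \<Sum>l'<r. (if l = l' then 1 else 0) * (x l * x l'))"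
    using orthonormal_matsD(3)[OF assms] by (intro sum.cong refl) (simp flip: sum_distrib_right)
  also have "\<dots> = sumsq r x"
    by (simp add: if_distrib[of "\<lambda>x. x * _"] power2_eq_square cong: if_cong)
  finally show ?thesis .
qed

lemma proj_apply:
  assumes "U \<in> orthonormal_mats p r"
  shows "(\<Sum>b<p. proj U a b * x b) = (\<Sum>l<r. U $$ (a, l) * (\<Sum>b<p. U $$ (b, l) * x b))"
proof -
  have "(\<Sum>b<p. proj U a b * x b) = (\<Sum>b<p. \<Sum>l<r. U $$ (a, l) * U $$ (b, l) * x b)"
    using orthonormal_matsD(2)[OF assms] by (simp add: proj_def sum_distrib_right)
  also have "\<dots> = (\<Sum>l<r. \<Sum>b<p. U $$ (a, l) * U $$ (b, l) * x b)" by (rule sum.swap)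
  finally show ?thesis by (simp add: sum_distrib_left mult.assoc)
qed

lemma proj_residual_norm:
  assumes U: "U \<in> orthonormal_mats p r"
  shows "(\<Sum>a<p. (x a - (\<Sum>b<p. proj U a b * x b))\<^sup>2)
    = sumsq p x - (\<Sum>l<r. (\<Sum>b<p. U $$ (b, l) * x b)\<^sup>2)"
proof -
  define t where "t l = (\<Sum>b<p. U $$ (b, l) * x b)" for l
  define y where "y a = (\<Sum>l<r. U $$ (a, l) * t l)" for a
  have "dot p x y = (\<Sum>l<r. \<Sum>a<p. x a * (U $$ (a, l) * t l))"
    unfolding y_def sum_distrib_left by (rule sum.swap)
  also have "\<dots> = dot r t t"
    by (intro sum.cong refl) (simp add: t_def sum_distrib_left sum_distrib_right mult_ac)
  finally have xy: "dot p x y = sumsq r t"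
    by (simp add: power2_eq_square)
  have yy: "sumsq p y = sumsq r t"
    unfolding y_def by (rule orthonormal_comb_norm[OF U])
  have "(\<Sum>a<p. (x a - y a)\<^sup>2) = sumsq p x - 2 * dot p x y + sumsq p y"
    by (simp add: power2_diff sum.distrib sum_subtractf sum_distrib_left mult.assoc)
  then show ?thesis
    unfolding proj_apply[OF U] using xy yy by (simp add: y_def t_def)
qed

abbreviation cos_sq :: "real mat \<Rightarrow> real mat \<Rightarrow> real multiset" where
  "cos_sq V U \<equiv> proots (char_poly ((V\<^sup>T * U)\<^sup>T * (V\<^sup>T * U)))"

text \<open>Diagonalizing the Gram matrix of \<open>V^T U\<close> rotates the columns of
  \<open>U\<close> into principal vectors \<open>w k\<close>; the distance of \<open>w k\<close>
  from the range of \<open>V\<close> is the sine of the \<open>k\<close>-th principal angle, and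
  \<open>e k\<close> its squared cosine.\<close>

lemma principal_vectors:
  assumes V: "V \<in> orthonormal_mats p r" and U: "U \<in> orthonormal_mats p r"
  obtains e w where
    "cos_sq V U = mset (map e [0..<r])"
    "\<And>k. k < r \<Longrightarrow> 0 \<le> e k \<and> e k \<le> 1"
    "\<And>k. k < r \<Longrightarrow> (sumsq p (w k)) = 1"
    "\<And>k. k < r \<Longrightarrow> (\<Sum>a<p. (w k a - (\<Sum>b<p. proj V a b * w k b))\<^sup>2) = 1 - e k"
    "\<And>a b. proj U a b = (\<Sum>k<r. w k a * w k b)"
proof -
  note Vd = orthonormal_matsD[OF V] and Ud = orthonormal_matsD[OF U]
  have B: "V\<^sup>T * U \<in> carrier_mat r r" using Vd(1) Ud(1) by simp
  obtain u e where onb: "orthonormal_basis r u"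
    and pr: "cos_sq V U = mset (map e [0..<r])"
    and ek: "\<And>k. k < r \<Longrightarrow> e k = (\<Sum>a<r. (\<Sum>i<r. (V\<^sup>T * U) $$ (a, i) * u k i)\<^sup>2)"
    by (rule gram_eigenbasis[OF B]) (rule that)
  define w where "w k a = (\<Sum>l<r. U $$ (a, l) * u k l)" for k a
  have t: "(\<Sum>i<r. (V\<^sup>T * U) $$ (l, i) * u k i) = (\<Sum>b<p. V $$ (b, l) * w k b)"
    if "l < r" for l k
  proof -
    have "(\<Sum>i<r. (V\<^sup>T * U) $$ (l, i) * u k i)
        = (\<Sum>i<r. \<Sum>b<p. V $$ (b, l) * U $$ (b, i) * u k i)"
      using that Vd(1) Ud(1) by (simp add: scalar_prod_def sum_distrib_right lessThan_atLeast0)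
    also have "\<dots> = (\<Sum>b<p. \<Sum>i<r. V $$ (b, l) * U $$ (b, i) * u k i)" by (rule sum.swap)
    finally show ?thesis by (simp add: w_def sum_distrib_left mult.assoc)
  qed
  have w1: "sumsq p (w k) = 1" if "k < r" for k
    using onb that by (simp add: w_def orthonormal_comb_norm[OF U]) (simp add: orthonormal_basis_def power2_eq_square)
  have res: "(\<Sum>a<p. (w k a - (\<Sum>b<p. proj V a b * w k b))\<^sup>2) = 1 - e k" if "k < r" for k
    using that t by (simp add: proj_residual_norm[OF V] w1 ek)
  show ?thesis
  proof (rule that[of e w])
    show "0 \<le> e k \<and> e k \<le> 1" if "k < r" for k
    proof
      show "0 \<le> e k" using ek[OF that] by (simp add: sum_nonneg)
      have "0 \<le> 1 - e k" unfolding res[OF that, symmetric] by (rule sum_nonneg) simp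
      then show "e k \<le> 1" by simp
    qed
    show "proj U a b = (\<Sum>k<r. w k a * w k b)" for a b
      unfolding w_def proj_def Ud(2) by (rule parseval[OF onb, symmetric])
  qed (fact pr, fact w1, fact res)
qed

text \<open>In the principal basis, \<open>(1 - P_V) P_U\<close> is a sum of rank-one matrices whose
  left factors have the sines as lengths and whose right factors are unit vectors; a contraction
  pairs with each of them to at most the sine.\<close>

lemma one_sided_projection_bound:
  assumes V: "V \<in> orthonormal_mats p r" and U: "U \<in> orthonormal_mats p r"
    and M: "contraction p p M"
  shows "\<bar>\<Sum>a<p. \<Sum>b<p. M a b * (proj U a b - (\<Sum>c<p. proj V a c * proj U c b))\<bar>
    \<le> (\<Sum>x\<in>#cos_sq V U. sqrt (1 - x))"
proof -
  obtain e w where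
    pr: "cos_sq V U = mset (map e [0..<r])"
    and w1: "\<And>k. k < r \<Longrightarrow> (sumsq p (w k)) = 1"
    and res: "\<And>k. k < r \<Longrightarrow> (\<Sum>a<p. (w k a - (\<Sum>b<p. proj V a b * w k b))\<^sup>2) = 1 - e k"
    and pU: "\<And>a b. proj U a b = (\<Sum>k<r. w k a * w k b)"
    by (rule principal_vectors[OF V U]) (rule that)
  define N where "N k a = w k a - (\<Sum>b<p. proj V a b * w k b)" for k a
  have N: "proj U a b - (\<Sum>c<p. proj V a c * proj U c b) = (\<Sum>k<r. N k a * w k b)" for a b
  proof -
    have "(\<Sum>c<p. proj V a c * proj U c b) = (\<Sum>k<r. \<Sum>c<p. proj V a c * (w k c * w k b))"
      by (simp add: pU sum_distrib_left, rule sum.swap)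
    then show ?thesis
      by (simp add: pU N_def left_diff_distrib sum_subtractf sum_distrib_right mult.assoc)
  qed
  have "(\<Sum>a<p. \<Sum>b<p. M a b * (proj U a b - (\<Sum>c<p. proj V a c * proj U c b)))
      = (\<Sum>a<p. \<Sum>b<p. \<Sum>k<r. M a b * N k a * w k b)"
    unfolding N by (simp add: sum_distrib_left mult.assoc)
  also have "\<dots> = (\<Sum>a<p. \<Sum>k<r. \<Sum>b<p. M a b * N k a * w k b)"
    by (intro sum.cong refl sum.swap)
  also have "\<dots> = (\<Sum>k<r. \<Sum>a<p. \<Sum>b<p. M a b * N k a * w k b)" by (rule sum.swap)
  finally have "\<bar>\<Sum>a<p. \<Sum>b<p. M a b * (proj U a b - (\<Sum>c<p. proj V a c * proj U c b))\<bar>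
      \<le> (\<Sum>k<r. \<bar>\<Sum>a<p. \<Sum>b<p. M a b * N k a * w k b\<bar>)" by (simp only: sum_abs)
  also have "\<dots> \<le> (\<Sum>k<r. sqrt (1 - e k))"
  proof (rule sum_mono)
    fix k assume "k \<in> {..<r}"
    then have "sumsq p (N k) = 1 - e k" "sumsq p (w k) = 1"
      using res w1 by (auto simp: N_def)
    moreover have "\<bar>\<Sum>a<p. \<Sum>b<p. M a b * N k a * w k b\<bar>
      \<le> sqrt (sumsq p (N k)) * sqrt (sumsq p (w k))"
      using M unfolding contraction_def by blast
    ultimately show "\<bar>\<Sum>a<p. \<Sum>b<p. M a b * N k a * w k b\<bar> \<le> sqrt (1 - e k)" by simp
  qed
  also have "\<dots> = (\<Sum>x\<in>#mset (map e [0..<r]). sqrt (1 - x))"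
    by (simp add: sum_unfold_sum_mset lessThan_atLeast0 flip: mset_upt image_mset.compositionality)
       (simp add: image_mset.compositionality o_def)
  finally show ?thesis unfolding pr .
qed

text \<open>\<open>P_V - P_U = P_V (1 - P_U) - (1 - P_V) P_U\<close>, where the first term is the
  transpose of \<open>(1 - P_U) P_V\<close>. Both orders of the subspaces give the same angles by
  \<open>char_poly_mult_commute\<close>, so the one-sided bound applies twice.\<close>

lemma projection_distance_bound:
  assumes V: "V \<in> orthonormal_mats p r" and U: "U \<in> orthonormal_mats p r"
    and M: "contraction p p M"
  shows "\<bar>\<Sum>a<p. \<Sum>b<p. M a b * (proj V a b - proj U a b)\<bar> \<le> 2 *
    (\<Sum>x\<in>#cos_sq V U. sqrt (1 - x))"
    (is "_ \<le> 2 * ?S")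
proof -
  have c: "V \<in> carrier_mat p r" "U \<in> carrier_mat p r"
    using V U by (auto dest: orthonormal_matsD(1))
  define B where "B = V\<^sup>T * U"
  have B: "B \<in> carrier_mat r r" using c by (simp add: B_def)
  have Bt: "U\<^sup>T * V = B\<^sup>T" using c by (simp add: B_def transpose_mult[of _ r p _ r])
  have swap: "char_poly ((U\<^sup>T * V)\<^sup>T * (U\<^sup>T * V))
      = char_poly (B\<^sup>T * B)"
    unfolding Bt using char_poly_mult_commute[of B r "B\<^sup>T"] B by simp
  have 1: "\<bar>\<Sum>a<p. \<Sum>b<p. M a b * (proj U a b - (\<Sum>c<p. proj V a c * proj U c b))\<bar> \<le> ?S"
    by (rule one_sided_projection_bound[OF V U M])
  have 2: "\<bar>\<Sum>b<p. \<Sum>a<p. M a b * (proj V b a - (\<Sum>c<p. proj U b c * proj V c a))\<bar> \<le> ?S"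
    using one_sided_projection_bound[OF U V contraction_transpose[OF M]] unfolding swap by (simp add: B_def)
  have inner: "(\<Sum>c<p. proj U b c * proj V c a) = (\<Sum>c<p. proj V a c * proj U c b)" for a b
    by (intro sum.cong refl) (simp add: proj_sym[of U b] proj_sym[of V a] mult.commute)
  have "(\<Sum>b<p. \<Sum>a<p. M a b * (proj V b a - (\<Sum>c<p. proj U b c * proj V c a)))
      = (\<Sum>a<p. \<Sum>b<p. M a b * (proj V a b - (\<Sum>c<p. proj V a c * proj U c b)))"
    unfolding inner by (subst sum.swap) (simp only: proj_sym)
  then have "(\<Sum>a<p. \<Sum>b<p. M a b * (proj V a b - proj U a b))
    = (\<Sum>b<p. \<Sum>a<p. M a b * (proj V b a - (\<Sum>c<p. proj U b c * proj V c a)))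
    - (\<Sum>a<p. \<Sum>b<p. M a b * (proj U a b - (\<Sum>c<p. proj V a c * proj U c b)))"
    by (simp add: right_diff_distrib flip: sum_subtractf)
  then show ?thesis using 1 2 by linarith
qed

text \<open>Young's inequality for each \<open>s i / m\<close>, where \<open>m\<close> is the power
  mean itself; summing makes the right-hand side collapse to \<open>card A\<close>.\<close>

lemma power_mean_ge_mean:
  fixes s :: "'a \<Rightarrow> real"
  assumes "finite A" "A \<noteq> {}" "1 \<le> q" and s: "\<And>i. i \<in> A \<Longrightarrow> 0 \<le> s i"
  shows "(\<Sum>i\<in>A. s i) / card A \<le> real (card A) powr (- (1 / q)) * (\<Sum>i\<in>A. s i powr q) powr (1 / q)"
proof (cases "\<exists>i\<in>A. s i > 0")
  case False
  then have "s i = 0" if "i \<in> A" for i using s[OF that] that by force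
  then show ?thesis by simp
next
  case True
  define N where "N = real (card A)"
  have "N > 0" using assms by (simp add: N_def card_gt_0_iff)
  define S where "S = (\<Sum>i\<in>A. s i powr q)"
  have "S > 0" unfolding S_def using True assms(1) by (auto intro!: sum_pos2)
  define m where "m = (S / N) powr (1 / q)"
  have "m > 0" using \<open>S > 0\<close> \<open>N > 0\<close> by (simp add: m_def)
  have mq: "m powr q = S / N" using assms(3) \<open>S > 0\<close> \<open>N > 0\<close> by (simp add: m_def powr_powr)
  have "s i / m \<le> (s i powr q / m powr q) / q + (1 - 1 / q)" if "i \<in> A" for i
  proof (cases "s i = 0")
    case True
    then show ?thesis using assms(3) by simp
  next
    case False
    then have "s i > 0" using s[OF that] by simp
    have "((s i / m) powr q) powr (1 / q) * 1 powr (1 - 1 / q) \<le> (1 / q) * (s i / m) powr q + (1 - 1 / q) * 1"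
      by (rule Youngs_inequality_0) (use assms(3) \<open>s i > 0\<close> \<open>m > 0\<close> in auto)
    moreover have "((s i / m) powr q) powr (1 / q) = s i / m"
    proof -
      have "q * (1 / q) = 1" "0 \<le> s i / m" using assms(3) s[OF that] \<open>m > 0\<close> by auto
      then show ?thesis unfolding powr_powr using \<open>s i > 0\<close> \<open>m > 0\<close> by simp
    qed
    moreover have "(s i / m) powr q = s i powr q / m powr q"
      using s[OF that] \<open>m > 0\<close> by (simp add: powr_divide)
    ultimately show ?thesis by (simp add: mult.commute)
  qed
  then have "(\<Sum>i\<in>A. s i / m) \<le> (\<Sum>i\<in>A. (s i powr q / m powr q) / q + (1 - 1 / q))" by (rule sum_mono)
  also have "\<dots> = S / m powr q / q + N * (1 - 1 / q)"
    by (simp add: sum.distrib S_def N_def sum_divide_distrib)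
  also have "\<dots> = N" unfolding mq using \<open>S > 0\<close> \<open>N > 0\<close> assms(3) by (simp add: field_simps)
  finally have "(\<Sum>i\<in>A. s i) / N \<le> m"
    using \<open>m > 0\<close> \<open>N > 0\<close> by (simp add: field_simps flip: sum_divide_distrib)
  also have "m = N powr (- (1 / q)) * S powr (1 / q)"
    using \<open>S > 0\<close> \<open>N > 0\<close> by (simp add: m_def powr_divide powr_minus_divide)
  finally show ?thesis by (simp add: N_def S_def)
qed

text \<open>Reduces every \<open>q\<close> to the mean of the sines, the quantity that pairings with
  contractions control: power means increase with the exponent, and for
  \<open>q = \<infinity>\<close> the smallest cosine belongs to the largest sine.\<close>

lemma sin_theta_norm_ge_mean:
  assumes V: "V \<in> orthonormal_mats p r" and U: "U \<in> orthonormal_mats p r" and "1 \<le> r" "1 \<le> q"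
  shows "(\<Sum>x\<in>#cos_sq V U. sqrt (1 - x)) / r
    \<le> real r powr (- real_of_ereal (1 / q)) * sin_theta_norm q V U"
proof -
  obtain e where pr: "cos_sq V U = mset (map e [0..<r])"
    and e: "\<And>k. k < r \<Longrightarrow> 0 \<le> e k \<and> e k \<le> 1"
    by (rule principal_vectors[OF V U]) (rule that)
  define B where "B = V\<^sup>T * U"
  note pr = pr[folded B_def]
  define L where "L = singular_values B"
  have mL: "mset L = image_mset sqrt (mset (map e [0..<r]))"
    by (simp add: L_def singular_values_def pr)
  then have mL': "mset L = mset (map (sqrt \<circ> e) [0..<r])"
    by (simp only: mset_map image_mset.compositionality)
  then have len: "length L = r" and setL: "set L = (sqrt \<circ> e) ` {..<r}"
    using mset_eq_length[OF mL'] mset_eq_setD[OF mL'] by (simp_all add: lessThan_atLeast0)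
  have srt: "sorted (rev L)" by (simp add: L_def singular_values_def)
  have L01: "0 \<le> L ! i \<and> L ! i \<le> 1" if "i < r" for i
  proof -
    have "L ! i \<in> set L" using that len by simp
    then show ?thesis unfolding setL using e by auto
  qed
  define s where "s i = sqrt (1 - (singular_value i B)\<^sup>2)" for i
  have s0: "0 \<le> s i" if "i \<in> {1..r}" for i
    using that L01[of "i - 1"] by (auto simp: s_def singular_value_def L_def abs_square_le_1)
  have "(\<Sum>x\<in>#mset (map e [0..<r]). sqrt (1 - x)) = (\<Sum>x\<in>#mset L. sqrt (1 - x\<^sup>2))"
    unfolding mL using e by (auto intro!: arg_cong[where f = sum_mset] image_mset_cong simp: image_mset.compositionality o_def)
  also have "\<dots> = (\<Sum>i<r. sqrt (1 - (L ! i)\<^sup>2))"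
    by (metis (no_types, lifting) len lessThan_atLeast0 mset_map sum_list_sum_nth sum_mset_sum_list length_map nth_map sum.cong atLeastLessThan_iff)
  also have "\<dots> = (\<Sum>i = 1..r. s i)"
    unfolding s_def singular_value_def L_def[symmetric]
    by (rule sum.reindex_bij_witness[of _ "\<lambda>i. i - 1" "\<lambda>i. i + 1"]) auto
  finally have sum: "(\<Sum>x\<in>#proots (char_poly (B\<^sup>T * B)). sqrt (1 - x)) = (\<Sum>i = 1..r. s i)"
    unfolding pr .
  have dim: "dim_col V = r" using orthonormal_matsD(2)[OF V] .
  show ?thesis
  proof (cases "q = \<infinity>")
    case True
    have "(\<Sum>i = 1..r. s i) \<le> (\<Sum>i = 1..r. s r)"
    proof (rule sum_mono)
      fix i assume i: "i \<in> {1..r}"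
      then have "L ! (r - 1) \<le> L ! (i - 1)"
        using sorted_rev_nth_mono[OF srt, of "i - 1" "r - 1"] len by auto
      then have "(L ! (r - 1))\<^sup>2 \<le> (L ! (i - 1))\<^sup>2"
        using L01[of "r - 1"] \<open>1 \<le> r\<close> by (intro power_mono) auto
      then show "s i \<le> s r" by (simp add: s_def singular_value_def L_def)
    qed
    then have "(\<Sum>i = 1..r. s i) / r \<le> s r" using \<open>1 \<le> r\<close> by (simp add: field_simps)
    \<comment> \<open>For \<open>q = \<infinity>\<close> the exponent \<open>1 / q\<close> is
      \<open>0\<close>, so the normalizing power of \<open>r\<close> equals
      \<open>1\<close>.\<close>
    then show ?thesis
      using True \<open>1 \<le> r\<close> dim sum by (simp add: sin_theta_norm_def Let_def B_def[symmetric] s_def)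
  next
    case False
    then obtain q' where q: "q = ereal q'" "1 \<le> q'" using \<open>1 \<le> q\<close> by (cases q) auto
    have "(\<Sum>i = 1..r. s i) / card {1..r}
        \<le> real (card {1..r}) powr (- (1 / q')) * (\<Sum>i = 1..r. s i powr q') powr (1 / q')"
      by (rule power_mean_ge_mean) (use \<open>1 \<le> r\<close> q s0 in auto)
    moreover have "(\<Sum>i = 1..r. s i powr q') = (\<Sum>i = 1..r. (1 - (singular_value i B)\<^sup>2) powr (q' / 2))"
    proof (rule sum.cong)
      show "s i powr q' = (1 - (singular_value i B)\<^sup>2) powr (q' / 2)" if "i \<in> {1..r}" for i
        using s0[OF that] unfolding s_def by (simp add: powr_half_sqrt[symmetric] powr_powr)
    qed simp
    ultimately show ?thesis
      using q dim sum by (simp add: sin_theta_norm_def Let_def B_def[symmetric] one_ereal_def)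
  qed
qed

section \<open>Contractions as certificates\<close>

lemma sum_rectangle_pad:
  fixes f :: "nat \<Rightarrow> nat \<Rightarrow> real"
  assumes "p = r + n"
  shows "(\<Sum>a<p. \<Sum>b<p. (if r \<le> a \<and> b < r then f (a - r) b else 0)) = (\<Sum>i<n. \<Sum>j<r. f i j)"
proof -
  have "(\<Sum>b<p. (if r \<le> a \<and> b < r then f (a - r) b else 0)) = (if r \<le> a then \<Sum>j<r. f (a - r) j else 0)" for a
  proof -
    have "(\<Sum>b<p. (if r \<le> a \<and> b < r then f (a - r) b else 0))
        = (\<Sum>b\<in>{..<p} \<inter> {b. b < r}. if r \<le> a then f (a - r) b else 0)"
      by (subst sum.inter_restrict) (auto intro!: sum.cong)
    also have "{..<p} \<inter> {b. b < r} = {..<r}" using assms by auto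
    finally show ?thesis by simp
  qed
  then have "(\<Sum>a<p. \<Sum>b<p. (if r \<le> a \<and> b < r then f (a - r) b else 0))
      = (\<Sum>a<p. if r \<le> a then \<Sum>j<r. f (a - r) j else 0)" by simp
  also have "\<dots> = (\<Sum>a\<in>{r..<p}. \<Sum>j<r. f (a - r) j)"
    by (rule sum.mono_neutral_cong_right) auto
  also have "\<dots> = (\<Sum>i<n. \<Sum>j<r. f i j)"
    by (rule sum.reindex_bij_witness[of _ "\<lambda>i. i + r" "\<lambda>a. a - r"]) (use assms in auto)
  finally show ?thesis .
qed

text \<open>Places a certificate in the lower left block, rows from \<open>r\<close> on and columns
  below \<open>r\<close>: there the projection onto the range of a spiked matrix is of first order
  in \<open>eps\<close>.\<close>

lemma contraction_pad:
  assumes K: "contraction n r K" and p: "p = r + n"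
  shows "contraction p p (\<lambda>a b. if r \<le> a \<and> b < r then K (a - r) b else 0)"
  unfolding contraction_def
proof (intro allI)
  fix x y :: "nat \<Rightarrow> real"
  let ?K = "\<lambda>a b. if r \<le> a \<and> b < r then K (a - r) b else 0"
  have "(\<Sum>a<p. \<Sum>b<p. ?K a b * x a * y b)
      = (\<Sum>a<p. \<Sum>b<p. (if r \<le> a \<and> b < r then K (a - r) b * x (a - r + r) * y b else 0))"
    by (intro sum.cong) auto
  also have "\<dots> = (\<Sum>i<n. \<Sum>j<r. K i j * x (i + r) * y j)"
    by (rule sum_rectangle_pad[OF p])
  finally have "\<bar>\<Sum>a<p. \<Sum>b<p. ?K a b * x a * y b\<bar>
      \<le> sqrt (\<Sum>i<n. (x (i + r))\<^sup>2) * sqrt (sumsq r y)"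
    using K[unfolded contraction_def, rule_format, of "\<lambda>i. x (i + r)" y] by simp
  also have "\<dots> \<le> sqrt (sumsq p x) * sqrt (sumsq p y)"
  proof (intro mult_mono real_sqrt_le_mono)
    have "(\<Sum>i<n. (x (i + r))\<^sup>2) = (\<Sum>a\<in>{r..<p}. (x a)\<^sup>2)"
      by (rule sum.reindex_bij_witness[of _ "\<lambda>a. a - r" "\<lambda>i. i + r"]) (use p in auto)
    also have "\<dots> \<le> sumsq p x" by (intro sum_mono2) auto
    finally show "(\<Sum>i<n. (x (i + r))\<^sup>2) \<le> sumsq p x" .
    show "sumsq r y \<le> sumsq p y" using p by (intro sum_mono2) auto
  qed (auto simp: sum_nonneg)
  finally show "\<bar>\<Sum>a<p. \<Sum>b<p. ?K a b * x a * y b\<bar>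
      \<le> sqrt (sumsq p x) * sqrt (sumsq p y)" .
qed

text \<open>The bilinear form is tested on \<open>x\<close> and its own image.\<close>

lemma contraction_apply_norm:
  assumes K: "contraction m n K"
  shows "(\<Sum>j<n. (\<Sum>i<m. K i j * x i)\<^sup>2) \<le> sumsq m x"
proof -
  define y where "y j = (\<Sum>i<m. K i j * x i)" for j
  define Y where "Y = sumsq n y"
  define X where "X = sumsq m x"
  have nn: "Y \<ge> 0" "X \<ge> 0" by (auto simp: Y_def X_def sum_nonneg)
  have "(\<Sum>i<m. \<Sum>j<n. K i j * x i * y j) = (\<Sum>j<n. \<Sum>i<m. K i j * x i * y j)" by (rule sum.swap)
  also have "\<dots> = Y" by (simp add: Y_def power2_eq_square sum_distrib_right[symmetric] flip: y_def)
  finally have "Y \<le> sqrt X * sqrt Y"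
    using K[unfolded contraction_def, rule_format, of x y] nn by (simp add: X_def Y_def)
  then have "sqrt Y * sqrt Y \<le> sqrt X * sqrt Y" using nn by simp
  then have "sqrt Y \<le> sqrt X \<or> Y = 0"
    using nn by (metis mult_le_cancel_right_pos real_sqrt_gt_zero order_le_less)
  then have "Y \<le> X" using nn by auto
  then show ?thesis by (simp add: X_def Y_def y_def)
qed

abbreviation pairing :: "nat \<Rightarrow> nat \<Rightarrow> (nat \<Rightarrow> nat \<Rightarrow> real) \<Rightarrow> (nat \<Rightarrow> nat \<Rightarrow> real) \<Rightarrow> real" where
  "pairing n r K W \<equiv> \<Sum>i<n. \<Sum>j<r. K i j * W i j"

text \<open>The witness is the polar factor of \<open>D\<close>, whose pairing with \<open>D\<close>
  is the nuclear norm. Bounding each singular value \<open>s\<close> below by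
  \<open>s^2/t - s^4/(4 t^3)\<close> turns the sum into polynomials in the entries of
  \<open>D\<close>, whose averages over signs are computable; \<open>t\<close> is the expected size
  of the singular values.\<close>

lemma contraction_certificate:
  fixes D :: "nat \<Rightarrow> nat \<Rightarrow> real"
  assumes "t > 0"
  obtains K where "contraction n r K"
    "(\<Sum>i<n. \<Sum>j<r. (D i j)\<^sup>2) / t - (\<Sum>j<r. \<Sum>j'<r. (\<Sum>i<n. D i j * D i j')\<^sup>2) / (4 * t ^ 3)
      \<le> pairing n r K D"
proof -
  define B where "B = Matrix.mat n r (\<lambda>(i, j). D i j)"
  have B: "B \<in> carrier_mat n r" by (simp add: B_def)
  obtain u e where onb: "orthonormal_basis r u"
    and "\<And>v. (\<Sum>k<r. e k * (dot r v (u k))\<^sup>2) = (\<Sum>a<n. (\<Sum>i<r. B $$ (a, i) * v i)\<^sup>2)"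
    and "\<And>k. k < r \<Longrightarrow> e k = (\<Sum>a<n. (\<Sum>i<r. B $$ (a, i) * u k i)\<^sup>2)"
    and "\<And>i k. i < r \<Longrightarrow> k < r \<Longrightarrow> (\<Sum>j<r. (\<Sum>a<n. B $$ (a, i) * B $$ (a, j)) * u k j) = e k * u k i"
    by (rule gram_eigenbasis[OF B]) (rule that)
  then have q: "\<And>v. (\<Sum>k<r. e k * (dot r v (u k))\<^sup>2) = (\<Sum>a<n. (dot r (D a) v)\<^sup>2)"
    and ek: "\<And>k. k < r \<Longrightarrow> e k = (\<Sum>a<n. (dot r (D a) (u k))\<^sup>2)"
    and ev: "\<And>i k. i < r \<Longrightarrow> k < r \<Longrightarrow> (\<Sum>j<r. (\<Sum>a<n. D a i * D a j) * u k j) = e k * u k i"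
    by (simp_all add: B_def)
  have e0: "0 \<le> e k" if "k < r" for k using ek[OF that] by (simp add: sum_nonneg)
  have uu: "dot r (u k) (u l) = (if k = l then 1 else 0)" if "k < r" "l < r" for k l
    using onb that by (simp add: orthonormal_basis_def)
  \<comment> \<open>The inverse square root of the Gram matrix, set to \<open>0\<close> on the
    kernel, so that rank-deficient \<open>D\<close> are included.\<close>
  define h where "h k = (if e k > 0 then 1 / sqrt (e k) else 0)" for k
  define K where "K i j = (\<Sum>k<r. h k * dot r (D i) (u k) * u k j)" for i j
  have Ky: "dot r (K i) y = (\<Sum>l<r. D i l * (\<Sum>k<r. (h k * dot r y (u k)) * u k l))" for i y
  proof -
    have "dot r (K i) y = (\<Sum>j<r. \<Sum>k<r. h k * dot r (D i) (u k) * (y j * u k j))"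
      unfolding K_def sum_distrib_right by (simp add: mult_ac)
    also have "\<dots> = (\<Sum>k<r. \<Sum>j<r. h k * dot r (D i) (u k) * (y j * u k j))" by (rule sum.swap)
    also have "\<dots> = (\<Sum>k<r. (dot r (D i) (u k)) * (h k * dot r y (u k)))"
      unfolding sum_distrib_left[symmetric] by (simp add: mult_ac)
    also have "\<dots> = (\<Sum>k<r. \<Sum>l<r. D i l * ((h k * dot r y (u k)) * u k l))"
      unfolding sum_distrib_right by (simp add: mult_ac)
    also have "\<dots> = (\<Sum>l<r. \<Sum>k<r. D i l * ((h k * dot r y (u k)) * u k l))" by (rule sum.swap)
    finally show ?thesis by (simp add: sum_distrib_left)
  qed
  have Ky_norm: "(\<Sum>i<n. (dot r (K i) y)\<^sup>2) \<le> sumsq r y" for y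
  proof -
    define c where "c k = h k * dot r y (u k)" for k
    have "(\<Sum>i<r. (\<Sum>k'<r. c k' * u k' i) * u k i) = c k" if "k < r" for k
    proof -
      have "(\<Sum>i<r. (\<Sum>k'<r. c k' * u k' i) * u k i) = (\<Sum>k'<r. \<Sum>i<r. c k' * (u k' i * u k i))"
        by (simp add: sum_distrib_right mult.assoc, rule sum.swap)
      also have "\<dots> = (\<Sum>k'<r. c k' * (if k' = k then 1 else 0))"
        using uu that by (intro sum.cong refl) (simp flip: sum_distrib_left)
      finally show ?thesis using that by (simp add: if_distrib[of "(*) _"] cong: if_cong)
    qed
    then have "(\<Sum>i<n. (dot r (K i) y)\<^sup>2) = (\<Sum>k<r. e k * (c k)\<^sup>2)"
      unfolding Ky c_def[symmetric] q[symmetric] by (intro sum.cong) auto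
    also have "\<dots> \<le> (\<Sum>k<r. (dot r y (u k))\<^sup>2)"
      by (intro sum_mono) (auto simp: c_def h_def power_mult_distrib power_divide)
    also have "\<dots> = sumsq r y"
      using parseval[OF onb, of y y] by (simp add: power2_eq_square)
    finally show ?thesis .
  qed
  have "contraction n r K"
    unfolding contraction_def
  proof (intro allI)
    fix x y :: "nat \<Rightarrow> real"
    have "\<bar>\<Sum>i<n. \<Sum>j<r. K i j * x i * y j\<bar> = \<bar>\<Sum>i<n. x i * dot r (K i) y\<bar>"
      by (simp add: sum_distrib_left mult_ac)
    also have "\<dots> \<le> sqrt (sumsq n x) * sqrt (\<Sum>i<n. (dot r (K i) y)\<^sup>2)"
      using Cauchy_Schwarz_ineq_sum[of x "\<lambda>i. \<Sum>j<r. K i j * y j" "{..<n}"]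
      by (metis (no_types, lifting) real_sqrt_abs real_sqrt_le_mono real_sqrt_mult)
    also have "\<dots> \<le> sqrt (sumsq n x) * sqrt (sumsq r y)"
      by (intro mult_left_mono real_sqrt_le_mono Ky_norm) (simp add: sum_nonneg)
    finally show "\<bar>\<Sum>i<n. \<Sum>j<r. K i j * x i * y j\<bar>
        \<le> sqrt (sumsq n x) * sqrt (sumsq r y)" .
  qed
  moreover have "pairing n r K D = (\<Sum>k<r. sqrt (e k))"
  proof -
    have "pairing n r K D
        = (\<Sum>i<n. \<Sum>j<r. \<Sum>k<r. h k * dot r (D i) (u k) * (D i j * u k j))"
      unfolding K_def sum_distrib_right by (simp add: mult_ac)
    also have "\<dots> = (\<Sum>i<n. \<Sum>k<r. \<Sum>j<r. h k * dot r (D i) (u k) * (D i j * u k j))"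
      by (intro sum.cong refl sum.swap)
    also have "\<dots> = (\<Sum>i<n. \<Sum>k<r. h k * (dot r (D i) (u k))\<^sup>2)"
      by (simp add: power2_eq_square mult.assoc flip: sum_distrib_left)
    also have "\<dots> = (\<Sum>k<r. \<Sum>i<n. h k * (dot r (D i) (u k))\<^sup>2)" by (rule sum.swap)
    also have "\<dots> = dot r h e" by (simp add: ek flip: sum_distrib_left)
    also have "\<dots> = (\<Sum>k<r. sqrt (e k))"
    proof (intro sum.cong refl)
      fix k assume "k \<in> {..<r}"
      then show "h k * e k = sqrt (e k)"
        using e0[of k] by (cases "e k = 0") (auto simp: h_def field_simps)
    qed
    finally show ?thesis .
  qed
  moreover have "(\<Sum>i<n. \<Sum>j<r. (D i j)\<^sup>2) = (\<Sum>k<r. e k)"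
  proof -
    have "(\<Sum>k<r. e k) = (\<Sum>k<r. \<Sum>a<n. (dot r (D a) (u k))\<^sup>2)" by (simp add: ek)
    also have "\<dots> = (\<Sum>a<n. \<Sum>k<r. (dot r (D a) (u k))\<^sup>2)" by (rule sum.swap)
    also have "\<dots> = (\<Sum>a<n. \<Sum>i<r. (D a i)\<^sup>2)"
      using parseval[OF onb] by (simp add: power2_eq_square)
    finally show ?thesis by simp
  qed
  moreover have "(\<Sum>j<r. \<Sum>j'<r. (\<Sum>i<n. D i j * D i j')\<^sup>2) = sumsq r e"
  proof -
    have "(\<Sum>j<r. \<Sum>j'<r. (\<Sum>i<n. D i j * D i j')\<^sup>2)
        = (\<Sum>j<r. \<Sum>k<r. (\<Sum>j'<r. (\<Sum>i<n. D i j * D i j') * u k j')\<^sup>2)"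
      using parseval[OF onb] by (simp add: power2_eq_square)
    also have "\<dots> = (\<Sum>j<r. \<Sum>k<r. (e k * u k j)\<^sup>2)"
      using ev by (intro sum.cong refl) simp
    also have "\<dots> = (\<Sum>k<r. \<Sum>j<r. (e k * u k j)\<^sup>2)" by (rule sum.swap)
    also have "\<dots> = (\<Sum>k<r. (e k)\<^sup>2 * dot r (u k) (u k))"
      by (simp add: power_mult_distrib sum_distrib_left power2_eq_square mult_ac)
    also have "\<dots> = sumsq r e" using uu by (intro sum.cong refl) simp
    finally show ?thesis .
  qed
  moreover have "(\<Sum>k<r. e k) / t - sumsq r e / (4 * t ^ 3) \<le> (\<Sum>k<r. sqrt (e k))"
  proof -
    have "e k / t - (e k)\<^sup>2 / (4 * t ^ 3) \<le> sqrt (e k)" if "k < r" for k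
    proof -
      define y where "y = sqrt (e k) / t"
      have y: "y \<ge> 0" using e0[OF that] assms by (simp add: y_def)
      have "e k = (t * y)\<^sup>2" using e0[OF that] assms by (simp add: y_def)
      then have "e k / t - (e k)\<^sup>2 / (4 * t ^ 3) = t * (y * (y - y ^ 3 / 4))"
        using assms by (simp add: field_simps power2_eq_square power3_eq_cube)
      also have "\<dots> \<le> t * (y * 1)"
      proof -
        have "y - y ^ 3 / 4 \<le> 1"
        proof -
          \<comment> \<open>A sum of squares with nonnegative coefficients, which certifies the
            inequality for \<open>y \<ge> 0\<close>.\<close>
          have "1 - y + y ^ 3 / 4 = y * (y / 2 - 1)\<^sup>2 + (y - 1)\<^sup>2"
            by (simp add: field_simps power2_eq_square power3_eq_cube)
          then show ?thesis using y by (smt (verit) mult_nonneg_nonneg zero_le_power2)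
        qed
        then show ?thesis using y assms by (intro mult_left_mono) auto
      qed
      finally show ?thesis using assms by (simp add: y_def)
    qed
    then have "(\<Sum>k<r. e k / t - (e k)\<^sup>2 / (4 * t ^ 3)) \<le> (\<Sum>k<r. sqrt (e k))"
      by (intro sum_mono) auto
    then show ?thesis by (simp add: sum_subtractf sum_divide_distrib)
  qed
  ultimately show ?thesis by (intro that[of K]) simp_all
qed

section \<open>Singular subspaces of spiked matrices\<close>

lemma left_singular_mat_entries:
  assumes M: "M \<in> carrier_mat p c" and lsm: "left_singular_mat M U"
  obtains s V where "U \<in> orthonormal_mats p (dim_col U)" "V \<in> orthonormal_mats c (dim_col U)"
    "\<And>l. l < dim_col U \<Longrightarrow> 0 < s l"
    "\<And>a k. a < p \<Longrightarrow> k < c \<Longrightarrow> M $$ (a, k) = (\<Sum>l<dim_col U. U $$ (a, l) * s l * V $$ (k, l))"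
proof -
  have dim: "dim_row M = p" "dim_col M = c" using M by auto
  obtain s V where H: "U \<in> orthonormal_mats p (dim_col U) \<and> V \<in> orthonormal_mats c (dim_col U) \<and>
    (\<forall>l<dim_col U. 0 < s l) \<and> M = U * mat_diag (dim_col U) s * V\<^sup>T"
    using lsm unfolding left_singular_mat_def dim by (elim exE)
  note U_on = conjunct1[OF H] and H' = conjunct2[OF H]
  note V_on = conjunct1[OF H'] and H'' = conjunct2[OF H']
  have s_pos: "0 < s l" if "l < dim_col U" for l using conjunct1[OF H''] that by simp
  note M_eq = conjunct2[OF H'']
  define d where "d = dim_col U"
  have U: "U \<in> carrier_mat p d" and V: "V \<in> carrier_mat c d"
    unfolding d_def by (rule orthonormal_matsD(1)[OF U_on], rule orthonormal_matsD(1)[OF V_on])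
  have "M $$ (a, k) = (\<Sum>l<d. U $$ (a, l) * s l * V $$ (k, l))" if "a < p" "k < c" for a k
    unfolding M_eq d_def[symmetric] mat_diag_mult_right[OF U]
    using that U V by (simp add: scalar_prod_def lessThan_atLeast0)
  then show ?thesis by (intro that[OF U_on V_on s_pos]) (simp_all add: d_def)
qed

text \<open>As \<open>R\<close> has the right inverse \<open>S\<close>, the matrices
  \<open>M\<close> and \<open>A\<close> have the same column space. The second claim says that the
  projection fixes this space, the third that its range is no larger; together they pin it down
  whatever singular vectors are chosen. The number of columns of \<open>U\<close> is still open
  here.\<close>

lemma left_singular_proj:
  fixes r :: nat
  assumes M: "M \<in> carrier_mat p c" and lsm: "left_singular_mat M U"
    and fac: "\<forall>a<p. \<forall>k<c. M $$ (a, k) = (\<Sum>j<r. A a j * R j k)"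
    and inv: "\<forall>j<r. \<forall>j'<r. (\<Sum>k<c. R j k * S k j') = (if j = j' then 1 else 0)"
  shows "U \<in> orthonormal_mats p (dim_col U)"
    and "\<And>a j. a < p \<Longrightarrow> j < r \<Longrightarrow> (\<Sum>b<p. proj U a b * A b j) = A a j"
    and "\<exists>Q. \<forall>a<p. \<forall>b<p. proj U a b = (\<Sum>j<r. A a j * Q j b)"
proof -
  obtain s V where U: "U \<in> orthonormal_mats p (dim_col U)" and V: "V \<in> orthonormal_mats c (dim_col U)"
    and s: "\<And>l. l < dim_col U \<Longrightarrow> 0 < s l"
    and Mak: "\<And>a k. a < p \<Longrightarrow> k < c \<Longrightarrow> M $$ (a, k) = (\<Sum>l<dim_col U. U $$ (a, l) * s l * V $$ (k, l))"
    by (rule left_singular_mat_entries[OF M lsm]) (rule that)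
  define d where "d = dim_col U"
  note U = U[folded d_def] and V = V[folded d_def] and s = s[folded d_def] and Mak = Mak[folded d_def]
  show "U \<in> orthonormal_mats p (dim_col U)" using U by (simp add: d_def)
  have UM: "(\<Sum>b<p. U $$ (b, l) * M $$ (b, k)) = s l * V $$ (k, l)" if "l < d" "k < c" for l k
  proof -
    have "(\<Sum>b<p. U $$ (b, l) * M $$ (b, k))
        = (\<Sum>b<p. \<Sum>l'<d. (U $$ (b, l) * U $$ (b, l')) * (s l' * V $$ (k, l')))"
      using that by (simp add: Mak sum_distrib_left mult.assoc)
    also have "\<dots> = (\<Sum>l'<d. \<Sum>b<p. (U $$ (b, l) * U $$ (b, l')) * (s l' * V $$ (k, l')))" by (rule sum.swap)
    also have "\<dots> = (\<Sum>l'<d. (if l = l' then 1 else 0) * (s l' * V $$ (k, l')))"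
      using orthonormal_matsD(3)[OF U] that by (intro sum.cong refl) (simp flip: sum_distrib_right)
    finally show ?thesis using that by (simp add: if_distrib[of "\<lambda>x. x * _"] cong: if_cong)
  qed
  have PM: "(\<Sum>b<p. proj U a b * M $$ (b, k)) = M $$ (a, k)" if "a < p" "k < c" for a k
    using that by (simp add: proj_apply[OF U] UM) (simp add: Mak mult.assoc)
  have A: "A b j = (\<Sum>k<c. M $$ (b, k) * S k j)" if "b < p" "j < r" for b j
  proof -
    have "(\<Sum>k<c. M $$ (b, k) * S k j) = (\<Sum>k<c. \<Sum>j'<r. A b j' * (R j' k * S k j))"
      using that by (simp add: fac sum_distrib_right mult.assoc)
    also have "\<dots> = (\<Sum>j'<r. \<Sum>k<c. A b j' * (R j' k * S k j))" by (rule sum.swap)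
    also have "\<dots> = (\<Sum>j'<r. A b j' * (if j' = j then 1 else 0))"
      using inv that by (intro sum.cong refl) (simp flip: sum_distrib_left)
    also have "\<dots> = (\<Sum>j'<r. if j' = j then A b j' else 0)" by (intro sum.cong) auto
    also have "\<dots> = A b j" using that by (subst sum.delta) auto
    finally show ?thesis ..
  qed
  show "(\<Sum>b<p. proj U a b * A b j) = A a j" if "a < p" "j < r" for a j
  proof -
    have "(\<Sum>b<p. proj U a b * A b j) = (\<Sum>b<p. \<Sum>k<c. proj U a b * M $$ (b, k) * S k j)"
      using that by (simp add: A sum_distrib_left mult.assoc)
    also have "\<dots> = (\<Sum>k<c. \<Sum>b<p. proj U a b * M $$ (b, k) * S k j)" by (rule sum.swap)
    also have "\<dots> = (\<Sum>k<c. M $$ (a, k) * S k j)"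
      using that by (intro sum.cong refl) (simp add: PM flip: sum_distrib_right)
    finally show ?thesis using that A by simp
  qed
  have MV: "(\<Sum>k<c. M $$ (a, k) * (V $$ (k, l) / s l)) = U $$ (a, l)" if "a < p" "l < d" for a l
  proof -
    have "(\<Sum>k<c. M $$ (a, k) * (V $$ (k, l) / s l))
        = (\<Sum>k<c. \<Sum>l'<d. (U $$ (a, l') * s l' / s l) * (V $$ (k, l') * V $$ (k, l)))"
      using that
      by (intro sum.cong refl, subst Mak, simp, simp, subst sum_distrib_right, intro sum.cong refl)
        (simp add: mult_ac)
    also have "\<dots> = (\<Sum>l'<d. \<Sum>k<c. (U $$ (a, l') * s l' / s l) * (V $$ (k, l') * V $$ (k, l)))"
      by (rule sum.swap)
    also have "\<dots> = (\<Sum>l'<d. (U $$ (a, l') * s l' / s l) * (if l' = l then 1 else 0))"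
      using orthonormal_matsD(3)[OF V] that
      by (intro sum.cong refl, subst sum_distrib_left[symmetric]) simp
    finally show ?thesis using that s[of l] by (simp add: if_distrib[of "(*) _"] cong: if_cong)
  qed
  \<comment> \<open>Dividing the columns of \<open>V\<close> by the singular values recovers
    \<open>U\<close> from \<open>M\<close>, and \<open>M = A R\<close> then exhibits the
    coefficients with respect to \<open>A\<close>.\<close>
  define Q where "Q j b = (\<Sum>l<d. (\<Sum>k<c. R j k * (V $$ (k, l) / s l)) * U $$ (b, l))" for j b
  have "proj U a b = (\<Sum>j<r. A a j * Q j b)" if "a < p" "b < p" for a b
  proof -
    have MA: "(\<Sum>k<c. M $$ (a, k) * (V $$ (k, l) / s l)) = (\<Sum>j<r. A a j * (\<Sum>k<c. R j k * (V $$ (k, l) / s l)))" for l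
    proof -
      have "(\<Sum>k<c. M $$ (a, k) * (V $$ (k, l) / s l)) = (\<Sum>k<c. \<Sum>j<r. A a j * (R j k * (V $$ (k, l) / s l)))"
        using that by (simp add: fac sum_distrib_right sum_divide_distrib mult.assoc)
      also have "\<dots> = (\<Sum>j<r. \<Sum>k<c. A a j * (R j k * (V $$ (k, l) / s l)))" by (rule sum.swap)
      finally show ?thesis by (simp add: sum_distrib_left)
    qed
    have "U $$ (a, l) = (\<Sum>j<r. A a j * (\<Sum>k<c. R j k * (V $$ (k, l) / s l)))" if "l < d" for l
      unfolding MV[OF \<open>a < p\<close> that, symmetric] by (rule MA)
    then have "proj U a b = (\<Sum>l<d. \<Sum>j<r. A a j * ((\<Sum>k<c. R j k * (V $$ (k, l) / s l)) * U $$ (b, l)))"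
      unfolding proj_def d_def[symmetric] by (intro sum.cong refl) (simp add: sum_distrib_right mult.assoc)
    also have "\<dots> = (\<Sum>j<r. \<Sum>l<d. A a j * ((\<Sum>k<c. R j k * (V $$ (k, l) / s l)) * U $$ (b, l)))"
      by (rule sum.swap)
    finally show ?thesis by (simp add: Q_def sum_distrib_left)
  qed
  then show "\<exists>Q. \<forall>a<p. \<forall>b<p. proj U a b = (\<Sum>j<r. A a j * Q j b)" by blast
qed

definition spiked :: "nat \<Rightarrow> real \<Rightarrow> (nat \<Rightarrow> nat \<Rightarrow> real) \<Rightarrow> nat \<Rightarrow> nat \<Rightarrow> real" where
  "spiked r eps W a j = (if a < r then (if a = j then 1 else 0) else eps * W (a - r) j)"

text \<open>The squared Frobenius norm of \<open>W^T W\<close>, that is, the sum of the fourth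
  powers of the singular values of \<open>W\<close>.\<close>

definition gram_norm :: "nat \<Rightarrow> nat \<Rightarrow> (nat \<Rightarrow> nat \<Rightarrow> real) \<Rightarrow> real" where
  "gram_norm n r W = (\<Sum>j<r. \<Sum>j'<r. (\<Sum>i<n. W i j * W i j')\<^sup>2)"

lemma sum_split_add:
  fixes f :: "nat \<Rightarrow> real"
  shows "(\<Sum>a<r + n. f a) = (\<Sum>j<r. f j) + (\<Sum>i<n. f (r + i))"
  by (induction n) (simp_all add: add.assoc)

text \<open>A leading block of an orthogonal projection does not increase norms; it is applied to
  the rows of \<open>W\<close>.\<close>

lemma proj_contract:
  assumes U: "U \<in> orthonormal_mats p d" and "r \<le> p"
  shows "(\<Sum>m<r. (\<Sum>l<r. x l * proj U l m)\<^sup>2) \<le> sumsq r x"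
proof -
  define x' where "x' l = (if l < r then x l else 0)" for l
  have sub: "dot p f x' = dot r f x" for f
    using \<open>r \<le> p\<close> by (intro sum.mono_neutral_cong_right) (auto simp: x'_def)
  define t where "t l = (\<Sum>b<p. U $$ (b, l) * x' b)" for l
  have "(\<Sum>m<r. (\<Sum>l<r. x l * proj U l m)\<^sup>2) = (\<Sum>m<r. (\<Sum>b<p. proj U m b * x' b)\<^sup>2)"
    unfolding sub by (simp add: proj_sym mult.commute)
  also have "\<dots> \<le> (\<Sum>m<p. (\<Sum>b<p. proj U m b * x' b)\<^sup>2)"
    using \<open>r \<le> p\<close> by (intro sum_mono2) auto
  also have "\<dots> = sumsq d t"
    unfolding proj_apply[OF U] t_def by (rule orthonormal_comb_norm[OF U])
  also have "\<dots> \<le> sumsq p x'"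
  proof -
    have "0 \<le> (\<Sum>a<p. (x' a - (\<Sum>b<p. proj U a b * x' b))\<^sup>2)" by (rule sum_nonneg) simp
    then show ?thesis unfolding proj_residual_norm[OF U] t_def by simp
  qed
  also have "\<dots> = sumsq r x"
    using \<open>r \<le> p\<close> by (intro sum.mono_neutral_cong_right) (auto simp: x'_def)
  finally show ?thesis .
qed

text \<open>Two block equations replace inverting \<open>1 + eps^2 W^T W\<close>. Columns of the
  projection lie in the range of \<open>[1; eps W]\<close>, which gives the lower left block from
  the upper left one; fixing that range, together with symmetry, gives the implicit equation for the
  upper left block.\<close>

lemma spiked_singular_subspace:
  assumes M: "M \<in> carrier_mat p c" and lsm: "left_singular_mat M U" and p: "p = r + n"
    and fac: "\<forall>a<p. \<forall>k<c. M $$ (a, k) = (\<Sum>j<r. spiked r eps W a j * R j k)"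
    and inv: "\<forall>j<r. \<forall>j'<r. (\<Sum>k<c. R j k * S k j') = (if j = j' then 1 else 0)"
  shows "U \<in> orthonormal_mats p r"
    and "i < n \<Longrightarrow> j < r \<Longrightarrow> proj U (r + i) j = eps * (\<Sum>l<r. W i l * proj U l j)"
    and "l < r \<Longrightarrow> j < r \<Longrightarrow> proj U l j = (if l = j then 1 else 0)
      - eps\<^sup>2 * (\<Sum>m<r. proj U l m * (\<Sum>i<n. W i m * W i j))"
proof -
  note L = left_singular_proj[OF M lsm fac inv]
  obtain Q where Q: "\<And>a b. a < p \<Longrightarrow> b < p \<Longrightarrow> proj U a b = (\<Sum>j<r. spiked r eps W a j * Q j b)"
    using L(3) by blast
  have Q1: "Q j b = proj U j b" if "j < r" "b < p" for j b
    using Q[of j b] that p by (simp add: spiked_def if_distrib[of "\<lambda>x. x * _"] cong: if_cong)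
  have P2: "proj U (r + i) b = eps * (\<Sum>l<r. W i l * proj U l b)" if "i < n" "b < p" for i b
    using Q[of "r + i" b] that p by (simp add: spiked_def Q1 sum_distrib_left mult.assoc)
  then show "i < n \<Longrightarrow> j < r \<Longrightarrow> proj U (r + i) j = eps * (\<Sum>l<r. W i l * proj U l j)"
    using p by simp
  have PA: "proj U a j + eps * (\<Sum>i<n. proj U a (r + i) * W i j) = spiked r eps W a j" if "a < p" "j < r" for a j
  proof -
    have "(\<Sum>b<p. proj U a b * spiked r eps W b j)
        = (\<Sum>l<r. proj U a l * (if l = j then 1 else 0)) + (\<Sum>i<n. proj U a (r + i) * (eps * W i j))"
      unfolding p sum_split_add by (simp add: spiked_def)
    then show ?thesis
      using L(2)[OF that] that by (simp add: if_distrib[of "(*) _"] sum_distrib_left mult.left_commute cong: if_cong)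
  qed
  show "proj U l j = (if l = j then 1 else 0) - eps\<^sup>2 * (\<Sum>m<r. proj U l m * (\<Sum>i<n. W i m * W i j))"
    if "l < r" "j < r"
  proof -
    have "(\<Sum>i<n. proj U l (r + i) * W i j) = (\<Sum>i<n. eps * (\<Sum>m<r. W i m * proj U m l) * W i j)"
      using that p by (intro sum.cong refl) (simp add: proj_sym[of U l] P2)
    also have "\<dots> = eps * (\<Sum>i<n. \<Sum>m<r. proj U l m * (W i m * W i j))"
      by (simp add: sum_distrib_left sum_distrib_right proj_sym[of U l] mult_ac)
    also have "(\<Sum>i<n. \<Sum>m<r. proj U l m * (W i m * W i j)) = (\<Sum>m<r. \<Sum>i<n. proj U l m * (W i m * W i j))"
      by (rule sum.swap)
    finally have "(\<Sum>i<n. proj U l (r + i) * W i j) = eps * (\<Sum>m<r. proj U l m * (\<Sum>i<n. W i m * W i j))"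
      by (simp add: sum_distrib_left)
    then show ?thesis using PA[of l j] that p by (simp add: spiked_def power2_eq_square)
  qed
  have "dim_col U = r"
  proof -
    \<comment> \<open>The number of columns is the trace of the projection, and the block equations
      evaluate this trace to \<open>r\<close>.\<close>
    have "real (dim_col U) = (\<Sum>l<dim_col U. \<Sum>a<p. U $$ (a, l) * U $$ (a, l))"
      using orthonormal_matsD(3)[OF L(1)] by simp
    also have "\<dots> = (\<Sum>a<p. proj U a a)" unfolding proj_def by (rule sum.swap)
    also have "\<dots> = (\<Sum>l<r. proj U l l) + (\<Sum>i<n. proj U (r + i) (r + i))"
      unfolding p by (rule sum_split_add)
    also have "(\<Sum>i<n. proj U (r + i) (r + i)) = (\<Sum>i<n. \<Sum>l<r. eps * (proj U l (r + i) * W i l))"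
      using p by (simp add: P2 sum_distrib_left mult_ac)
    also have "\<dots> = (\<Sum>l<r. \<Sum>i<n. eps * (proj U l (r + i) * W i l))" by (rule sum.swap)
    also have "(\<Sum>l<r. proj U l l) + \<dots> = (\<Sum>l<r. spiked r eps W l l)"
    proof -
      have "(\<Sum>l<r. spiked r eps W l l) = (\<Sum>l<r. proj U l l + eps * (\<Sum>i<n. proj U l (r + i) * W i l))"
        using p PA by (intro sum.cong refl) simp
      then show ?thesis by (simp add: sum.distrib sum_distrib_left)
    qed
    also have "\<dots> = real r" by (simp add: spiked_def)
    finally show ?thesis by simp
  qed
  then show "U \<in> orthonormal_mats p r" using L(1) by simp
qed

text \<open>With \<open>P\<close> the upper left block and \<open>G = W^T W\<close>, the block
  equations give the lower left block as \<open>eps W - eps^3 W P G\<close>. In the pairing of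
  \<open>K\<close> with the remainder, \<open>K\<close> and \<open>P\<close> do not increase the
  Frobenius norm of \<open>W\<close>, and Cauchy-Schwarz separates it from that of
  \<open>G\<close>.\<close>

lemma spiked_pairing:
  assumes M: "M \<in> carrier_mat p c" and lsm: "left_singular_mat M U" and p: "p = r + n"
    and fac: "\<forall>a<p. \<forall>k<c. M $$ (a, k) = (\<Sum>j<r. spiked r eps W a j * R j k)"
    and inv: "\<forall>j<r. \<forall>j'<r. (\<Sum>k<c. R j k * S k j') = (if j = j' then 1 else 0)"
    and K: "contraction n r K" and "eps \<ge> 0"
  shows "\<bar>pairing n r K (\<lambda>i j. proj U (r + i) j) - eps * pairing n r K W\<bar>
    \<le> eps ^ 3 * sqrt (\<Sum>i<n. \<Sum>j<r. (W i j)\<^sup>2) * sqrt (gram_norm n r W)"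
proof -
  note sp = spiked_singular_subspace[OF M lsm p fac inv]
  define G where "G m j = (\<Sum>i<n. W i m * W i j)" for m j
  define Z where "Z i m = (\<Sum>l<r. W i l * proj U l m)" for i m
  define Y where "Y j m = (\<Sum>i<n. K i j * Z i m)" for j m
  have Pij: "proj U (r + i) j = eps * W i j - eps ^ 3 * (\<Sum>m<r. Z i m * G m j)" if "i < n" "j < r" for i j
  proof -
    have "(\<Sum>l<r. W i l * proj U l j)
        = (\<Sum>l<r. W i l * (if l = j then 1 else 0)) - eps\<^sup>2 * (\<Sum>l<r. \<Sum>m<r. W i l * proj U l m * G m j)"
      using that sp(3)[of _ j] unfolding G_def[symmetric]
      by (simp add: right_diff_distrib sum_subtractf sum_distrib_left mult_ac)
    also have "(\<Sum>l<r. \<Sum>m<r. W i l * proj U l m * G m j) = (\<Sum>m<r. \<Sum>l<r. W i l * proj U l m * G m j)"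
      by (rule sum.swap)
    finally have "(\<Sum>l<r. W i l * proj U l j) = W i j - eps\<^sup>2 * (\<Sum>m<r. Z i m * G m j)"
      using that by (simp add: Z_def sum_distrib_right if_distrib[of "(*) _"] cong: if_cong)
    then show ?thesis
      using sp(2)[OF that] by (simp add: right_diff_distrib power3_eq_cube power2_eq_square mult.assoc)
  qed
  have "pairing n r K (\<lambda>i j. proj U (r + i) j) - eps * pairing n r K W
      = - (eps ^ 3 * (\<Sum>i<n. \<Sum>j<r. \<Sum>m<r. K i j * Z i m * G m j))"
    by (simp add: Pij right_diff_distrib sum_subtractf sum_distrib_left mult_ac)
  also have "(\<Sum>i<n. \<Sum>j<r. \<Sum>m<r. K i j * Z i m * G m j) = (\<Sum>j<r. \<Sum>m<r. Y j m * G m j)"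
  proof -
    have "(\<Sum>i<n. \<Sum>j<r. \<Sum>m<r. K i j * Z i m * G m j) = (\<Sum>j<r. \<Sum>i<n. \<Sum>m<r. K i j * Z i m * G m j)"
      by (rule sum.swap)
    also have "\<dots> = (\<Sum>j<r. \<Sum>m<r. \<Sum>i<n. K i j * Z i m * G m j)"
      by (intro sum.cong refl sum.swap)
    finally show ?thesis by (simp add: Y_def sum_distrib_right)
  qed
  finally have eq: "\<bar>pairing n r K (\<lambda>i j. proj U (r + i) j) - eps * pairing n r K W\<bar>
      = eps ^ 3 * \<bar>\<Sum>j<r. \<Sum>m<r. Y j m * G m j\<bar>" using \<open>eps \<ge> 0\<close> by (simp add: abs_mult)
  have "(\<Sum>j<r. \<Sum>m<r. Y j m * G m j)\<^sup>2 \<le> (\<Sum>j<r. \<Sum>m<r. (Y j m)\<^sup>2) * (\<Sum>j<r. \<Sum>m<r. (G m j)\<^sup>2)"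
    using Cauchy_Schwarz_ineq_sum[of "\<lambda>(j, m). Y j m" "\<lambda>(j, m). G m j" "{..<r} \<times> {..<r}"]
    by (simp add: sum.cartesian_product case_prod_unfold)
  also have "(\<Sum>j<r. \<Sum>m<r. (G m j)\<^sup>2) = gram_norm n r W"
    unfolding gram_norm_def G_def by (subst sum.swap) simp
  also have "(\<Sum>j<r. \<Sum>m<r. (Y j m)\<^sup>2) \<le> (\<Sum>i<n. \<Sum>j<r. (W i j)\<^sup>2)"
  proof -
    have "(\<Sum>j<r. \<Sum>m<r. (Y j m)\<^sup>2) = (\<Sum>m<r. \<Sum>j<r. (Y j m)\<^sup>2)" by (rule sum.swap)
    also have "\<dots> \<le> (\<Sum>m<r. \<Sum>i<n. (Z i m)\<^sup>2)"
      unfolding Y_def by (intro sum_mono contraction_apply_norm[OF K])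
    also have "\<dots> = (\<Sum>i<n. \<Sum>m<r. (Z i m)\<^sup>2)" by (rule sum.swap)
    also have "\<dots> \<le> (\<Sum>i<n. \<Sum>j<r. (W i j)\<^sup>2)"
      unfolding Z_def by (intro sum_mono proj_contract[OF sp(1)]) (simp add: p)
    finally show ?thesis .
  qed
  finally have "(\<Sum>j<r. \<Sum>m<r. Y j m * G m j)\<^sup>2 \<le> (\<Sum>i<n. \<Sum>j<r. (W i j)\<^sup>2) * gram_norm n r W"
    by (simp add: mult_right_mono gram_norm_def sum_nonneg)
  then have "\<bar>\<Sum>j<r. \<Sum>m<r. Y j m * G m j\<bar> \<le> sqrt (\<Sum>i<n. \<Sum>j<r. (W i j)\<^sup>2) * sqrt (gram_norm n r W)"
    unfolding real_sqrt_mult[symmetric] by (rule real_le_rsqrt[of "\<bar>_\<bar>", simplified power2_abs])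
  then show ?thesis unfolding eq using \<open>eps \<ge> 0\<close> by (simp add: mult.assoc mult_left_mono)
qed

text \<open>Splits the fourth moment of a difference into functions of single hypotheses, which the
  averaging argument can absorb. Four summands in the square cost the factor \<open>4\<close>, and
  the two cross terms \<open>V^T W\<close> double it.\<close>

lemma gram_norm_diff:
  "gram_norm n r (\<lambda>i j. V i j - W i j) \<le> 8 * (gram_norm n r V + gram_norm n r W)"
proof -
  define C where "C j j' = (\<Sum>i<n. V i j * W i j')" for j j'
  define A where "A j j' = (\<Sum>i<n. V i j * V i j')" for j j'
  define B where "B j j' = (\<Sum>i<n. W i j * W i j')" for j j'
  have C2: "(\<Sum>j<r. \<Sum>j'<r. (C j j')\<^sup>2) \<le> (gram_norm n r V + gram_norm n r W) / 2"
  proof -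
    define a where "a i i' = dot r (V i) (V i')" for i i'
    define b where "b i i' = dot r (W i) (W i')" for i i'
    \<comment> \<open>The squared norm of \<open>V^T W\<close> is the inner product of
      \<open>V V^T\<close> and \<open>W W^T\<close>; for equal arguments this says that
      \<open>W^T W\<close> and \<open>W W^T\<close> have the same norm.\<close>
    have rot: "(\<Sum>j<r. \<Sum>j'<r. (\<Sum>i<n. X i j * X' i j')\<^sup>2)
        = (\<Sum>i<n. \<Sum>i'<n. (dot r (X i) (X i')) * dot r (X' i) (X' i'))" for X X' :: "nat \<Rightarrow> nat \<Rightarrow> real"
    proof -
      have "(\<Sum>j<r. \<Sum>j'<r. (\<Sum>i<n. X i j * X' i j')\<^sup>2)
          = (\<Sum>j<r. \<Sum>j'<r. \<Sum>i<n. \<Sum>i'<n. (X i j * X i' j) * (X' i j' * X' i' j'))"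
        by (simp add: power2_eq_square sum_product mult_ac)
      also have "\<dots> = (\<Sum>j<r. \<Sum>i<n. \<Sum>j'<r. \<Sum>i'<n. (X i j * X i' j) * (X' i j' * X' i' j'))"
        by (intro sum.cong refl sum.swap)
      also have "\<dots> = (\<Sum>i<n. \<Sum>j<r. \<Sum>j'<r. \<Sum>i'<n. (X i j * X i' j) * (X' i j' * X' i' j'))"
        by (rule sum.swap)
      also have "\<dots> = (\<Sum>i<n. \<Sum>j<r. \<Sum>i'<n. \<Sum>j'<r. (X i j * X i' j) * (X' i j' * X' i' j'))"
        by (intro sum.cong refl sum.swap)
      also have "\<dots> = (\<Sum>i<n. \<Sum>i'<n. \<Sum>j<r. \<Sum>j'<r. (X i j * X i' j) * (X' i j' * X' i' j'))"
        by (intro sum.cong refl sum.swap)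
      finally show ?thesis by (simp add: sum_product)
    qed
    have "(\<Sum>j<r. \<Sum>j'<r. (C j j')\<^sup>2) = (\<Sum>i<n. \<Sum>i'<n. a i i' * b i i')"
      unfolding C_def a_def b_def by (rule rot)
    also have "\<dots> \<le> (\<Sum>i<n. \<Sum>i'<n. (a i i' * a i i' + b i i' * b i i') / 2)"
    proof (intro sum_mono)
      fix i i'
      show "a i i' * b i i' \<le> (a i i' * a i i' + b i i' * b i i') / 2"
        using sum_squares_bound[of "a i i'" "b i i'"] by (simp add: power2_eq_square mult_ac)
    qed
    also have "\<dots> = (gram_norm n r V + gram_norm n r W) / 2"
      unfolding gram_norm_def rot a_def b_def by (simp add: sum.distrib flip: sum_divide_distrib)
    finally show ?thesis .
  qed
  have "(\<Sum>i<n. (V i j - W i j) * (V i j' - W i j'))\<^sup>2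
      \<le> 4 * ((A j j')\<^sup>2 + (B j j')\<^sup>2 + (C j j')\<^sup>2 + (C j' j)\<^sup>2)" for j j'
  proof -
    have "(\<Sum>i<n. (V i j - W i j) * (V i j' - W i j')) = A j j' + B j j' - C j j' - C j' j"
      by (simp add: A_def B_def C_def algebra_simps sum.distrib sum_subtractf)
    moreover have "(x + y - z - w)\<^sup>2 \<le> 4 * (x\<^sup>2 + y\<^sup>2 + z\<^sup>2 + w\<^sup>2)" for x y z w :: real
    proof -
      have "4 * (x\<^sup>2 + y\<^sup>2 + z\<^sup>2 + w\<^sup>2) - (x + y - z - w)\<^sup>2
          = (x - y)\<^sup>2 + (x + z)\<^sup>2 + (x + w)\<^sup>2 + (y + z)\<^sup>2 + (y + w)\<^sup>2 + (z - w)\<^sup>2"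
        by (simp add: power2_eq_square algebra_simps)
      then show ?thesis by (smt (verit) zero_le_power2)
    qed
    ultimately show ?thesis by simp
  qed
  then have "gram_norm n r (\<lambda>i j. V i j - W i j)
      \<le> (\<Sum>j<r. \<Sum>j'<r. 4 * ((A j j')\<^sup>2 + (B j j')\<^sup>2 + (C j j')\<^sup>2 + (C j' j)\<^sup>2))"
    unfolding gram_norm_def by (intro sum_mono)
  also have "\<dots> = 4 * (gram_norm n r V + gram_norm n r W + (\<Sum>j<r. \<Sum>j'<r. (C j j')\<^sup>2) + (\<Sum>j<r. \<Sum>j'<r. (C j' j)\<^sup>2))"
    by (simp add: gram_norm_def A_def B_def sum.distrib flip: sum_distrib_left)
  also have "(\<Sum>j<r. \<Sum>j'<r. (C j' j)\<^sup>2) = (\<Sum>j<r. \<Sum>j'<r. (C j j')\<^sup>2)" by (rule sum.swap)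
  finally show ?thesis using C2 by simp
qed

section \<open>Bayes risk in the Gaussian model\<close>

lemma finite_tensor_index [simp]: "finite (tensor_index p)"
  by (simp add: tensor_index_def)

section \<open>Gaussian likelihoods with respect to Lebesgue measure\<close>

definition gauss :: "(nat \<Rightarrow> nat) \<Rightarrow> real \<Rightarrow> tensor \<Rightarrow> tensor \<Rightarrow> real" where
  "gauss p \<sigma> X y = (\<Prod>x\<in>tensor_index p. normal_density (X x) \<sigma> (y x))"

definition lebesgue_tensor :: "(nat \<Rightarrow> nat) \<Rightarrow> tensor measure" where
  "lebesgue_tensor p = (\<Pi>\<^sub>M x\<in>tensor_index p. lborel)"

lemma sets_lebesgue_tensor [measurable_cong]: "sets (lebesgue_tensor p) = sets (tensor_space p)"
  unfolding lebesgue_tensor_def tensor_space_def by (intro sets_PiM_cong) auto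

lemma space_lebesgue_tensor: "space (lebesgue_tensor p) = space (tensor_space p)"
  using sets_lebesgue_tensor by (rule sets_eq_imp_space_eq)

lemma measurable_tensor_component [measurable]:
  "x \<in> tensor_index p \<Longrightarrow> (\<lambda>y. y x) \<in> borel_measurable (tensor_space p)"
  unfolding tensor_space_def by (rule measurable_component_singleton)

lemma gauss_nonneg: "0 \<le> gauss p \<sigma> X y"
  unfolding gauss_def by (intro prod_nonneg) auto

lemma gauss_measurable [measurable]: "gauss p \<sigma> X \<in> borel_measurable (tensor_space p)"
  unfolding gauss_def by measurable

abbreviation normal_measure :: "real \<Rightarrow> real \<Rightarrow> real measure" where
  "normal_measure m \<sigma> \<equiv> density lborel (normal_density m \<sigma>)"

lemma PiM_normal_density:
  assumes "\<sigma> > 0"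
  shows "(\<Pi>\<^sub>M x\<in>tensor_index p. normal_measure (X x) \<sigma>)
    = density (lebesgue_tensor p) (gauss p \<sigma> X)"
proof -
  let ?I = "tensor_index p"
  interpret N: product_sigma_finite "\<lambda>x. normal_measure (X x) \<sigma>"
    unfolding product_sigma_finite_def using assms
    by (auto intro!: prob_space_imp_sigma_finite prob_space_normal_density)
  interpret L: product_sigma_finite "\<lambda>x::nat \<times> nat \<times> nat. lborel :: real measure" by standard
  show ?thesis
  proof (rule N.PiM_eqI[symmetric])
    show "sets (density (lebesgue_tensor p) (gauss p \<sigma> X))
        = sets (\<Pi>\<^sub>M x\<in>?I. normal_measure (X x) \<sigma>)"
      unfolding lebesgue_tensor_def sets_density by (intro sets_PiM_cong) auto
    fix A :: "nat \<times> nat \<times> nat \<Rightarrow> real set"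
    assume A: "\<And>i. i \<in> ?I \<Longrightarrow> A i \<in> sets (normal_measure (X i) \<sigma>)"
    then have [measurable]: "\<And>i. i \<in> ?I \<Longrightarrow> A i \<in> sets borel" by simp
    have PA: "Pi\<^sub>E ?I A \<in> sets (lebesgue_tensor p)"
      unfolding lebesgue_tensor_def by (rule sets_PiM_I_finite) auto
    have "emeasure (density (lebesgue_tensor p) (gauss p \<sigma> X)) (Pi\<^sub>E ?I A)
        = (\<integral>\<^sup>+y. ennreal (gauss p \<sigma> X y) * indicator (Pi\<^sub>E ?I A) y \<partial>lebesgue_tensor p)"
      by (rule emeasure_density) (use PA in \<open>auto intro!: measurable_compose[OF gauss_measurable] simp: measurable_cong_sets[OF sets_lebesgue_tensor refl]\<close>)
    also have "\<dots> = (\<integral>\<^sup>+y. (\<Prod>i\<in>?I. ennreal (normal_density (X i) \<sigma> (y i)) * indicator (A i) (y i)) \<partial>lebesgue_tensor p)"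
    proof (rule nn_integral_cong)
      fix y assume "y \<in> space (lebesgue_tensor p)"
      \<comment> \<open>Points of the product space are \<open>undefined\<close> off the index set,
        so membership in the box is a condition on the coordinates alone.\<close>
      then have "y \<in> extensional ?I" by (auto simp: lebesgue_tensor_def space_PiM PiE_def)
      then have "indicator (Pi\<^sub>E ?I A) y = (\<Prod>i\<in>?I. indicator (A i) (y i) :: ennreal)"
      proof (cases "y \<in> Pi\<^sub>E ?I A")
        case True
        then have "(\<Prod>i\<in>?I. indicator (A i) (y i) :: ennreal) = 1"
          by (intro prod.neutral) (auto simp: PiE_def Pi_def)
        then show ?thesis using True by simp
      next
        case False
        then obtain i where "i \<in> ?I" "y i \<notin> A i"
          using \<open>y \<in> extensional ?I\<close> by (auto simp: PiE_def Pi_def)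
        then have "(\<Prod>i\<in>?I. indicator (A i) (y i) :: ennreal) = 0"
          by (intro prod_zero, simp, intro bexI[of _ i]) simp_all
        then show ?thesis using False by simp
      qed
      then show "ennreal (gauss p \<sigma> X y) * indicator (Pi\<^sub>E ?I A) y
          = (\<Prod>i\<in>?I. ennreal (normal_density (X i) \<sigma> (y i)) * indicator (A i) (y i))"
        by (simp add: gauss_def prod.distrib prod_ennreal)
    qed
    also have "\<dots> = (\<Prod>i\<in>?I. \<integral>\<^sup>+x. ennreal (normal_density (X i) \<sigma> x) * indicator (A i) x \<partial>lborel)"
      unfolding lebesgue_tensor_def by (rule L.product_nn_integral_prod) auto
    also have "\<dots> = (\<Prod>i\<in>?I. emeasure (normal_measure (X i) \<sigma>) (A i))"
      by (intro prod.cong refl) (simp add: emeasure_density)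
    finally show "emeasure (density (lebesgue_tensor p) (gauss p \<sigma> X)) (Pi\<^sub>E ?I A)
      = (\<Prod>i\<in>?I. emeasure (normal_measure (X i) \<sigma>) (A i))" .
  qed simp
qed

lemma nn_integral_gauss:
  assumes "\<sigma> > 0" shows "(\<integral>\<^sup>+y. ennreal (gauss p \<sigma> X y) \<partial>lebesgue_tensor p) = 1"
proof -
  interpret L: product_sigma_finite "\<lambda>x::nat \<times> nat \<times> nat. lborel :: real measure" by standard
  have "(\<integral>\<^sup>+y. ennreal (gauss p \<sigma> X y) \<partial>lebesgue_tensor p)
      = (\<integral>\<^sup>+y. (\<Prod>i\<in>tensor_index p. ennreal (normal_density (X i) \<sigma> (y i))) \<partial>lebesgue_tensor p)"
    by (simp add: gauss_def prod_ennreal)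
  also have "\<dots> = (\<Prod>i\<in>tensor_index p. \<integral>\<^sup>+x. ennreal (normal_density (X i) \<sigma> x) \<partial>lborel)"
    unfolding lebesgue_tensor_def by (rule L.product_nn_integral_prod) auto
  also have "\<dots> = 1"
  proof (rule prod.neutral, rule ballI)
    fix i
    interpret prob_space "normal_measure (X i) \<sigma>" by (rule prob_space_normal_density[OF assms])
    show "(\<integral>\<^sup>+x. ennreal (normal_density (X i) \<sigma> x) \<partial>lborel) = 1"
      using emeasure_space_1 by (simp add: emeasure_density)
  qed
  finally show ?thesis .
qed

lemma gauss_integrable:
  assumes "\<sigma> > 0"
  shows "integrable (lebesgue_tensor p) (gauss p \<sigma> X)" "(\<integral>y. gauss p \<sigma> X y \<partial>lebesgue_tensor p) = 1"
proof -
  have m: "gauss p \<sigma> X \<in> borel_measurable (lebesgue_tensor p)" by measurable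
  have "has_bochner_integral (lebesgue_tensor p) (gauss p \<sigma> X) 1"
    by (rule has_bochner_integral_nn_integral) (use m nn_integral_gauss[OF assms] in \<open>auto simp: gauss_nonneg\<close>)
  then show "integrable (lebesgue_tensor p) (gauss p \<sigma> X)" "(\<integral>y. gauss p \<sigma> X y \<partial>lebesgue_tensor p) = 1"
    by (auto simp: has_bochner_integral_iff)
qed

lemma shift_measurable:
  "(\<lambda>Z. \<lambda>x\<in>tensor_index p. X x + Z x) \<in> measurable (noise p \<sigma>) (lebesgue_tensor p)"
proof -
  have [measurable]: "(\<lambda>Z. Z x) \<in> borel_measurable (noise p \<sigma>)" if "x \<in> tensor_index p" for x
    using measurable_component_singleton[OF that, of "\<lambda>x. normal_measure 0 \<sigma>"]
    by (simp add: noise_def measurable_density_eq1 cong: measurable_cong_sets)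
  show ?thesis unfolding lebesgue_tensor_def by (intro measurable_restrict) measurable
qed

text \<open>Both measures are the product of the shifted normal laws, as is checked on boxes. The
  risks at all hypotheses thereby become integrals against one dominating measure, with likelihoods
  as weights.\<close>

lemma distr_shifted_noise:
  assumes "\<sigma> > 0"
  shows "distr (noise p \<sigma>) (lebesgue_tensor p) (\<lambda>Z. \<lambda>x\<in>tensor_index p. X x + Z x)
    = density (lebesgue_tensor p) (gauss p \<sigma> X)"
proof -
  let ?I = "tensor_index p"
  interpret N0: product_sigma_finite "\<lambda>x::nat \<times> nat \<times> nat. normal_measure 0 \<sigma>"
    unfolding product_sigma_finite_def using assms
    by (auto intro!: prob_space_imp_sigma_finite prob_space_normal_density)
  interpret N: product_sigma_finite "\<lambda>x. normal_measure (X x) \<sigma>"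
    unfolding product_sigma_finite_def using assms
    by (auto intro!: prob_space_imp_sigma_finite prob_space_normal_density)
  let ?T = "\<lambda>Z. \<lambda>x\<in>?I. X x + Z x"
  note T = shift_measurable[of X p \<sigma>]
  have "distr (noise p \<sigma>) (lebesgue_tensor p) ?T = (\<Pi>\<^sub>M x\<in>?I. normal_measure (X x) \<sigma>)"
  proof (rule N.PiM_eqI)
    show "sets (distr (noise p \<sigma>) (lebesgue_tensor p) ?T)
        = sets (\<Pi>\<^sub>M x\<in>?I. normal_measure (X x) \<sigma>)"
      unfolding lebesgue_tensor_def sets_distr by (intro sets_PiM_cong) auto
    fix A :: "nat \<times> nat \<times> nat \<Rightarrow> real set"
    assume A: "\<And>i. i \<in> ?I \<Longrightarrow> A i \<in> sets (normal_measure (X i) \<sigma>)"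
    then have Ab [measurable]: "\<And>i. i \<in> ?I \<Longrightarrow> A i \<in> sets borel" by simp
    have PA: "Pi\<^sub>E ?I A \<in> sets (lebesgue_tensor p)"
      unfolding lebesgue_tensor_def by (rule sets_PiM_I_finite) auto
    have "emeasure (distr (noise p \<sigma>) (lebesgue_tensor p) ?T) (Pi\<^sub>E ?I A)
        = emeasure (noise p \<sigma>) (?T -` Pi\<^sub>E ?I A \<inter> space (noise p \<sigma>))"
      by (rule emeasure_distr[OF T PA])
    also have "?T -` Pi\<^sub>E ?I A \<inter> space (noise p \<sigma>)
        = Pi\<^sub>E ?I (\<lambda>i. (+) (X i) -` A i)"
      by (auto simp: noise_def space_PiM PiE_def Pi_def)
    also have "emeasure (noise p \<sigma>) \<dots>
        = (\<Prod>i\<in>?I. emeasure (normal_measure 0 \<sigma>) ((+) (X i) -` A i))"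
      unfolding noise_def
    proof (rule N0.emeasure_PiM)
      fix i assume "i \<in> ?I"
      then have "(+) (X i) -` A i \<inter> space borel \<in> sets borel"
        by (intro measurable_sets[of _ borel borel] Ab) auto
      then show "(+) (X i) -` A i \<in> sets (normal_measure 0 \<sigma>)" by simp
    qed simp
    also have "\<dots> = (\<Prod>i\<in>?I. emeasure (normal_measure (X i) \<sigma>) (A i))"
    proof (intro prod.cong refl)
      fix i assume i: "i \<in> ?I"
      have "(+) (X i) -` A i \<inter> space borel \<in> sets borel"
        using i by (intro measurable_sets[of _ borel borel] Ab) auto
      then have [measurable]: "(+) (X i) -` A i \<in> sets borel" by simp
      have [measurable]: "A i \<in> sets borel" using Ab i .
      have "emeasure (normal_measure (X i) \<sigma>) (A i)
          = (\<integral>\<^sup>+x. ennreal (normal_density (X i) \<sigma> x) * indicator (A i) x \<partial>lborel)"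
        by (rule emeasure_density) auto
      also have "\<dots> = (\<integral>\<^sup>+x. ennreal (normal_density (X i) \<sigma> (X i + 1 * x)) * indicator (A i) (X i + 1 * x) \<partial>lborel)"
        by (subst nn_integral_real_affine[where c = 1 and t = "X i"]) auto
      also have "\<dots> = (\<integral>\<^sup>+x. ennreal (normal_density 0 \<sigma> x) * indicator ((+) (X i) -` A i) x \<partial>lborel)"
        by (intro nn_integral_cong) (auto simp: normal_density_def indicator_def)
      also have "\<dots> = emeasure (normal_measure 0 \<sigma>) ((+) (X i) -` A i)"
        by (rule emeasure_density[symmetric]) auto
      finally show "emeasure (normal_measure 0 \<sigma>) ((+) (X i) -` A i)
        = emeasure (normal_measure (X i) \<sigma>) (A i)" ..
    qed
    finally show "emeasure (distr (noise p \<sigma>) (lebesgue_tensor p) ?T) (Pi\<^sub>E ?I A)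
      = (\<Prod>i\<in>?I. emeasure (normal_measure (X i) \<sigma>) (A i))" .
  qed simp
  then show ?thesis using PiM_normal_density[OF assms] by simp
qed

lemma risk_eq_integral:
  assumes "\<sigma> > 0" and [measurable]: "loss \<in> borel_measurable (tensor_space p)"
  shows "risk p \<sigma> X loss = (\<integral>\<^sup>+y. ennreal (gauss p \<sigma> X y) * ennreal (loss y) \<partial>lebesgue_tensor p)"
proof -
  let ?T = "\<lambda>Z. \<lambda>x\<in>tensor_index p. X x + Z x"
  note T = shift_measurable[of X p \<sigma>]
  have "risk p \<sigma> X loss = (\<integral>\<^sup>+y. ennreal (loss y) \<partial>distr (noise p \<sigma>) (lebesgue_tensor p) ?T)"
    unfolding risk_def by (rule nn_integral_distr[OF T, symmetric]) measurable
  also have "\<dots> = (\<integral>\<^sup>+y. ennreal (gauss p \<sigma> X y) * ennreal (loss y) \<partial>lebesgue_tensor p)"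
    unfolding distr_shifted_noise[OF assms(1)] by (rule nn_integral_density) measurable
  finally show ?thesis .
qed

lemma normal_density_mult:
  assumes "\<sigma> > 0"
  shows "normal_density a \<sigma> x * normal_density b \<sigma> x
    = (exp (- (a - b)\<^sup>2 / (8 * \<sigma>\<^sup>2)) * normal_density ((a + b) / 2) \<sigma> x)\<^sup>2"
proof -
  have "- (x - a)\<^sup>2 / (2 * \<sigma>\<^sup>2) + - (x - b)\<^sup>2 / (2 * \<sigma>\<^sup>2)
      = 2 * (- (a - b)\<^sup>2 / (8 * \<sigma>\<^sup>2)) + 2 * (- (x - (a + b) / 2)\<^sup>2 / (2 * \<sigma>\<^sup>2))"
    using assms by (simp add: field_simps power2_eq_square)
  then have "exp (- (x - a)\<^sup>2 / (2 * \<sigma>\<^sup>2)) * exp (- (x - b)\<^sup>2 / (2 * \<sigma>\<^sup>2))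
      = (exp (- (a - b)\<^sup>2 / (8 * \<sigma>\<^sup>2)) * exp (- (x - (a + b) / 2)\<^sup>2 / (2 * \<sigma>\<^sup>2)))\<^sup>2"
    by (simp add: power_mult_distrib exp_double[symmetric] flip: exp_add)
  then show ?thesis by (simp add: normal_density_def power_mult_distrib power_divide)
qed

abbreviation sq_dist :: "(nat \<Rightarrow> nat) \<Rightarrow> tensor \<Rightarrow> tensor \<Rightarrow> real" where
  "sq_dist p X Y \<equiv> \<Sum>x\<in>tensor_index p. (X x - Y x)\<^sup>2"

text \<open>Completing the square: the geometric mean of two likelihoods is the likelihood at the
  midpoint times their Hellinger affinity. As that likelihood integrates to \<open>1\<close>, the
  affinity can be read off.\<close>

lemma sqrt_gauss_mult:
  assumes "\<sigma> > 0"
  shows "sqrt (gauss p \<sigma> X y * gauss p \<sigma> X' y)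
    = exp (- sq_dist p X X' / (8 * \<sigma>\<^sup>2)) * gauss p \<sigma> (\<lambda>x. (X x + X' x) / 2) y"
proof -
  have "gauss p \<sigma> X y * gauss p \<sigma> X' y
      = (\<Prod>x\<in>tensor_index p. exp (- (X x - X' x)\<^sup>2 / (8 * \<sigma>\<^sup>2)) * normal_density ((X x + X' x) / 2) \<sigma> (y x))\<^sup>2"
    by (simp only: gauss_def prod.distrib[symmetric] normal_density_mult[OF assms] prod_power_distrib)
  also have "(\<Prod>x\<in>tensor_index p. exp (- (X x - X' x)\<^sup>2 / (8 * \<sigma>\<^sup>2)) * normal_density ((X x + X' x) / 2) \<sigma> (y x))
      = exp (- sq_dist p X X' / (8 * \<sigma>\<^sup>2)) * gauss p \<sigma> (\<lambda>x. (X x + X' x) / 2) y"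
    by (simp add: prod.distrib gauss_def exp_sum[symmetric] sum_negf sum_divide_distrib)
  finally show ?thesis by (simp add: gauss_nonneg)
qed

section \<open>Posterior averages over the cube of bits\<close>

lemma sum_Pow_split:
  fixes g :: "'b set \<Rightarrow> real"
  assumes "finite B" "b \<in> B"
  shows "(\<Sum>w\<in>Pow B. g w) = (\<Sum>w\<in>Pow (B - {b}). g w) + (\<Sum>w\<in>Pow (B - {b}). g (insert b w))"
proof -
  have "(\<Sum>w\<in>{w \<in> Pow B. b \<in> w}. g w) = (\<Sum>w\<in>Pow (B - {b}). g (insert b w))"
    by (rule sum.reindex_bij_witness[of _ "insert b" "\<lambda>w. w - {b}"]) (use assms in \<open>auto simp: insert_absorb\<close>)
  moreover have "(\<Sum>w\<in>Pow B. g w) = (\<Sum>w\<in>Pow (B - {b}). g w) + (\<Sum>w\<in>{w \<in> Pow B. b \<in> w}. g w)"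
    using assms by (subst sum.union_disjoint[symmetric]) (auto intro!: sum.cong)
  ultimately show ?thesis by simp
qed

abbreviation hamming :: "'b set \<Rightarrow> 'b set \<Rightarrow> 'b set \<Rightarrow> real" where
  "hamming B w w' \<equiv> \<Sum>b\<in>B. of_bool ((b \<in> w) \<noteq> (b \<in> w'))"

text \<open>Two independent draws from the posterior differ in the bit \<open>b\<close> with a probability that the
  affinities of neighbouring hypotheses bound from below; the triangle-type hypothesis turns
  this into a bound for the posterior risk.\<close>

lemma replica_bound:
  fixes f l q :: "'b set \<Rightarrow> real"
  assumes B: "finite B" and f: "\<And>w. w \<in> Pow B \<Longrightarrow> 0 \<le> f w" and "0 \<le> \<beta>" "0 \<le> \<tau>"
    and tri: "\<And>w w'. w \<in> Pow B \<Longrightarrow> w' \<in> Pow B \<Longrightarrow>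
      \<beta> * hamming B w w' - q w - q w' \<le> l w + l w'"
  shows "\<beta> * (\<Sum>b\<in>B. 2 * \<tau> * (\<Sum>w\<in>Pow (B - {b}). sqrt (f w * f (insert b w))) - \<tau>\<^sup>2 * (\<Sum>w\<in>Pow B. f w))
    - (\<Sum>w\<in>Pow B. f w * q w) \<le> (\<Sum>w\<in>Pow B. f w * l w)"
proof -
  let ?q = "\<Sum>w\<in>Pow B. f w * q w" and ?l = "\<Sum>w\<in>Pow B. f w * l w"
    and ?L = "\<Sum>w\<in>Pow B. \<Sum>w'\<in>Pow B. f w * f w' * (\<beta> * hamming B w w' - q w - q w')"
    and ?D = "\<lambda>b. \<Sum>w\<in>Pow B. \<Sum>w'\<in>Pow B. f w * f w' * of_bool ((b \<in> w) \<noteq> (b \<in> w'))"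
  define F where "F = (\<Sum>w\<in>Pow B. f w)"
  define P where "P b = (\<Sum>w\<in>Pow (B - {b}). f (insert b w))" for b
  define N where "N b = (\<Sum>w\<in>Pow (B - {b}). f w)" for b
  define S where "S b = (\<Sum>w\<in>Pow (B - {b}). sqrt (f w * f (insert b w)))" for b
  have fin: "finite (Pow B)" using B by simp
  have F0: "F \<ge> 0" unfolding F_def using f by (rule sum_nonneg)
  have diff: "?D b = 2 * (P b * N b)"
    if b: "b \<in> B" for b
  proof -
    have "(\<Sum>w'\<in>Pow B. f w * f w' * of_bool ((b \<in> w) \<noteq> (b \<in> w'))) = f w * (if b \<in> w then N b else P b)" for w
      unfolding sum_Pow_split[OF B b] by (auto simp: P_def N_def sum_distrib_left intro!: sum.cong sum.neutral)
    then have "?D b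
        = (\<Sum>w\<in>Pow B. f w * (if b \<in> w then N b else P b))" by simp
    also have "\<dots> = (\<Sum>w\<in>Pow (B - {b}). f w * P b) + (\<Sum>w\<in>Pow (B - {b}). f (insert b w) * N b)"
      unfolding sum_Pow_split[OF B b] by (auto intro!: arg_cong2[where f = "(+)"] sum.cong)
    also have "\<dots> = 2 * (P b * N b)" by (simp add: P_def N_def flip: sum_distrib_right)
    finally show ?thesis .
  qed
  have CS: "(S b)\<^sup>2 \<le> P b * N b" if "b \<in> B" for b
  proof -
    have "S b = (\<Sum>w\<in>Pow (B - {b}). sqrt (f w) * sqrt (f (insert b w)))"
      by (simp add: S_def real_sqrt_mult)
    then have "(S b)\<^sup>2 \<le> (\<Sum>w\<in>Pow (B - {b}). (sqrt (f w))\<^sup>2) * (\<Sum>w\<in>Pow (B - {b}). (sqrt (f (insert b w)))\<^sup>2)"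
      using Cauchy_Schwarz_ineq_sum[of "\<lambda>w. sqrt (f w)" "\<lambda>w. sqrt (f (insert b w))"] by simp
    also have "\<dots> = N b * P b"
    proof -
      have "(\<Sum>w\<in>Pow (B - {b}). (sqrt (f w))\<^sup>2) = N b" unfolding N_def
        by (intro sum.cong refl real_sqrt_pow2 f) auto
      moreover have "(\<Sum>w\<in>Pow (B - {b}). (sqrt (f (insert b w)))\<^sup>2) = P b" unfolding P_def
        using that by (intro sum.cong refl real_sqrt_pow2 f) auto
      ultimately show ?thesis by simp
    qed
    finally show ?thesis by (simp add: mult.commute)
  qed
  have S0: "0 \<le> S b" if "b \<in> B" for b
  proof -
    have "0 \<le> f w * f (insert b w)" if "w \<in> Pow (B - {b})" for w
      using that \<open>b \<in> B\<close> by (intro mult_nonneg_nonneg f) auto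
    then show ?thesis unfolding S_def by (intro sum_nonneg) simp
  qed
  \<comment> \<open>Expanding a square replaces the posterior quantity \<open>S^2 / F\<close> by an
    expression linear in \<open>S\<close> and \<open>F\<close>, which can later be integrated over
    the observation.\<close>
  have step: "F * (2 * \<tau> * S b - \<tau>\<^sup>2 * F) \<le> P b * N b" if "b \<in> B" for b
  proof -
    have "0 \<le> (S b - \<tau> * F)\<^sup>2" by simp
    then show ?thesis using CS[OF that] by (simp add: power2_eq_square algebra_simps)
  qed
  have "?L
      \<le> (\<Sum>w\<in>Pow B. \<Sum>w'\<in>Pow B. f w * f w' * (l w + l w'))"
    using f by (intro sum_mono mult_left_mono tri) auto
  also have "\<dots> = 2 * (F * ?l)"
  proof -
    have "(\<Sum>w\<in>Pow B. \<Sum>w'\<in>Pow B. f w * f w' * (l w + l w'))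
        = (\<Sum>w\<in>Pow B. \<Sum>w'\<in>Pow B. (f w * l w) * f w') + (\<Sum>w\<in>Pow B. \<Sum>w'\<in>Pow B. f w * (f w' * l w'))"
      by (simp add: distrib_left sum.distrib mult_ac)
    also have "\<dots> = ?l * F + F * ?l"
      by (simp add: F_def sum_product)
    finally show ?thesis by simp
  qed
  also have "?L
      = \<beta> * (\<Sum>b\<in>B. 2 * (P b * N b)) - 2 * (F * ?q)"
  proof -
    have "?L
      = \<beta> * (\<Sum>w\<in>Pow B. \<Sum>w'\<in>Pow B. \<Sum>b\<in>B. f w * f w' * of_bool ((b \<in> w) \<noteq> (b \<in> w')))
        - (\<Sum>w\<in>Pow B. \<Sum>w'\<in>Pow B. (f w * q w) * f w') - (\<Sum>w\<in>Pow B. \<Sum>w'\<in>Pow B. f w * (f w' * q w'))"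
      by (simp only: right_diff_distrib sum_subtractf sum_distrib_left mult_ac)
    also have "(\<Sum>w\<in>Pow B. \<Sum>w'\<in>Pow B. \<Sum>b\<in>B. f w * f w' * of_bool ((b \<in> w) \<noteq> (b \<in> w')))
        = (\<Sum>w\<in>Pow B. \<Sum>b\<in>B. \<Sum>w'\<in>Pow B. f w * f w' * of_bool ((b \<in> w) \<noteq> (b \<in> w')))"
      by (intro sum.cong refl sum.swap)
    also have "\<dots> = (\<Sum>b\<in>B. \<Sum>w\<in>Pow B. \<Sum>w'\<in>Pow B. f w * f w' * of_bool ((b \<in> w) \<noteq> (b \<in> w')))"
      by (rule sum.swap)
    also have "\<dots> = (\<Sum>b\<in>B. 2 * (P b * N b))" by (intro sum.cong refl diff)
    also have "(\<Sum>w\<in>Pow B. \<Sum>w'\<in>Pow B. (f w * q w) * f w') = ?q * F"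
      by (simp only: F_def sum_product)
    also have "(\<Sum>w\<in>Pow B. \<Sum>w'\<in>Pow B. f w * (f w' * q w')) = F * ?q"
      by (simp only: F_def sum_product)
    finally show ?thesis by simp
  qed
  finally have main: "\<beta> * (\<Sum>b\<in>B. P b * N b) - F * ?q \<le> F * ?l"
    by (simp add: sum_distrib_left[symmetric])
  have "F * (\<beta> * (\<Sum>b\<in>B. 2 * \<tau> * S b - \<tau>\<^sup>2 * F)) \<le> \<beta> * (\<Sum>b\<in>B. P b * N b)"
  proof -
    have "F * (\<beta> * (\<Sum>b\<in>B. 2 * \<tau> * S b - \<tau>\<^sup>2 * F)) = \<beta> * (\<Sum>b\<in>B. F * (2 * \<tau> * S b - \<tau>\<^sup>2 * F))"
      by (simp only: sum_distrib_left mult.left_commute)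
    also have "\<dots> \<le> \<beta> * (\<Sum>b\<in>B. P b * N b)" using \<open>0 \<le> \<beta>\<close> step by (intro mult_left_mono sum_mono) auto
    finally show ?thesis .
  qed
  with main have *: "F * (\<beta> * (\<Sum>b\<in>B. 2 * \<tau> * S b - \<tau>\<^sup>2 * F) - ?q)
      \<le> F * ?l" by (simp add: right_diff_distrib)
  show ?thesis
  proof (cases "F = 0")
    case True
    have fz: "f w = 0" if "w \<in> Pow B" for w
      by (rule sum_nonneg_0[OF fin f True[unfolded F_def] that])
    have "S b = 0" if "b \<in> B" for b
      unfolding S_def using fz by (intro sum.neutral) auto
    then show ?thesis using True fz by (simp add: F_def[symmetric] S_def[symmetric])
  next
    case False
    then have "F > 0" using F0 by simp
    then show ?thesis using * by (simp add: F_def[symmetric] S_def[symmetric])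
  qed
qed

text \<open>The replica bound holds at every observation with the likelihoods as weights;
  integrated, it bounds the average risk and hence \<open>R\<close>. The error terms
  \<open>q\<close> enter only through their mean, bounded by \<open>Q\<close>.\<close>

lemma bayes_lower_bound:
  fixes X :: "'b set \<Rightarrow> tensor" and l :: "'b set \<Rightarrow> tensor \<Rightarrow> real"
  assumes B: "finite B" and \<sigma>: "\<sigma> > 0" and "0 \<le> \<beta>"
    and l_meas: "\<And>w. w \<in> Pow B \<Longrightarrow> l w \<in> borel_measurable (tensor_space p)"
    and l_nonneg: "\<And>w y. w \<in> Pow B \<Longrightarrow> 0 \<le> l w y"
    and tri: "\<And>w w' y. w \<in> Pow B \<Longrightarrow> w' \<in> Pow B \<Longrightarrow> y \<in> space (tensor_space p) \<Longrightarrow>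
      \<beta> * hamming B w w' - q w - q w' \<le> l w y + l w' y"
    and flip: "\<And>w b. b \<in> B \<Longrightarrow> w \<in> Pow (B - {b}) \<Longrightarrow>
      sq_dist p (X w) (X (insert b w)) \<le> 8 * \<sigma>\<^sup>2 * \<eta>"
    and q: "(\<Sum>w\<in>Pow B. q w) \<le> 2 ^ card B * Q"
    and R: "\<And>w. w \<in> Pow B \<Longrightarrow> risk p \<sigma> (X w) (l w) \<le> R"
  shows "ennreal (\<beta> * card B * (exp (- \<eta>))\<^sup>2 / 4 - Q) \<le> R"
proof -
  define a where "a = exp (- \<eta>)"
  define M where "M = lebesgue_tensor p"
  define f where "f w = gauss p \<sigma> (X w)" for w
  define E where "E w b = exp (- sq_dist p (X w) (X (insert b w)) / (8 * \<sigma>\<^sup>2))" for w b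
  define g where "g w b = gauss p \<sigma> (\<lambda>x. (X w x + X (insert b w) x) / 2)" for w b
  have int: "integrable M (f w)" "(\<integral>y. f w y \<partial>M) = 1" for w
    unfolding f_def M_def by (rule gauss_integrable[OF \<sigma>])+
  have intg: "integrable M (g w b)" "(\<integral>y. g w b y \<partial>M) = 1" for w b
    unfolding g_def M_def by (rule gauss_integrable[OF \<sigma>])+
  \<comment> \<open>The choice \<open>\<tau> = a / 2\<close> maximizes
    \<open>a * \<tau> - \<tau>^2\<close>, the guaranteed gain per bit, with maximum
    \<open>a^2 / 4\<close>. Geometric means of likelihoods are written as an affinity times a
    density, so that \<open>H\<close> integrates term by term.\<close>
  define H where "H y = \<beta> * (\<Sum>b\<in>B. a * (\<Sum>w\<in>Pow (B - {b}). E w b * g w b y) - (a / 2)\<^sup>2 * (\<Sum>w\<in>Pow B. f w y))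
    - (\<Sum>w\<in>Pow B. f w y * q w)" for y
  have H_int: "integrable M H"
    unfolding H_def using int(1) intg(1)
    by (intro Bochner_Integration.integrable_diff integrable_mult_right integrable_mult_left Bochner_Integration.integrable_sum)
  have "(\<integral>y. H y \<partial>M) = \<beta> * (\<Sum>b\<in>B. a * (\<Sum>w\<in>Pow (B - {b}). E w b) - (a / 2)\<^sup>2 * 2 ^ card B) - (\<Sum>w\<in>Pow B. q w)"
    unfolding H_def using int intg B
    by (simp add: Bochner_Integration.integral_diff Bochner_Integration.integral_sum card_Pow)
  also have "\<dots> \<ge> \<beta> * (\<Sum>b\<in>B. a * (2 ^ (card B - 1) * a) - (a / 2)\<^sup>2 * 2 ^ card B) - 2 ^ card B * Q"
  proof (intro diff_mono q mult_left_mono sum_mono \<open>0 \<le> \<beta>\<close> order_refl)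
    fix b assume b: "b \<in> B"
    have "a \<le> E w b" if "w \<in> Pow (B - {b})" for w
      using flip[OF b that] \<sigma> unfolding a_def E_def by (simp add: divide_le_eq mult_ac)
    then have "(\<Sum>w\<in>Pow (B - {b}). a) \<le> (\<Sum>w\<in>Pow (B - {b}). E w b)" by (rule sum_mono)
    then show "2 ^ (card B - 1) * a \<le> (\<Sum>w\<in>Pow (B - {b}). E w b)"
      using B b by (simp add: card_Pow)
  qed (simp_all add: a_def)
  also have "\<beta> * (\<Sum>b\<in>B. a * (2 ^ (card B - 1) * a) - (a / 2)\<^sup>2 * 2 ^ card B) - 2 ^ card B * Q
      = 2 ^ card B * (\<beta> * card B * a\<^sup>2 / 4 - Q)"
  proof (cases "card B = 0")
    case False
    then have "(2::real) ^ card B = 2 * 2 ^ (card B - 1)" by (metis power_eq_if)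
    then show ?thesis by (simp add: algebra_simps power2_eq_square)
  qed (use B in simp)
  finally have H_lower: "2 ^ card B * (\<beta> * card B * a\<^sup>2 / 4 - Q) \<le> (\<integral>y. H y \<partial>M)" .
  have l_meas': "l w \<in> borel_measurable M" if "w \<in> Pow B" for w
    using l_meas[OF that] unfolding M_def by (simp add: measurable_cong_sets[OF sets_lebesgue_tensor refl])
  have f_meas: "f w \<in> borel_measurable M" for w
    unfolding M_def f_def by measurable
  \<comment> \<open>\<open>H\<close> can be negative; it is truncated at \<open>0\<close> before
    passing to the nonnegative integral, and the pointwise bound survives because the weighted
    losses are nonnegative.\<close>
  have "ennreal (\<integral>y. H y \<partial>M) \<le> ennreal (\<integral>y. max 0 (H y) \<partial>M)"
    using H_int by (intro ennreal_leI integral_mono) auto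
  also have "\<dots> = (\<integral>\<^sup>+y. ennreal (max 0 (H y)) \<partial>M)"
    using H_int by (intro nn_integral_eq_integral[symmetric]) auto
  also have "\<dots> \<le> (\<integral>\<^sup>+y. (\<Sum>w\<in>Pow B. ennreal (f w y) * ennreal (l w y)) \<partial>M)"
  proof (rule nn_integral_mono)
    fix y assume "y \<in> space M"
    then have y: "y \<in> space (tensor_space p)" by (simp add: M_def space_lebesgue_tensor)
    have "\<beta> * (\<Sum>b\<in>B. 2 * (a / 2) * (\<Sum>w\<in>Pow (B - {b}). sqrt (f w y * f (insert b w) y)) - (a / 2)\<^sup>2 * (\<Sum>w\<in>Pow B. f w y))
        - (\<Sum>w\<in>Pow B. f w y * q w) \<le> (\<Sum>w\<in>Pow B. f w y * l w y)"
      by (rule replica_bound[OF B]) (use tri y \<open>0 \<le> \<beta>\<close> in \<open>auto simp: f_def gauss_nonneg a_def\<close>)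
    then have "H y \<le> (\<Sum>w\<in>Pow B. f w y * l w y)"
      unfolding f_def sqrt_gauss_mult[OF \<sigma>] by (simp add: H_def f_def g_def E_def)
    moreover have "0 \<le> (\<Sum>w\<in>Pow B. f w y * l w y)"
      using l_nonneg by (intro sum_nonneg mult_nonneg_nonneg) (auto simp: f_def gauss_nonneg)
    ultimately have "ennreal (max 0 (H y)) \<le> ennreal (\<Sum>w\<in>Pow B. f w y * l w y)"
      by (intro ennreal_leI) simp
    also have "\<dots> = (\<Sum>w\<in>Pow B. ennreal (f w y * l w y))"
      using l_nonneg by (intro sum_ennreal[symmetric] mult_nonneg_nonneg) (auto simp: f_def gauss_nonneg)
    also have "\<dots> = (\<Sum>w\<in>Pow B. ennreal (f w y) * ennreal (l w y))"
      using l_nonneg by (intro sum.cong refl ennreal_mult) (auto simp: f_def gauss_nonneg)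
    finally show "ennreal (max 0 (H y)) \<le> (\<Sum>w\<in>Pow B. ennreal (f w y) * ennreal (l w y))" .
  qed
  also have "\<dots> = (\<Sum>w\<in>Pow B. \<integral>\<^sup>+y. ennreal (f w y) * ennreal (l w y) \<partial>M)"
  proof (rule nn_integral_sum)
    fix w assume "w \<in> Pow B"
    note [measurable] = l_meas'[OF this] f_meas
    show "(\<lambda>y. ennreal (f w y) * ennreal (l w y)) \<in> borel_measurable M" by measurable
  qed
  also have "\<dots> = (\<Sum>w\<in>Pow B. risk p \<sigma> (X w) (l w))"
    unfolding f_def M_def by (intro sum.cong refl risk_eq_integral[OF \<sigma>, symmetric] l_meas)
  also have "\<dots> \<le> (\<Sum>w\<in>Pow B. R)" by (rule sum_mono) (rule R)
  also have "\<dots> = 2 ^ card B * R" using B by (simp add: card_Pow)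
  finally have up: "ennreal (\<integral>y. H y \<partial>M) \<le> 2 ^ card B * R" .
  show ?thesis
  proof (cases R)
    case (real r)
    have "ennreal (2 ^ card B * (\<beta> * card B * a\<^sup>2 / 4 - Q)) \<le> 2 ^ card B * R"
      using up H_lower by (meson ennreal_leI order_trans)
    also have "2 ^ card B * R = ennreal (2 ^ card B * r)"
      using real by (simp add: ennreal_mult ennreal_power[symmetric])
    finally have "2 ^ card B * (\<beta> * card B * a\<^sup>2 / 4 - Q) \<le> 2 ^ card B * r"
      using real by (simp add: ennreal_le_iff)
    then show ?thesis using real by (simp add: a_def ennreal_leI)
  qed simp
qed

section \<open>Random signs and balanced cores\<close>

definition signs :: "(nat \<times> nat) set \<Rightarrow> nat \<Rightarrow> nat \<Rightarrow> real" where
  "signs w i j = (if (i, j) \<in> w then 1 else - 1)"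

lemma signs_sq: "(\<Sum>i<n. \<Sum>j<r. (signs w i j)\<^sup>2) = real n * real r"
  by (simp add: signs_def if_distrib[of "\<lambda>x. x\<^sup>2"] cong: if_cong)

lemma signs_diff_sq:
  "(\<Sum>i<n. \<Sum>j<r. (signs w i j - signs w' i j)\<^sup>2)
    = 4 * hamming ({..<n} \<times> {..<r}) w w'"
  unfolding sum.cartesian_product sum_distrib_left
  by (rule sum.cong) (auto simp: signs_def)

text \<open>If both indices differ, flipping the single sign at \<open>(i, j)\<close> reverses the
  product, so the sum cancels in pairs; otherwise each product is at most \<open>1\<close>.\<close>

lemma signs_corr:
  assumes "i < n" "i' < n" "j < r" "j' < r"
  shows "(\<Sum>w\<in>Pow ({..<n} \<times> {..<r}). signs w i j * signs w i j' * (signs w i' j * signs w i' j'))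
    \<le> 2 ^ (n * r) * (of_bool (i = i') + of_bool (j = j'))"
proof (cases "i = i' \<or> j = j'")
  case True
  have "(\<Sum>w\<in>Pow ({..<n} \<times> {..<r}). signs w i j * signs w i j' * (signs w i' j * signs w i' j'))
      \<le> (\<Sum>w\<in>Pow ({..<n} \<times> {..<r}). 1)"
    by (rule sum_mono) (auto simp: signs_def)
  also have "\<dots> = 2 ^ (n * r)" by (simp add: card_Pow card_cartesian_product)
  also have "\<dots> \<le> 2 ^ (n * r) * (of_bool (i = i') + of_bool (j = j'))" using True by auto
  finally show ?thesis .
next
  case False
  have "(\<Sum>w\<in>Pow ({..<n} \<times> {..<r}). signs w i j * signs w i j' * (signs w i' j * signs w i' j')) = 0"
    using assms by (subst sum_Pow_split[of _ "(i, j)"], simp, simp) (unfold sum.distrib[symmetric],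
      rule sum.neutral, use False in \<open>auto simp: signs_def\<close>)
  then show ?thesis by simp
qed

text \<open>Only quadruples with \<open>i = i'\<close> or \<open>j = j'\<close> contribute. For
  \<open>r \<le> n\<close> the mean is of order \<open>n^2 r\<close>, as if all \<open>r\<close>
  singular values were of order \<open>sqrt n\<close>; this dictates the scale of the
  certificate.\<close>

lemma gram_norm_signs_mean:
  "(\<Sum>w\<in>Pow ({..<n} \<times> {..<r}). gram_norm n r (signs w))
    \<le> 2 ^ card ({..<n} \<times> {..<r}) * ((real n)\<^sup>2 * real r + real n * (real r)\<^sup>2)"
proof -
  let ?P = "Pow ({..<n} \<times> {..<r})"
  let ?s = "\<lambda>w i i' j j'. signs w i j * signs w i j' * (signs w i' j * signs w i' j')"
  have "(\<Sum>w\<in>?P. gram_norm n r (signs w)) = (\<Sum>w\<in>?P. \<Sum>j<r. \<Sum>j'<r. \<Sum>i<n. \<Sum>i'<n. ?s w i i' j j')"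
    by (simp add: gram_norm_def power2_eq_square sum_product)
  also have "\<dots> = (\<Sum>j<r. \<Sum>w\<in>?P. \<Sum>j'<r. \<Sum>i<n. \<Sum>i'<n. ?s w i i' j j')" by (rule sum.swap)
  also have "\<dots> = (\<Sum>j<r. \<Sum>j'<r. \<Sum>w\<in>?P. \<Sum>i<n. \<Sum>i'<n. ?s w i i' j j')"
    by (intro sum.cong refl sum.swap)
  also have "\<dots> = (\<Sum>j<r. \<Sum>j'<r. \<Sum>i<n. \<Sum>w\<in>?P. \<Sum>i'<n. ?s w i i' j j')"
    by (intro sum.cong refl sum.swap)
  also have "\<dots> = (\<Sum>j<r. \<Sum>j'<r. \<Sum>i<n. \<Sum>i'<n. \<Sum>w\<in>?P. ?s w i i' j j')"
    by (intro sum.cong refl sum.swap)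
  also have "\<dots> \<le> (\<Sum>j<r. \<Sum>j'<r. \<Sum>i<n. \<Sum>i'<n. 2 ^ (n * r) * (of_bool (i = i') + of_bool (j = j')))"
    by (intro sum_mono signs_corr) auto
  also have "\<dots> = 2 ^ (n * r) * (\<Sum>j<r. \<Sum>j'<r. real n + real n * real n * of_bool (j = j'))"
    by (simp add: sum.distrib of_bool_def mult.assoc flip: sum_distrib_left) (simp add: algebra_simps)
  also have "(\<Sum>j<r. \<Sum>j'<r. real n + real n * real n * of_bool (j = j')) = (real n)\<^sup>2 * real r + real n * (real r)\<^sup>2"
    by (simp add: sum.distrib of_bool_def power2_eq_square mult_ac flip: sum_distrib_left)
      (simp add: algebra_simps)
  finally show ?thesis by (simp add: card_cartesian_product)
qed

section \<open>Cores with evenly filled rows\<close>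

lemma card_residue_class_le:
  assumes "0 < (a::nat)"
  shows "card {t. t < c \<and> t mod a = i} \<le> c div a + 1"
proof -
  have "card {t. t < c \<and> t mod a = i} \<le> card {..c div a}"
  proof (rule card_inj_on_le[where f = "\<lambda>t. t div a"])
    show "inj_on (\<lambda>t. t div a) {t. t < c \<and> t mod a = i}"
      by (rule inj_onI) (metis (mono_tags, lifting) div_mult_mod_eq mem_Collect_eq)
  qed (auto intro: div_le_mono)
  then show ?thesis by simp
qed

text \<open>Going through \<open>{..<a} \<times> {..<b}\<close> diagonally repeats after \<open>lcm a b\<close> steps; shifting the second
  coordinate by one after each such period makes the first \<open>a * b\<close> cells distinct.\<close>

definition balanced_cells :: "nat \<Rightarrow> nat \<Rightarrow> nat \<Rightarrow> (nat \<Rightarrow> nat) \<Rightarrow> (nat \<Rightarrow> nat) \<Rightarrow> bool" where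
  "balanced_cells a b c f g \<longleftrightarrow> (\<forall>t<c. f t < a \<and> g t < b) \<and>
    (\<forall>t<c. \<forall>t'<c. f t = f t' \<and> g t = g t' \<longrightarrow> t = t') \<and>
    (\<forall>i<a. \<exists>t<c. f t = i) \<and> (\<forall>j<b. \<exists>t<c. g t = j) \<and>
    (\<forall>i. card {t. t < c \<and> f t = i} \<le> c div a + 1)"

lemma balanced_cellsD:
  assumes "balanced_cells a b c f g"
  shows "\<And>t. t < c \<Longrightarrow> f t < a \<and> g t < b"
    "\<And>t t'. t < c \<Longrightarrow> t' < c \<Longrightarrow> f t = f t' \<Longrightarrow> g t = g t' \<Longrightarrow> t = t'"
    "\<And>i. i < a \<Longrightarrow> \<exists>t<c. f t = i" "\<And>j. j < b \<Longrightarrow> \<exists>t<c. g t = j"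
    "\<And>i. card {t. t < c \<and> f t = i} \<le> c div a + 1"
  using assms unfolding balanced_cells_def by auto

lemma balanced_cells_exist:
  fixes a b c :: nat
  assumes "0 < a" "0 < b" "a \<le> c" "b \<le> c" "c \<le> a * b"
  obtains f g where "balanced_cells a b c f g"
proof -
  define L where "L = lcm a b"
  define d where "d = gcd a b"
  have Ld: "L * d = a * b" by (simp add: L_def d_def lcm_gcd)
  have "0 < L" unfolding L_def using assms by (intro lcm_pos_nat) auto
  have L: "b \<le> L" "a dvd L" "b dvd L"
    using \<open>0 < L\<close> by (auto simp: L_def intro!: dvd_imp_le)
  define g where "g t = (t + t div L) mod b" for t
  have q: "t div L < d" if "t < c" for t
    using that assms(5) Ld by (intro less_mult_imp_div_less) (simp add: mult.commute)
  show ?thesis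
  proof (rule that[of "\<lambda>t. t mod a" g], unfold balanced_cells_def, intro conjI allI impI)
    show "t mod a < a" "g t < b" for t using assms by (simp_all add: g_def)
    fix t t' assume "t < c" "t' < c" "t mod a = t' mod a \<and> g t = g t'"
    then have t: "t < c" "t' < c" "t mod a = t' mod a" "g t = g t'" by auto
    \<comment> \<open>Modulo the gcd \<open>d\<close>, equality of the second coordinates only
      compares the shifts \<open>t div L\<close>; these are below \<open>d\<close>, so both steps
      lie in the same period, where the two residues determine the step.\<close>
    have "[t = t'] (mod d)"
      using t(3) by (metis cong_def cong_dvd_modulus_nat d_def gcd_dvd1)
    moreover have "[t + t div L = t' + t' div L] (mod d)"
      using t(4) unfolding g_def by (metis cong_def cong_dvd_modulus_nat d_def gcd_dvd2)
    ultimately have "[t div L = t' div L] (mod d)"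
      by (meson cong_add_lcancel_nat cong_add cong_refl cong_sym cong_trans)
    then have eq: "t div L = t' div L" using q t(1,2) by (simp add: cong_def)
    then have "[t + t' div L = t' + t' div L] (mod b)" using t(4) by (simp add: g_def cong_def)
    then have "[t = t'] (mod b)" by (simp add: cong_add_rcancel_nat)
    then have "[t = t'] (mod L)" using t(3) unfolding L_def by (intro cong_cong_lcm_nat) (auto simp: cong_def)
    then show "t = t'" using eq by (metis cong_def div_mult_mod_eq)
  next
    show "\<exists>t<c. t mod a = i" if "i < a" for i using that assms by (intro exI[of _ i]) auto
    \<comment> \<open>The first \<open>b\<close> steps lie in the first period, as
      \<open>b \<le> L\<close>, so their shift is \<open>0\<close>.\<close>
    show "\<exists>t<c. g t = j" if "j < b" for j
      using that assms L by (intro exI[of _ j]) (auto simp: g_def)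
    show "card {t. t < c \<and> t mod a = i} \<le> c div a + 1" for i by (rule card_residue_class_le[OF assms(1)])
  qed
qed

text \<open>A partial Latin square in which every row, column and symbol occurs: the exclusion
  clauses give the rows of each matricization disjoint supports, the covering clauses make them
  nonzero.\<close>

definition latin_core :: "nat \<Rightarrow> nat \<Rightarrow> nat \<Rightarrow> (nat \<times> nat \<times> nat) set \<Rightarrow> bool" where
  "latin_core a b c T \<longleftrightarrow> T \<subseteq> {..<a} \<times> {..<b} \<times> {..<c} \<and>
    (\<forall>i i' j k. (i, j, k) \<in> T \<and> (i', j, k) \<in> T \<longrightarrow> i = i') \<and>
    (\<forall>i j j' k. (i, j, k) \<in> T \<and> (i, j', k) \<in> T \<longrightarrow> j = j') \<and>
    (\<forall>i j k k'. (i, j, k) \<in> T \<and> (i, j, k') \<in> T \<longrightarrow> k = k') \<and>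
    (\<forall>i<a. \<exists>j k. (i, j, k) \<in> T) \<and> (\<forall>j<b. \<exists>i k. (i, j, k) \<in> T) \<and> (\<forall>k<c. \<exists>i j. (i, j, k) \<in> T)"

text \<open>The core is a graph over the longest side, with values in the rectangle of the other
  two; it fits because that side is at most their product. One cell for each index of the longest
  side leaves few cells for each first index.\<close>

lemma latin_core_exists:
  fixes a b c :: nat
  assumes "0 < a" "0 < b" "0 < c" "a \<le> b * c" "b \<le> c * a" "c \<le> a * b"
  obtains T where "latin_core a b c T"
    "\<And>i. card {(j, k). (i, j, k) \<in> T} \<le> max a (max b c) div a + 1"
proof -
  have le: "card {(j, k). (i, j, k) \<in> T} \<le> N"
    if "{(j, k). (i, j, k) \<in> T} = h ` S" "finite S" "card S \<le> N" for i T S N and h :: "nat \<Rightarrow> nat \<times> nat"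
    using that card_image_le[of S h] by simp
  consider "a \<le> c" "b \<le> c" | "a \<le> b" "c \<le> b" | "b \<le> a" "c \<le> a" by linarith
  then show ?thesis
  proof cases
    case 1
    obtain f g where "balanced_cells a b c f g"
      by (rule balanced_cells_exist[of a b c]) (use assms 1 in \<open>simp_all\<close>)
    note fg = balanced_cellsD[OF this]
    define T where "T = {(i, j, k). k < c \<and> i = f k \<and> j = g k}"
    show ?thesis
    proof (rule that[of T])
      show "latin_core a b c T"
        unfolding latin_core_def T_def using fg(1-4) by (auto, blast+)
      show "card {(j, k). (i, j, k) \<in> T} \<le> max a (max b c) div a + 1" for i
        using 1 fg(5)[of i] by (intro le[of _ _ "\<lambda>t. (g t, t)" "{t. t < c \<and> f t = i}"]) (auto simp: T_def max_def)
    qed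
  next
    case 2
    obtain f g where "balanced_cells a c b f g"
      by (rule balanced_cells_exist[of a c b]) (use assms 2 in \<open>simp_all add: mult.commute\<close>)
    note fg = balanced_cellsD[OF this]
    define T where "T = {(i, j, k). j < b \<and> i = f j \<and> k = g j}"
    show ?thesis
    proof (rule that[of T])
      show "latin_core a b c T"
        unfolding latin_core_def T_def using fg(1-4) by (auto, blast+)
      show "card {(j, k). (i, j, k) \<in> T} \<le> max a (max b c) div a + 1" for i
        using 2 fg(5)[of i] by (intro le[of _ _ "\<lambda>t. (t, g t)" "{t. t < b \<and> f t = i}"]) (auto simp: T_def max_def)
    qed
  next
    case 3
    obtain f g where "balanced_cells b c a f g"
      by (rule balanced_cells_exist[of b c a]) (use assms 3 in \<open>simp_all\<close>)
    note fg = balanced_cellsD[OF this]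
    define T where "T = {(i, j, k). i < a \<and> j = f i \<and> k = g i}"
    show ?thesis
    proof (rule that[of T])
      show "latin_core a b c T"
        unfolding latin_core_def T_def using fg(1-4) by (auto, blast+)
      show "card {(j, k). (i, j, k) \<in> T} \<le> max a (max b c) div a + 1" for i
        by (intro le[of _ _ "\<lambda>t. (f i, g i)" "if i < a then {i} else {}"]) (auto simp: T_def)
    qed
  qed
qed

section \<open>A family of low rank tensors\<close>

declare sum_of_bool_eq [simp del] sum_mult_of_bool_eq [simp del] sum_of_bool_mult_eq [simp del]

section \<open>Cyclic symmetry of the three modes\<close>

definition nxt :: "nat \<Rightarrow> nat" where
  "nxt k = (if k = 1 then 2 else if k = 2 then 3 else 1)"

text \<open>\<open>tri k i a b\<close> is the tensor index with entry \<open>i\<close> in mode \<open>k\<close> and the entries \<open>a\<close>, \<open>b\<close> in the two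
  modes that follow \<open>k\<close> cyclically; it makes the three modes accessible to one argument.\<close>

definition tri :: "nat \<Rightarrow> nat \<Rightarrow> nat \<Rightarrow> nat \<Rightarrow> nat \<times> nat \<times> nat" where
  "tri k i a b = (if k = 1 then (i, a, b) else if k = 2 then (b, i, a) else (a, b, i))"

definition untri :: "nat \<Rightarrow> nat \<times> nat \<times> nat \<Rightarrow> nat \<times> nat \<times> nat" where
  "untri k = (\<lambda>(x, y, z). if k = 1 then (x, y, z) else if k = 2 then (y, z, x) else (z, x, y))"

lemma untri_tri [simp]: "untri k (tri k i a b) = (i, a, b)"
  by (simp add: untri_def tri_def)

lemma tri_nxt:
  assumes "k \<in> {1, 2, 3}"
  shows "tri (nxt k) i a b = tri k b i a" "tri (nxt (nxt k)) i a b = tri k a b i"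
    "nxt (nxt (nxt k)) = k" "nxt k \<in> {1, 2, 3}" "{1, 2, 3} = {k, nxt k, nxt (nxt k)}"
  using assms by (auto simp: tri_def nxt_def)

lemma tri_in_tensor_index:
  assumes "k \<in> {1, 2, 3}"
  shows "tri k i a b \<in> tensor_index p \<longleftrightarrow> i < p k \<and> a < p (nxt k) \<and> b < p (nxt (nxt k))"
  using assms by (auto simp: tri_def nxt_def tensor_index_def)

lemma sum_tensor_index:
  assumes k: "k \<in> {1, 2, 3}"
  shows "(\<Sum>x\<in>tensor_index p. f x) = (\<Sum>i<p k. \<Sum>a<p (nxt k). \<Sum>b<p (nxt (nxt k)). f (tri k i a b))"
proof -
  have "(\<Sum>i<p k. \<Sum>a<p (nxt k). \<Sum>b<p (nxt (nxt k)). f (tri k i a b))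
      = (\<Sum>(i, a, b)\<in>{..<p k} \<times> {..<p (nxt k)} \<times> {..<p (nxt (nxt k))}. f (tri k i a b))"
    by (simp add: sum.cartesian_product)
  also have "\<dots> = (\<Sum>x\<in>tensor_index p. f x)"
    by (rule sum.reindex_bij_witness[of _ "untri k" "\<lambda>(i, a, b). tri k i a b"])
       (use k in \<open>auto simp: tri_def untri_def nxt_def tensor_index_def\<close>)
  finally show ?thesis ..
qed

lemma matricization_tri:
  assumes "k \<in> {1, 2, 3}"
  shows "matricization p k X = Matrix.mat (p k) (p (nxt k) * p (nxt (nxt k)))
    (\<lambda>(i, c). X (tri k i (c div p (nxt (nxt k))) (c mod p (nxt (nxt k)))))"
  using assms by (auto simp: matricization_def tri_def nxt_def)

lemma sum_div_mod:
  fixes g :: "nat \<Rightarrow> nat \<Rightarrow> 'a :: comm_monoid_add"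
  shows "(\<Sum>c<P * Q. g (c div Q) (c mod Q)) = (\<Sum>a<P. \<Sum>b<Q. g a b)"
proof -
  have "(\<Sum>a<P. \<Sum>b<Q. g a b) = (\<Sum>(a, b)\<in>{..<P} \<times> {..<Q}. g a b)"
    by (simp add: sum.cartesian_product)
  also have "\<dots> = (\<Sum>c<P * Q. g (c div Q) (c mod Q))"
  proof (rule sum.reindex_bij_witness[of _ "\<lambda>c. (c div Q, c mod Q)" "\<lambda>(a, b). a * Q + b"])
    fix ab assume "ab \<in> {..<P} \<times> {..<Q}"
    then obtain a b where ab: "ab = (a, b)" "a < P" "b < Q" by auto
    then have "a * Q + b < a * Q + Q" by simp
    also have "\<dots> \<le> P * Q" using ab mult_le_mono1[of "Suc a" P Q] by simp
    finally show "(case ab of (a, b) \<Rightarrow> a * Q + b) \<in> {..<P * Q}" using ab by simp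
  next
    fix c assume c: "c \<in> {..<P * Q}"
    then have "0 < Q" by (cases Q) auto
    then show "(c div Q, c mod Q) \<in> {..<P} \<times> {..<Q}"
      using c by (auto intro: less_mult_imp_div_less)
  qed auto
  finally show ?thesis ..
qed

section \<open>Arrays with disjointly supported rows\<close>

lemma sum_exclusive_sq:
  fixes x :: "nat \<Rightarrow> real"
  assumes "\<And>i i'. i < d \<Longrightarrow> i' < d \<Longrightarrow> Q i \<Longrightarrow> Q i' \<Longrightarrow> i = i'"
  shows "(\<Sum>i<d. x i * of_bool (Q i))\<^sup>2 = (\<Sum>i<d. (x i)\<^sup>2 * of_bool (Q i))"
proof (cases "\<exists>i<d. Q i")
  case True
  then obtain i0 where i0: "i0 < d" "Q i0" by blast
  have *: "of_bool (Q i) = (if i = i0 then 1 else 0 :: real)" if "i < d" for i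
  proof (cases "Q i")
    case True
    then have "i = i0" using assms i0 that by blast
    then show ?thesis using i0 by simp
  next
    case False
    then have "i \<noteq> i0" using i0 by blast
    then show ?thesis using False by simp
  qed
  have "(\<Sum>i<d. z i * of_bool (Q i)) = z i0" for z :: "nat \<Rightarrow> real"
  proof -
    have "(\<Sum>i<d. z i * of_bool (Q i)) = (\<Sum>i<d. if i = i0 then z i else 0)"
      by (intro sum.cong refl) (simp add: *)
    then show ?thesis using i0 by simp
  qed
  then show ?thesis by simp
next
  case False
  then show ?thesis by simp
qed

text \<open>Pythagoras for orthogonal rows, the weights being the numbers of cells in the
  rows.\<close>

lemma sum_exclusive_sq2:
  fixes x :: "nat \<Rightarrow> real" and P P' :: nat
  assumes "\<forall>i i' u v. Q i u v \<longrightarrow> Q i' u v \<longrightarrow> i = i'"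
  shows "(\<Sum>u<P. \<Sum>v<P'. (\<Sum>i<d. x i * of_bool (Q i u v))\<^sup>2)
    = (\<Sum>i<d. (x i)\<^sup>2 * (\<Sum>u<P. \<Sum>v<P'. of_bool (Q i u v)))"
proof -
  have "(\<Sum>u<P. \<Sum>v<P'. (\<Sum>i<d. x i * of_bool (Q i u v))\<^sup>2)
      = (\<Sum>u<P. \<Sum>v<P'. \<Sum>i<d. (x i)\<^sup>2 * of_bool (Q i u v))"
    using assms by (intro sum.cong refl sum_exclusive_sq) blast
  also have "\<dots> = (\<Sum>u<P. \<Sum>i<d. \<Sum>v<P'. (x i)\<^sup>2 * of_bool (Q i u v))"
    by (intro sum.cong refl sum.swap)
  also have "\<dots> = (\<Sum>i<d. \<Sum>u<P. \<Sum>v<P'. (x i)\<^sup>2 * of_bool (Q i u v))" by (rule sum.swap)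
  finally show ?thesis by (simp only: sum_distrib_left)
qed

lemma sum_exclusive_sq2_ge:
  fixes x :: "nat \<Rightarrow> real" and P P' :: nat
  assumes "\<forall>i i' u v. Q i u v \<longrightarrow> Q i' u v \<longrightarrow> i = i'"
    and "\<forall>i<d. \<exists>u<P. \<exists>v<P'. Q i u v"
  shows "sumsq d x \<le> (\<Sum>u<P. \<Sum>v<P'. (\<Sum>i<d. x i * of_bool (Q i u v))\<^sup>2)"
  unfolding sum_exclusive_sq2[of Q, OF assms(1)]
proof (rule sum_mono)
  fix i assume "i \<in> {..<d}"
  then obtain u v where uv: "u < P" "v < P'" "Q i u v" using assms(2) by blast
  have "(1::real) \<le> (\<Sum>v<P'. of_bool (Q i u v))"
    by (rule order_trans[OF _ member_le_sum[of v]]) (use uv in auto)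
  also have "\<dots> \<le> (\<Sum>u<P. \<Sum>v<P'. of_bool (Q i u v))"
    by (rule member_le_sum[of u]) (use uv in \<open>auto intro: sum_nonneg\<close>)
  finally show "(x i)\<^sup>2 \<le> (x i)\<^sup>2 * (\<Sum>u<P. \<Sum>v<P'. of_bool (Q i u v))"
    using mult_left_mono[of 1 "\<Sum>u<P. \<Sum>v<P'. of_bool (Q i u v)" "(x i)\<^sup>2"] by simp
qed

text \<open>The core multiplied by \<open>lam A\<close> in mode \<open>k\<close>. In the other modes
  it is merely embedded by zeros, so that only the mode-\<open>k\<close> singular subspace depends
  on the hypothesis.\<close>

definition spiked_tensor ::
  "(nat \<Rightarrow> nat) \<Rightarrow> nat \<Rightarrow> nat \<Rightarrow> real \<Rightarrow> (nat \<Rightarrow> nat \<Rightarrow> real) \<Rightarrow> (nat \<times> nat \<times> nat) set \<Rightarrow> tensor" where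
  "spiked_tensor p k d lam A T = (\<lambda>x\<in>tensor_index p.
    case untri k x of (i, a, b) \<Rightarrow> lam * (\<Sum>j<d. A i j * of_bool ((j, a, b) \<in> T)))"

locale spiked_family =
  fixes p r :: "nat \<Rightarrow> nat" and k :: nat and lam :: real and T :: "(nat \<times> nat \<times> nat) set"
  assumes k: "k \<in> {1, 2, 3}" and lam: "0 < lam"
    and pr: "\<And>m. m \<in> {1, 2, 3} \<Longrightarrow> 1 \<le> r m \<and> r m \<le> p m"
    and T: "latin_core (r k) (r (nxt k)) (r (nxt (nxt k))) T"
begin

abbreviation "k' \<equiv> nxt k"
abbreviation "k'' \<equiv> nxt (nxt k)"
abbreviation "X A \<equiv> spiked_tensor p k (r k) lam A T"

text \<open>The squared length of the \<open>j\<close>-th row of the core, hence one of its squared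
  singular values in mode \<open>k\<close>.\<close>

definition mult :: "nat \<Rightarrow> real" where
  "mult j = (\<Sum>a<p k'. \<Sum>b<p k''. of_bool ((j, a, b) \<in> T))"

lemma pr_modes: "1 \<le> r k" "r k \<le> p k" "1 \<le> r k'" "r k' \<le> p k'" "1 \<le> r k''" "r k'' \<le> p k''"
  using pr tri_nxt(5)[OF k] by auto

lemma T_range: "(j, a, b) \<in> T \<Longrightarrow> j < r k \<and> a < r k' \<and> b < r k''"
  using T by (auto simp: latin_core_def)

lemma T_excl: "(j, a, b) \<in> T \<Longrightarrow> (j', a, b) \<in> T \<Longrightarrow> j = j'"
  "(j, a, b) \<in> T \<Longrightarrow> (j, a', b) \<in> T \<Longrightarrow> a = a'"
  "(j, a, b) \<in> T \<Longrightarrow> (j, a, b') \<in> T \<Longrightarrow> b = b'"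
  using T unfolding latin_core_def by blast+

lemma T_cover: "j < r k \<Longrightarrow> \<exists>a<p k'. \<exists>b<p k''. (j, a, b) \<in> T"
  "a < r k' \<Longrightarrow> \<exists>b<p k''. \<exists>j<r k. (j, a, b) \<in> T"
  "b < r k'' \<Longrightarrow> \<exists>j<r k. \<exists>a<p k'. (j, a, b) \<in> T"
  using T T_range pr_modes unfolding latin_core_def by (metis order_less_le_trans)+

lemma X_tri:
  assumes "i < p k" "a < p k'" "b < p k''"
  shows "X A (tri k i a b) = lam * (\<Sum>j<r k. A i j * of_bool ((j, a, b) \<in> T))"
  using assms tri_in_tensor_index[OF k] by (simp add: spiked_tensor_def)

lemma X_in_space: "X A \<in> space (tensor_space p)"
  by (simp add: spiked_tensor_def tensor_space_def space_PiM)

lemma mult_eq_card: "mult j = card {(a, b). (j, a, b) \<in> T}"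
proof -
  have "mult j = (\<Sum>ab\<in>{..<p k'} \<times> {..<p k''}. of_bool (ab \<in> {(a, b). (j, a, b) \<in> T}))"
    unfolding mult_def sum.cartesian_product by (rule sum.cong) auto
  also have "\<dots> = card (({..<p k'} \<times> {..<p k''}) \<inter> {(a, b). (j, a, b) \<in> T})"
    by (simp add: sum_of_bool_eq) (rule arg_cong[where f = card], auto)
  also have "({..<p k'} \<times> {..<p k''}) \<inter> {(a, b). (j, a, b) \<in> T} = {(a, b). (j, a, b) \<in> T}"
    using T_range pr_modes by force
  finally show ?thesis .
qed

lemma mult_ge_1: "j < r k \<Longrightarrow> 1 \<le> mult j"
proof -
  assume "j < r k"
  then have "{(a, b). (j, a, b) \<in> T} \<noteq> {}" using T_cover(1) by blast
  moreover have "finite {(a, b). (j, a, b) \<in> T}"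
    by (rule finite_subset[of _ "{..<r k'} \<times> {..<r k''}"]) (use T_range in auto)
  ultimately show ?thesis unfolding mult_eq_card by (simp add: Suc_leI card_gt_0_iff)
qed

lemma X_diff_sq:
  "(\<Sum>x\<in>tensor_index p. (X A x - X A' x)\<^sup>2)
    = lam\<^sup>2 * (\<Sum>i<p k. \<Sum>j<r k. mult j * (A i j - A' i j)\<^sup>2)"
proof -
  have "(\<Sum>x\<in>tensor_index p. (X A x - X A' x)\<^sup>2)
      = (\<Sum>i<p k. \<Sum>a<p k'. \<Sum>b<p k''. lam\<^sup>2 * (\<Sum>j<r k. (A i j - A' i j) * of_bool ((j, a, b) \<in> T))\<^sup>2)"
    unfolding sum_tensor_index[OF k]
    by (intro sum.cong refl)
       (simp add: X_tri left_diff_distrib sum_subtractf flip: right_diff_distrib power_mult_distrib)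
  also have "\<dots> = lam\<^sup>2 * (\<Sum>i<p k. \<Sum>a<p k'. \<Sum>b<p k''. (\<Sum>j<r k. (A i j - A' i j) * of_bool ((j, a, b) \<in> T))\<^sup>2)"
    by (simp add: sum_distrib_left)
  also have "\<dots> = lam\<^sup>2 * (\<Sum>i<p k. \<Sum>j<r k. mult j * (A i j - A' i j)\<^sup>2)"
  proof -
    have "\<forall>i i' u v. (i, u, v) \<in> T \<longrightarrow> (i', u, v) \<in> T \<longrightarrow> i = i'" using T_excl(1) by blast
    then show ?thesis
      unfolding mult_def by (subst sum_exclusive_sq2) (simp_all add: mult.commute)
  qed
  finally show ?thesis .
qed

lemma X_sq: "(\<Sum>x\<in>tensor_index p. (X A x)\<^sup>2) = lam\<^sup>2 * (\<Sum>i<p k. \<Sum>j<r k. mult j * (A i j)\<^sup>2)"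
proof -
  have "(\<Sum>x\<in>tensor_index p. (X A x)\<^sup>2) = (\<Sum>x\<in>tensor_index p. (X A x - X (\<lambda>i j. 0) x)\<^sup>2)"
    by (intro sum.cong refl) (auto simp: spiked_tensor_def split: prod.splits)
  then show ?thesis unfolding X_diff_sq by simp
qed

lemma left_factorization:
  assumes lsm: "left_singular_mat (matricization p k (X (spiked (r k) eps W))) U" and n: "p k = r k + n"
  shows "U \<in> orthonormal_mats (p k) (r k)"
    and "contraction n (r k) K \<Longrightarrow> 0 \<le> eps \<Longrightarrow>
      \<bar>pairing n (r k) K (\<lambda>i j. proj U (r k + i) j) - eps * pairing n (r k) K W\<bar>
      \<le> eps ^ 3 * sqrt (\<Sum>i<n. \<Sum>j<r k. (W i j)\<^sup>2) * sqrt (gram_norm n (r k) W)"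
    (is "_ \<Longrightarrow> _ \<Longrightarrow> ?bound")
proof -
  let ?M = "matricization p k (X (spiked (r k) eps W))"
  define R where "R j c = lam * of_bool ((j, c div p k'', c mod p k'') \<in> T)" for j c
  \<comment> \<open>Orthogonal rows have an explicit right inverse: the transpose with each column
    divided by the squared row norm \<open>lam^2 * mult j\<close>.\<close>
  define S where "S c j = of_bool ((j, c div p k'', c mod p k'') \<in> T) / (lam * mult j)" for c j
  have M: "?M \<in> carrier_mat (p k) (p k' * p k'')" by (simp add: matricization_tri[OF k])
  have fac: "\<forall>a<p k. \<forall>c<p k' * p k''. ?M $$ (a, c) = (\<Sum>j<r k. spiked (r k) eps W a j * R j c)"
  proof (intro allI impI)
    fix a c assume ac: "a < p k" "c < p k' * p k''"
    then have "0 < p k''" by (cases "p k''") auto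
    then have "c div p k'' < p k'" "c mod p k'' < p k''"
      using ac by (auto intro: less_mult_imp_div_less)
    then show "?M $$ (a, c) = (\<Sum>j<r k. spiked (r k) eps W a j * R j c)"
      using ac by (simp add: matricization_tri[OF k] X_tri R_def sum_distrib_left mult.left_commute)
  qed
  have inv: "\<forall>j<r k. \<forall>j'<r k. (\<Sum>c<p k' * p k''. R j c * S c j') = (if j = j' then 1 else 0)"
  proof (intro allI impI)
    fix j j' assume j: "j < r k" "j' < r k"
    have "(\<Sum>c<p k' * p k''. R j c * S c j')
        = (\<Sum>a<p k'. \<Sum>b<p k''. lam * of_bool ((j, a, b) \<in> T) * (of_bool ((j', a, b) \<in> T) / (lam * mult j')))"
      unfolding R_def S_def
      by (rule sum_div_mod[of "\<lambda>a b. lam * of_bool ((j, a, b) \<in> T) * (of_bool ((j', a, b) \<in> T) / (lam * mult j'))"])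
    also have "\<dots> = (\<Sum>a<p k'. \<Sum>b<p k''. of_bool ((j, a, b) \<in> T) * (if j = j' then 1 / mult j' else 0))"
      using lam T_excl(1) by (intro sum.cong refl) auto
    also have "\<dots> = mult j * (if j = j' then 1 / mult j' else 0)"
      by (simp only: mult_def sum_distrib_right)
    also have "\<dots> = (if j = j' then 1 else 0)" using mult_ge_1[OF j(1)] by auto
    finally show "(\<Sum>c<p k' * p k''. R j c * S c j') = (if j = j' then 1 else 0)" .
  qed
  show "U \<in> orthonormal_mats (p k) (r k)"
    by (rule spiked_singular_subspace(1)[OF M lsm n fac inv])
  show ?bound if "contraction n (r k) K" "0 \<le> eps"
    by (rule spiked_pairing[OF M lsm n fac inv that])
qed

text \<open>A common interface for the three modes: a factorization bounds the rank, and the first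
  \<open>r m\<close> rows alone bound the singular value.\<close>

lemma mode_in_low_rank:
  assumes m: "m \<in> {1, 2, 3}"
    and entry: "\<And>i a b. i < p m \<Longrightarrow> a < p (nxt m) \<Longrightarrow> b < p (nxt (nxt m)) \<Longrightarrow> Y (tri m i a b) = lam * g i a b"
    and fac: "\<And>i a b. i < p m \<Longrightarrow> g i a b = (\<Sum>l<r m. f i l * h l a b)"
    and lower: "\<And>x. (\<Sum>i<r m. (x i)\<^sup>2) \<le> (\<Sum>a<p (nxt m). \<Sum>b<p (nxt (nxt m)). (\<Sum>i<r m. x i * g i a b)\<^sup>2)"
  shows "mat_rank (matricization p m Y) \<le> r m \<and> lam \<le> singular_value (r m) (matricization p m Y)"
proof
  let ?Q = "p (nxt (nxt m))" and ?P = "p (nxt m)"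
  have ent: "matricization p m Y $$ (i, c) = lam * g i (c div ?Q) (c mod ?Q)" if "i < p m" "c < ?P * ?Q" for i c
  proof -
    have "0 < ?Q" using that by (cases ?Q) auto
    then have "c div ?Q < ?P" "c mod ?Q < ?Q" using that by (auto intro: less_mult_imp_div_less)
    then show ?thesis using that entry by (simp add: matricization_tri[OF m])
  qed
  have M: "matricization p m Y \<in> carrier_mat (p m) (?P * ?Q)" by (simp add: matricization_tri[OF m])
  show "mat_rank (matricization p m Y) \<le> r m"
    by (rule mat_rank_le_factor[OF M, where f = f and g = "\<lambda>l c. lam * h l (c div ?Q) (c mod ?Q)"])
       (simp add: ent fac sum_distrib_left mult_ac)
  show "lam \<le> singular_value (r m) (matricization p m Y)"
  proof (rule singular_value_ge[OF M _ _ lam])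
    show "1 \<le> r m" "r m \<le> p m" using pr[OF m] by auto
    fix x :: "nat \<Rightarrow> real"
    have "(\<Sum>c<?P * ?Q. (\<Sum>i<r m. x i * matricization p m Y $$ (i, c))\<^sup>2)
        = (\<Sum>c<?P * ?Q. (\<Sum>i<r m. x i * (lam * g i (c div ?Q) (c mod ?Q)))\<^sup>2)"
      using pr[OF m] by (intro sum.cong refl arg_cong[where f = "\<lambda>x. x\<^sup>2"]) (auto simp: ent)
    also have "\<dots> = (\<Sum>a<?P. \<Sum>b<?Q. (\<Sum>i<r m. x i * (lam * g i a b))\<^sup>2)"
      by (rule sum_div_mod[of "\<lambda>a b. (\<Sum>i<r m. x i * (lam * g i a b))\<^sup>2"])
    also have "\<dots> = lam\<^sup>2 * (\<Sum>a<?P. \<Sum>b<?Q. (\<Sum>i<r m. x i * g i a b)\<^sup>2)"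
      by (simp add: mult.left_commute sum_distrib_left[symmetric] power_mult_distrib)
    finally show "lam\<^sup>2 * (\<Sum>i<r m. (x i)\<^sup>2) \<le> (\<Sum>c<?P * ?Q. (\<Sum>i<r m. x i * matricization p m Y $$ (i, c))\<^sup>2)"
      using lower[of x] by (simp add: mult_left_mono)
  qed
qed

text \<open>In mode \<open>k\<close> the first \<open>r k\<close> rows are core rows. In the other
  two modes the identity block of \<open>A\<close> already displays the core in the columns with
  mode-\<open>k\<close> index below \<open>r k\<close>, and the spiked columns can only lengthen the
  combinations of rows.\<close>

lemma X_in_low_rank_tensors: "X (spiked (r k) eps W) \<in> low_rank_tensors p r lam"
proof -
  define A where "A = spiked (r k) eps W"
  have A: "(\<Sum>j<r k. A i j * of_bool ((j, a, b) \<in> T)) = of_bool ((i, a, b) \<in> T)" if "i < r k" for i a b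
    using that by (simp add: A_def spiked_def if_distrib[of "\<lambda>x. x * _"] cong: if_cong)
  note t = tri_nxt[OF k]
  have k': "k' \<in> {1, 2, 3}" by (rule t(4))
  have k'': "k'' \<in> {1, 2, 3}" by (rule tri_nxt(4)[OF k'])
  have pad: "(\<Sum>l<d. of_bool (i = l) * h l) = h i" if "\<And>i. i \<ge> d \<Longrightarrow> h i = 0" for d i and h :: "nat \<Rightarrow> real"
    using that[of i] by (cases "i < d") (auto simp: of_bool_def if_distrib[of "\<lambda>x. x * _"] cong: if_cong)
  have 1: "mat_rank (matricization p k (X A)) \<le> r k \<and> lam \<le> singular_value (r k) (matricization p k (X A))"
  proof (rule mode_in_low_rank[OF k, where f = A and h = "\<lambda>l a b. of_bool ((l, a, b) \<in> T)"
      and g = "\<lambda>i a b. \<Sum>j<r k. A i j * of_bool ((j, a, b) \<in> T)"])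
    fix x :: "nat \<Rightarrow> real"
    have "sumsq (r k) x \<le> (\<Sum>a<p k'. \<Sum>b<p k''. (\<Sum>i<r k. x i * of_bool ((i, a, b) \<in> T))\<^sup>2)"
      by (rule sum_exclusive_sq2_ge) (use T_excl(1) T_cover(1) in blast)+
    then show "sumsq (r k) x
        \<le> (\<Sum>a<p k'. \<Sum>b<p k''. (\<Sum>i<r k. x i * (\<Sum>j<r k. A i j * of_bool ((j, a, b) \<in> T)))\<^sup>2)"
      by (simp add: A)
  qed (auto simp: X_tri)
  have 2: "mat_rank (matricization p k' (X A)) \<le> r k' \<and> lam \<le> singular_value (r k') (matricization p k' (X A))"
  proof (rule mode_in_low_rank[OF k', unfolded t(3), where f = "\<lambda>i l. of_bool (i = l)"
      and h = "\<lambda>l a b. \<Sum>j<r k. A b j * of_bool ((j, l, a) \<in> T)"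
      and g = "\<lambda>i a b. \<Sum>j<r k. A b j * of_bool ((j, i, a) \<in> T)"])
    show "X A (tri k' i a b) = lam * (\<Sum>j<r k. A b j * of_bool ((j, i, a) \<in> T))"
      if "i < p k'" "a < p k''" "b < p k" for i a b
      using that by (simp add: t(1) X_tri)
    show "(\<Sum>j<r k. A b j * of_bool ((j, i, a) \<in> T))
        = (\<Sum>l<r k'. of_bool (i = l) * (\<Sum>j<r k. A b j * of_bool ((j, l, a) \<in> T)))" for i a b
      by (rule pad[symmetric]) (use T_range in \<open>force intro: sum.neutral\<close>)
    fix x :: "nat \<Rightarrow> real"
    have "sumsq (r k') x \<le> (\<Sum>a<p k''. \<Sum>b<r k. (\<Sum>i<r k'. x i * of_bool ((b, i, a) \<in> T))\<^sup>2)"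
      by (rule sum_exclusive_sq2_ge) (use T_excl(2) T_cover(2) in blast)+
    also have "\<dots> = (\<Sum>a<p k''. \<Sum>b<r k. (\<Sum>i<r k'. x i * (\<Sum>j<r k. A b j * of_bool ((j, i, a) \<in> T)))\<^sup>2)"
      by (simp add: A)
    \<comment> \<open>Adding the columns that come from the spiked rows of \<open>A\<close> adds
      squares.\<close>
    also have "\<dots> \<le> (\<Sum>a<p k''. \<Sum>b<p k. (\<Sum>i<r k'. x i * (\<Sum>j<r k. A b j * of_bool ((j, i, a) \<in> T)))\<^sup>2)"
      using pr_modes by (intro sum_mono sum_mono2) auto
    finally show "sumsq (r k') x
        \<le> (\<Sum>a<p k''. \<Sum>b<p k. (\<Sum>i<r k'. x i * (\<Sum>j<r k. A b j * of_bool ((j, i, a) \<in> T)))\<^sup>2)" .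
  qed
  have 3: "mat_rank (matricization p k'' (X A)) \<le> r k'' \<and> lam \<le> singular_value (r k'') (matricization p k'' (X A))"
  proof (rule mode_in_low_rank[OF k'', unfolded t(3), where f = "\<lambda>i l. of_bool (i = l)"
      and h = "\<lambda>l a b. \<Sum>j<r k. A a j * of_bool ((j, b, l) \<in> T)"
      and g = "\<lambda>i a b. \<Sum>j<r k. A a j * of_bool ((j, b, i) \<in> T)"])
    show "X A (tri k'' i a b) = lam * (\<Sum>j<r k. A a j * of_bool ((j, b, i) \<in> T))"
      if "i < p k''" "a < p k" "b < p k'" for i a b
      using that by (simp add: t(2) X_tri)
    show "(\<Sum>j<r k. A a j * of_bool ((j, b, i) \<in> T))
        = (\<Sum>l<r k''. of_bool (i = l) * (\<Sum>j<r k. A a j * of_bool ((j, b, l) \<in> T)))" for i a b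
      by (rule pad[symmetric]) (use T_range in \<open>force intro: sum.neutral\<close>)
    fix x :: "nat \<Rightarrow> real"
    have "sumsq (r k'') x \<le> (\<Sum>a<r k. \<Sum>b<p k'. (\<Sum>i<r k''. x i * of_bool ((a, b, i) \<in> T))\<^sup>2)"
      by (rule sum_exclusive_sq2_ge) (use T_excl(3) T_cover(3) in blast)+
    also have "\<dots> = (\<Sum>a<r k. \<Sum>b<p k'. (\<Sum>i<r k''. x i * (\<Sum>j<r k. A a j * of_bool ((j, b, i) \<in> T)))\<^sup>2)"
      by (simp add: A)
    also have "\<dots> \<le> (\<Sum>a<p k. \<Sum>b<p k'. (\<Sum>i<r k''. x i * (\<Sum>j<r k. A a j * of_bool ((j, b, i) \<in> T)))\<^sup>2)"
      using pr_modes by (intro sum_mono2) (auto intro: sum_nonneg)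
    finally show "sumsq (r k'') x
        \<le> (\<Sum>a<p k. \<Sum>b<p k'. (\<Sum>i<r k''. x i * (\<Sum>j<r k. A a j * of_bool ((j, b, i) \<in> T)))\<^sup>2)" .
  qed
  show ?thesis
    unfolding low_rank_tensors_def t(5) A_def[symmetric] using X_in_space 1 2 3 by blast
qed

end

section \<open>Minimax bounds over the family\<close>

text \<open>Compares nonnegative integrals without measurability, so that the subspace loss can be
  replaced by a smaller measurable one.\<close>

lemma risk_mono:
  assumes "\<And>y. y \<in> space (tensor_space p) \<Longrightarrow> l y \<le> l' y"
  shows "risk p \<sigma> X l \<le> risk p \<sigma> X l'"
  unfolding risk_def
proof (intro nn_integral_mono ennreal_leI assms)
  fix Z :: tensor
  show "(\<lambda>x\<in>tensor_index p. X x + Z x) \<in> space (tensor_space p)"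
    by (simp add: tensor_space_def space_PiM)
qed

lemma frobenius_norm_sq: "(frobenius_norm p X)\<^sup>2 = (\<Sum>x\<in>tensor_index p. (X x)\<^sup>2)"
  by (simp add: frobenius_norm_def L2_set_def sum_nonneg)

text \<open>Stands in for the triangle inequality, which squared norms violate; the price is the
  factor \<open>1 / 2\<close>.\<close>

lemma frobenius_norm_sq_split:
  "(frobenius_norm p (\<lambda>x. X x - X' x))\<^sup>2 / 2
    \<le> (frobenius_norm p (\<lambda>x. Y x - X x))\<^sup>2 + (frobenius_norm p (\<lambda>x. Y x - X' x))\<^sup>2"
proof -
  have "(X x - X' x)\<^sup>2 / 2 \<le> (Y x - X x)\<^sup>2 + (Y x - X' x)\<^sup>2" for x
    using zero_le_power2[of "(Y x - X x) + (Y x - X' x)"] by (simp add: power2_eq_square field_simps)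
  then show ?thesis
    unfolding frobenius_norm_sq sum_divide_distrib sum.distrib[symmetric] by (rule sum_mono)
qed

abbreviation frob_loss :: "(nat \<Rightarrow> nat) \<Rightarrow> tensor \<Rightarrow> tensor \<Rightarrow> real" where
  "frob_loss p Y X \<equiv> (frobenius_norm p (\<lambda>x. Y x - X x))\<^sup>2"

locale spiked_problem = spiked_family +
  fixes n :: nat and \<sigma> \<mu> :: real
  assumes pk: "p k = r k + n" and n: "2 * r k \<le> n" and \<sigma>: "0 < \<sigma>"
    and \<mu>: "\<And>j. mult j \<le> \<mu>"
begin

definition B :: "(nat \<times> nat) set" where "B = {..<n} \<times> {..<r k}"

definition XW :: "real \<Rightarrow> (nat \<times> nat) set \<Rightarrow> tensor" where
  "XW eps w = X (spiked (r k) eps (signs w))"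

lemma B_finite: "finite B" and card_B: "card B = n * r k"
  by (auto simp: B_def card_cartesian_product)

lemma n_pos: "0 < n" and \<mu>_pos: "1 \<le> \<mu>"
proof -
  show "0 < n" using n pr_modes by simp
  show "1 \<le> \<mu>" using mult_ge_1[of 0] \<mu>[of 0] pr_modes by simp
qed

lemma XW_low_rank: "XW eps w \<in> low_rank_tensors p r lam"
  unfolding XW_def by (rule X_in_low_rank_tensors)

lemma XW_diff_sq:
  "sq_dist p (XW eps w) (XW eps w')
    = lam\<^sup>2 * eps\<^sup>2 * (\<Sum>i<n. \<Sum>j<r k. mult j * (signs w i j - signs w' i j)\<^sup>2)"
proof -
  have "(\<Sum>i<p k. \<Sum>j<r k. mult j * (spiked (r k) eps (signs w) i j - spiked (r k) eps (signs w') i j)\<^sup>2)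
      = (\<Sum>i<n. \<Sum>j<r k. mult j * (eps * (signs w i j - signs w' i j))\<^sup>2)"
    unfolding pk sum_split_add by (simp add: spiked_def right_diff_distrib)
  also have "\<dots> = eps\<^sup>2 * (\<Sum>i<n. \<Sum>j<r k. mult j * (signs w i j - signs w' i j)\<^sup>2)"
    by (simp add: power_mult_distrib sum_distrib_left mult_ac)
  finally show ?thesis unfolding XW_def X_diff_sq by simp
qed

lemma XW_diff_sq_ge:
  "lam\<^sup>2 * eps\<^sup>2 * (4 * hamming B w w')
    \<le> sq_dist p (XW eps w) (XW eps w')"
  unfolding XW_diff_sq B_def signs_diff_sq[symmetric]
proof (intro mult_left_mono sum_mono)
  fix i j assume "j \<in> {..<r k}"
  then show "(signs w i j - signs w' i j)\<^sup>2 \<le> mult j * (signs w i j - signs w' i j)\<^sup>2"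
    using mult_right_mono[OF mult_ge_1, of j "(signs w i j - signs w' i j)\<^sup>2"] by simp
qed simp

text \<open>One flip changes one sign by \<open>2\<close>, so the tensor moves by at most
  \<open>4 * lam^2 * eps^2 * \<mu>\<close> in squared norm. The form
  \<open>8 * \<sigma>^2 * (\<mu> / 2)\<close> matches the exponent of the Gaussian affinity.\<close>

lemma XW_flip:
  assumes "0 \<le> eps" "lam * eps \<le> \<sigma>" "b \<in> B" "w \<in> Pow (B - {b})"
  shows "sq_dist p (XW eps w) (XW eps (insert b w)) \<le> 8 * \<sigma>\<^sup>2 * (\<mu> / 2)"
proof -
  have "sq_dist p (XW eps w) (XW eps (insert b w))
      \<le> lam\<^sup>2 * eps\<^sup>2 * (\<Sum>i<n. \<Sum>j<r k. \<mu> * (signs w i j - signs (insert b w) i j)\<^sup>2)"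
    unfolding XW_diff_sq by (intro mult_left_mono sum_mono mult_right_mono \<mu>) auto
  also have "(\<Sum>i<n. \<Sum>j<r k. \<mu> * (signs w i j - signs (insert b w) i j)\<^sup>2)
      = \<mu> * (4 * hamming B w (insert b w))"
    unfolding B_def signs_diff_sq[symmetric] by (simp add: sum_distrib_left)
  also have "(\<Sum>b'\<in>B. of_bool ((b' \<in> w) \<noteq> (b' \<in> insert b w)) :: real) = (\<Sum>b'\<in>B. if b' = b then 1 else 0)"
    using assms(4) by (intro sum.cong refl) auto
  also have "\<dots> = 1" using assms(3) B_finite by simp
  also have "lam\<^sup>2 * eps\<^sup>2 * (\<mu> * (4 * 1)) \<le> \<sigma>\<^sup>2 * (\<mu> * (4 * 1))"
    using power_mono[OF assms(2), of 2] assms(1) lam \<mu>_pos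
    by (intro mult_right_mono) (auto simp: power_mult_distrib)
  finally show ?thesis by (simp add: mult_ac)
qed

section \<open>Both Frobenius losses\<close>

lemma frobenius_loss_measurable:
  assumes X': "X' \<in> tensor_estimators p"
  shows "(\<lambda>y. frob_loss p (X' y) Y) \<in> borel_measurable (tensor_space p)"
proof -
  have [measurable]: "(\<lambda>y. X' y x) \<in> borel_measurable (tensor_space p)" if "x \<in> tensor_index p" for x
    using X' measurable_compose[OF _ measurable_tensor_component[OF that]] by (simp add: tensor_estimators_def)
  show ?thesis unfolding frobenius_norm_sq by measurable
qed

lemma exp_half_sq: "(exp (- (\<mu> / 2)))\<^sup>2 = exp (- \<mu>)"
  by (simp flip: exp_double)

text \<open>The weight \<open>v w\<close> is \<open>1\<close> for the absolute loss and the inverse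
  squared norm of the hypothesis for the relative one; a uniform lower bound \<open>\<kappa>\<close>
  on it rescales the whole estimate.\<close>

lemma weighted_frobenius_minimax:
  assumes X': "X' \<in> tensor_estimators p" and eps: "0 \<le> eps" "lam * eps \<le> \<sigma>"
    and v: "\<And>w. \<kappa> \<le> v w" "0 \<le> \<kappa>"
    and R: "\<And>w. risk p \<sigma> (XW eps w) (\<lambda>y. v w * frob_loss p (X' y) (XW eps w)) \<le> R"
  shows "ennreal (\<kappa> * (lam\<^sup>2 * eps\<^sup>2 * (n * r k) * exp (- \<mu>) / 2)) \<le> R"
proof -
  let ?f = "\<lambda>y w. frob_loss p (X' y) (XW eps w)"
  have "ennreal (2 * lam\<^sup>2 * eps\<^sup>2 * \<kappa> * card B * (exp (- (\<mu> / 2)))\<^sup>2 / 4 - 0) \<le> R"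
  proof (rule bayes_lower_bound[OF B_finite \<sigma>, where X = "XW eps" and q = "\<lambda>_. 0"
        and l = "\<lambda>w y. v w * ?f y w"])
    fix w w' y
    have "2 * lam\<^sup>2 * eps\<^sup>2 * \<kappa> * hamming B w w' = \<kappa> * (lam\<^sup>2 * eps\<^sup>2 * (4 * hamming B w w') / 2)" by simp
    also have "\<dots> \<le> \<kappa> * (?f y w + ?f y w')"
    proof (rule mult_left_mono[OF _ v(2)])
      show "lam\<^sup>2 * eps\<^sup>2 * (4 * hamming B w w') / 2 \<le> ?f y w + ?f y w'"
        using frobenius_norm_sq_split[of p "XW eps w" "XW eps w'" "X' y"] XW_diff_sq_ge[of eps w w']
        unfolding frobenius_norm_sq by linarith
    qed
    also have "\<dots> \<le> v w * ?f y w + v w' * ?f y w'"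
      unfolding distrib_left by (intro add_mono mult_right_mono v) auto
    finally show "2 * lam\<^sup>2 * eps\<^sup>2 * \<kappa> * hamming B w w' - 0 - 0
        \<le> v w * ?f y w + v w' * ?f y w'" by simp
    show "0 \<le> v w * ?f y w" using order_trans[OF v(2) v(1)] by simp
    show "sq_dist p (XW eps w) (XW eps (insert b w)) \<le> 8 * \<sigma>\<^sup>2 * (\<mu> / 2)"
      if "b \<in> B" "w \<in> Pow (B - {b})" for w b
      by (rule XW_flip[OF eps that])
  qed (use v(2) in \<open>auto intro: borel_measurable_times frobenius_loss_measurable[OF X'] R\<close>)
  then show ?thesis unfolding exp_half_sq card_B by (simp add: mult_ac)
qed

lemma frobenius_minimax:
  assumes X': "X' \<in> tensor_estimators p"
  shows "ennreal (\<sigma>\<^sup>2 * n * r k * exp (- \<mu>) / 2)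
    \<le> (SUP Y\<in>low_rank_tensors p r lam. risk p \<sigma> Y (\<lambda>y. frob_loss p (X' y) Y))"
proof -
  \<comment> \<open>The distance formula is exact for every \<open>eps\<close>, so the absolute loss
    permits the largest value that the flip condition allows, however large
    \<open>eps * sqrt n\<close> becomes.\<close>
  have eps: "0 \<le> \<sigma> / lam" "lam * (\<sigma> / lam) \<le> \<sigma>" using \<sigma> lam by auto
  have "ennreal (1 * (lam\<^sup>2 * (\<sigma> / lam)\<^sup>2 * (n * r k) * exp (- \<mu>) / 2))
      \<le> (SUP Y\<in>low_rank_tensors p r lam. risk p \<sigma> Y (\<lambda>y. frob_loss p (X' y) Y))"
    by (rule weighted_frobenius_minimax[OF X' eps, where v = "\<lambda>_. 1"])
       (auto intro: SUP_upper[OF XW_low_rank])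
  then show ?thesis using lam by (simp add: power_divide mult_ac)
qed

text \<open>The squared norm is \<open>lam^2 * (1 + eps^2 * n)\<close> times the number of core
  cells; the assumption stops the signs from dominating it, which is why the relative bound
  saturates at a constant.\<close>

lemma XW_norm_sq:
  fixes eps :: real
  assumes "eps\<^sup>2 * n \<le> 1"
  shows "0 < (frobenius_norm p (XW eps w))\<^sup>2" "(frobenius_norm p (XW eps w))\<^sup>2 \<le> 2 * lam\<^sup>2 * \<mu> * r k"
proof -
  have fn: "(frobenius_norm p (XW eps w))\<^sup>2 = lam\<^sup>2 * (\<Sum>i<r k + n. \<Sum>j<r k. mult j * (spiked (r k) eps (signs w) i j)\<^sup>2)"
    unfolding frobenius_norm_sq XW_def X_sq pk ..
  have top: "(\<Sum>j<r k. mult j * (spiked (r k) eps (signs w) i j)\<^sup>2) = mult i" if "i < r k" for i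
    using that by (simp add: spiked_def if_distrib[of "\<lambda>x. x\<^sup>2"] if_distrib[of "(*) _"] cong: if_cong)
  have bot: "(\<Sum>j<r k. mult j * (spiked (r k) eps (signs w) (r k + i) j)\<^sup>2) = eps\<^sup>2 * (\<Sum>j<r k. mult j)" for i
    by (simp add: spiked_def signs_def if_distrib[of "\<lambda>x. (eps * x)\<^sup>2"] sum_distrib_left mult.commute cong: if_cong)
  have fn': "(frobenius_norm p (XW eps w))\<^sup>2 = lam\<^sup>2 * ((1 + eps\<^sup>2 * n) * (\<Sum>j<r k. mult j))"
    unfolding fn sum_split_add by (simp add: top bot) (simp add: algebra_simps)
  have "(\<Sum>j<r k. 1) \<le> (\<Sum>j<r k. mult j)" by (intro sum_mono) (simp add: mult_ge_1)
  then have m: "real (r k) \<le> (\<Sum>j<r k. mult j)" by simp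
  have "0 < real (r k)" using pr_modes by simp
  with m have "0 < (\<Sum>j<r k. mult j)" by linarith
  moreover have "0 < 1 + eps\<^sup>2 * n" by (simp add: add_pos_nonneg)
  ultimately show "0 < (frobenius_norm p (XW eps w))\<^sup>2" unfolding fn' using lam by simp
  have "(\<Sum>j<r k. mult j) \<le> (\<Sum>j<r k. \<mu>)" by (intro sum_mono \<mu>)
  then have "(1 + eps\<^sup>2 * n) * (\<Sum>j<r k. mult j) \<le> 2 * (\<mu> * r k)"
    using assms \<open>0 < (\<Sum>j<r k. mult j)\<close> by (intro mult_mono) (auto simp: mult.commute)
  then have "lam\<^sup>2 * ((1 + eps\<^sup>2 * n) * (\<Sum>j<r k. mult j)) \<le> lam\<^sup>2 * (2 * (\<mu> * r k))"
    by (rule mult_left_mono) simp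
  then show "(frobenius_norm p (XW eps w))\<^sup>2 \<le> 2 * lam\<^sup>2 * \<mu> * r k"
    unfolding fn' by (simp add: mult_ac)
qed

lemma relative_frobenius_minimax:
  assumes X': "X' \<in> tensor_estimators p"
  shows "ennreal (min (n * \<sigma>\<^sup>2 / lam\<^sup>2) 1 * exp (- \<mu>) / (4 * \<mu>))
    \<le> (SUP Y\<in>low_rank_tensors p r lam. risk p \<sigma> Y
        (\<lambda>y. frob_loss p (X' y) Y / (frobenius_norm p Y)\<^sup>2))"
    (is "_ \<le> ?R")
proof -
  \<comment> \<open>The first bound keeps neighbouring hypotheses statistically close, the second
    keeps the norm of order \<open>lam * sqrt (r k)\<close>.\<close>
  define eps where "eps = min (\<sigma> / lam) (1 / sqrt n)"
  have eps: "0 \<le> eps" "lam * eps \<le> \<sigma>"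
    using \<sigma> lam by (auto simp: eps_def min_def field_simps)
  have eps2: "eps\<^sup>2 * n = min (n * \<sigma>\<^sup>2 / lam\<^sup>2) 1"
  proof -
    have "eps\<^sup>2 = min ((\<sigma> / lam)\<^sup>2) ((1 / sqrt n)\<^sup>2)"
      using \<sigma> lam by (auto simp: eps_def min_def power_mono)
    then show ?thesis using n_pos by (simp add: min_mult_distrib_right min_mult_distrib_left power_divide mult.commute)
  qed
  have "0 < 2 * lam\<^sup>2 * \<mu> * r k" using lam \<mu>_pos pr_modes by simp
  moreover have "eps\<^sup>2 * n \<le> 1" using eps2 by simp
  ultimately have v: "1 / (2 * lam\<^sup>2 * \<mu> * r k) \<le> 1 / (frobenius_norm p (XW eps w))\<^sup>2" "0 \<le> 1 / (2 * lam\<^sup>2 * \<mu> * r k)" for w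
    using XW_norm_sq[of eps w] by (auto intro!: divide_left_mono)
  have "ennreal (1 / (2 * lam\<^sup>2 * \<mu> * r k) * (lam\<^sup>2 * eps\<^sup>2 * (n * r k) * exp (- \<mu>) / 2)) \<le> ?R"
    by (rule weighted_frobenius_minimax[OF X' eps v]) (auto intro: SUP_upper2[OF XW_low_rank])
  moreover have "1 / (2 * lam\<^sup>2 * \<mu> * r k) * (lam\<^sup>2 * eps\<^sup>2 * (n * r k) * exp (- \<mu>) / 2)
      = (eps\<^sup>2 * n) * exp (- \<mu>) / (4 * \<mu>)"
    using lam \<mu>_pos pr_modes by (simp add: field_simps)
  ultimately show ?thesis unfolding eps2 by (simp add: mult.commute)
qed

text \<open>With \<open>\<delta> = eps * sqrt n\<close>, the signal is
  \<open>\<delta> * a^2 / (2 * \<T>)\<close>. The certificate loses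
  \<open>\<delta> * 3 / (2 * \<T>^3)\<close> and the linearization at most
  \<open>\<delta> * 5 / 8 * \<kappa>^2\<close>; the conditions on \<open>\<T>\<close> and
  \<open>\<kappa>\<close> make each of these a quarter of the signal, so half of it remains.\<close>

lemma sin_theta_minimax:
  assumes U': "U' \<in> subspace_estimators p (p k) (r k)" and "1 \<le> q"
    and U: "\<And>Y. Y \<in> low_rank_tensors p r lam \<Longrightarrow> left_singular_mat (matricization p k Y) (U Y)"
    and a: "a = exp (- (\<mu> / 2))" and \<T>: "0 < \<T>" "\<T>\<^sup>2 = 12 / a\<^sup>2" and \<kappa>: "0 < \<kappa>" "\<kappa>\<^sup>2 = a\<^sup>2 / (5 * \<T>)"
  shows "ennreal (min (sqrt n * \<sigma> / lam) \<kappa> * a\<^sup>2 / (4 * \<T>))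
    \<le> (SUP Y\<in>low_rank_tensors p r lam. risk p \<sigma> Y
        (\<lambda>y. real (r k) powr (- real_of_ereal (1 / q)) * sin_theta_norm q (U' y) (U Y)))"
    (is "_ \<le> ?R")
proof -
  define d where "d = r k"
  have d: "0 < d" "2 * d \<le> n" "p k = d + n" "card B = n * d" using pr_modes n pk card_B by (auto simp: d_def)
  note n0 = n_pos
  have a0: "0 < a" by (simp add: a)
  \<comment> \<open>The first bound serves the affinities, the second makes the cubic remainder of
    the linearization small against the linear term.\<close>
  define eps where "eps = min (\<sigma> / lam) (\<kappa> / sqrt n)"
  have eps: "0 \<le> eps" "lam * eps \<le> \<sigma>"
    using \<sigma> lam \<kappa> by (auto simp: eps_def min_def field_simps)
  have eps_n: "eps * sqrt n = min (sqrt n * \<sigma> / lam) \<kappa>"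
    using n0 by (simp add: eps_def min_mult_distrib_right) (simp add: mult.commute)
  define t where "t = \<T> * sqrt n"
  have t: "0 < t" using \<T> n0 by (simp add: t_def)
  define Pw where "Pw w = proj (U (XW eps w))" for w
  define P' where "P' y a b = (\<Sum>l<d. U' y $$ (a, l) * U' y $$ (b, l))" for y a b
  define gn where "gn w = gram_norm n d (signs w)" for w
  have gn0: "0 \<le> gn w" for w by (simp add: gn_def gram_norm_def sum_nonneg)
  define \<Phi> where "\<Phi> w w' K \<longleftrightarrow> contraction n d K \<and> (\<Sum>i<n. \<Sum>j<d. (signs w i j - signs w' i j)\<^sup>2) / t
      - gram_norm n d (\<lambda>i j. signs w i j - signs w' i j) / (4 * t ^ 3)
      \<le> pairing n d K (\<lambda>i j. signs w i j - signs w' i j)" for w w' K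
  have "\<exists>K. \<Phi> w w' K" for w w'
    unfolding \<Phi>_def gram_norm_def
    by (rule contraction_certificate[OF t, of n d "\<lambda>i j. signs w i j - signs w' i j"]) blast
  then obtain K where "\<Phi> w w' (K w w')" for w w' by metis
  then have K: "\<And>w w'. contraction n d (K w w')"
    and K_ge: "\<And>w w'. (\<Sum>i<n. \<Sum>j<d. (signs w i j - signs w' i j)\<^sup>2) / t
      - gram_norm n d (\<lambda>i j. signs w i j - signs w' i j) / (4 * t ^ 3)
      \<le> pairing n d (K w w') (\<lambda>i j. signs w i j - signs w' i j)"
    unfolding \<Phi>_def by blast+
  \<comment> \<open>The certificate \<open>K v v'\<close> depends on a pair of hypotheses, while a
    loss may depend on one only; hence \<open>l\<close> maximizes over all certificates. As a finite
    maximum it is measurable in \<open>y\<close>, and it lies below the subspace loss.\<close>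
  define h where "h v v' w y = \<bar>\<Sum>i<n. \<Sum>j<d. K v v' i j * (P' y (d + i) j - Pw w (d + i) j)\<bar> / (2 * d)" for v v' w y
  define l where "l w y = Max ((\<lambda>(v, v'). h v v' w y) ` (Pow B \<times> Pow B))" for w y
  have fin: "finite (Pow B \<times> Pow B)" using B_finite by simp
  have h_le_l: "h v v' w y \<le> l w y" if "v \<in> Pow B" "v' \<in> Pow B" for v v' w y
    unfolding l_def by (rule Max_ge) (use fin that in \<open>auto intro: image_eqI[of _ _ "(v, v')"]\<close>)
  have lsm: "left_singular_mat (matricization p k (X (spiked (r k) eps (signs w)))) (U (XW eps w))" for w
    using U[OF XW_low_rank] by (simp add: XW_def)
  note fac = left_factorization[OF lsm pk, folded d_def]
  have l_le: "l w y \<le> real (r k) powr (- real_of_ereal (1 / q)) * sin_theta_norm q (U' y) (U (XW eps w))"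
    if y: "y \<in> space (tensor_space p)" for w y
  proof -
    have V: "U' y \<in> orthonormal_mats (p k) d" using U' y by (simp add: subspace_estimators_def d_def)
    let ?S = "\<Sum>x\<in>#cos_sq (U' y) (U (XW eps w)). sqrt (1 - x)"
    have "h v v' w y \<le> ?S / d" for v v'
    proof -
      have "\<bar>\<Sum>a<p k. \<Sum>b<p k. (if d \<le> a \<and> b < d then K v v' (a - d) b else 0) * (proj (U' y) a b - proj (U (XW eps w)) a b)\<bar> \<le> 2 * ?S"
        by (rule projection_distance_bound[OF V fac(1) contraction_pad[OF K d(3)]])
      also have "(\<Sum>a<p k. \<Sum>b<p k. (if d \<le> a \<and> b < d then K v v' (a - d) b else 0) * (proj (U' y) a b - proj (U (XW eps w)) a b))
          = (\<Sum>a<p k. \<Sum>b<p k. if d \<le> a \<and> b < d then K v v' (a - d) b * (P' y (d + (a - d)) b - Pw w (d + (a - d)) b) else 0)"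
        using orthonormal_matsD(2)[OF V] by (intro sum.cong refl) (auto simp: P'_def Pw_def proj_def)
      also have "\<dots> = pairing n d (K v v') (\<lambda>i j. P' y (d + i) j - Pw w (d + i) j)"
        by (rule sum_rectangle_pad[OF d(3)])
      finally show ?thesis unfolding h_def using d(1) by (simp add: field_simps)
    qed
    then have "l w y \<le> ?S / d"
      unfolding l_def using fin by (subst Max_le_iff) auto
    also have "\<dots> \<le> real d powr (- real_of_ereal (1 / q)) * sin_theta_norm q (U' y) (U (XW eps w))"
      by (rule sin_theta_norm_ge_mean[OF V fac(1) _ \<open>1 \<le> q\<close>]) (use d in simp)
    finally show ?thesis by (simp add: d_def)
  qed
  define \<beta> where "\<beta> = 2 * eps / (d * t)"
  define rem where "rem w = eps ^ 3 * sqrt n * (n * d + gn w / n) / 2" for w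
  \<comment> \<open>Two sources of error, the fourth moment in the certificate and the
    linearization, divided by the factor \<open>2 * d\<close> between pairings and mean sines.
    \<open>Q\<close> results from replacing \<open>gn\<close> by the bound
    \<open>3 / 2 * n^2 * d\<close> on its mean, which uses \<open>2 * d \<le> n\<close>.\<close>
  define err where "err w = (2 * eps * gn w / t ^ 3 + rem w) / (2 * d)" for w
  define Q where "Q = (3 * eps * n\<^sup>2 * d / t ^ 3 + eps ^ 3 * sqrt n * (5 / 2 * n * d) / 2) / (2 * d)"
  have "ennreal (\<beta> * card B * (exp (- (\<mu> / 2)))\<^sup>2 / 4 - Q) \<le> ?R"
  proof (rule bayes_lower_bound[OF B_finite \<sigma>, where X = "XW eps" and q = err and l = l])
    show "0 \<le> \<beta>" using eps t by (simp add: \<beta>_def)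
    show "l w \<in> borel_measurable (tensor_space p)" for w
    proof -
      have [measurable]: "(\<lambda>y. P' y i j) \<in> borel_measurable (tensor_space p)" if "i < p k" "j < p k" for i j
        unfolding P'_def using U' that
        by (intro borel_measurable_sum borel_measurable_times) (auto simp: subspace_estimators_def d_def)
      have "h v v' w \<in> borel_measurable (tensor_space p)" for v v'
        unfolding h_def using d
        by (intro borel_measurable_divide borel_measurable_abs borel_measurable_sum borel_measurable_times
            borel_measurable_diff borel_measurable_const) auto
      then show ?thesis
        unfolding l_def using fin by (intro borel_measurable_Max) auto
    qed
    show "0 \<le> l w y" for w y
      using h_le_l[of "{}" "{}" w y] by (rule order_trans[rotated]) (auto simp: h_def)
    show "sq_dist p (XW eps w) (XW eps (insert b w)) \<le> 8 * \<sigma>\<^sup>2 * (\<mu> / 2)"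
      if "b \<in> B" "w \<in> Pow (B - {b})" for w b
      by (rule XW_flip[OF eps that])
    show "risk p \<sigma> (XW eps w) (l w) \<le> ?R" for w
    proof -
      have "risk p \<sigma> (XW eps w) (l w) \<le> risk p \<sigma> (XW eps w)
          (\<lambda>y. real (r k) powr (- real_of_ereal (1 / q)) * sin_theta_norm q (U' y) (U (XW eps w)))"
        by (rule risk_mono) (rule l_le)
      also have "\<dots> \<le> ?R" by (rule SUP_upper[OF XW_low_rank])
      finally show ?thesis .
    qed
    show "(\<Sum>w\<in>Pow B. err w) \<le> 2 ^ card B * Q"
    proof -
      have g: "(\<Sum>w\<in>Pow B. gn w) \<le> 2 ^ card B * (3 / 2 * n\<^sup>2 * d)"
      proof -
        have "(\<Sum>w\<in>Pow B. gn w) \<le> 2 ^ card B * ((real n)\<^sup>2 * d + n * (real d)\<^sup>2)"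
          unfolding gn_def B_def d_def by (rule gram_norm_signs_mean)
        also have "(real n)\<^sup>2 * d + n * (real d)\<^sup>2 \<le> 3 / 2 * n\<^sup>2 * d"
        proof -
          have "real n * (real d * real d) \<le> real n * (real n / 2 * real d)"
            using d(2) by (intro mult_left_mono mult_right_mono) auto
          then show ?thesis by (simp add: power2_eq_square mult_ac)
        qed
        finally show ?thesis by simp
      qed
      have "(\<Sum>w\<in>Pow B. err w) = (2 * eps * (\<Sum>w\<in>Pow B. gn w) / t ^ 3
          + eps ^ 3 * sqrt n * (2 ^ card B * (n * d) + (\<Sum>w\<in>Pow B. gn w) / n) / 2) / (2 * d)"
        using B_finite
        by (simp add: err_def rem_def sum.distrib card_Pow flip: sum_divide_distrib sum_distrib_left)
      also have "\<dots> \<le> (2 * eps * (2 ^ card B * (3 / 2 * n\<^sup>2 * d)) / t ^ 3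
          + eps ^ 3 * sqrt n * (2 ^ card B * (n * d) + (2 ^ card B * (3 / 2 * n\<^sup>2 * d)) / n) / 2) / (2 * d)"
        using eps t by (intro divide_right_mono add_mono mult_left_mono g order_refl) auto
      also have "\<dots> = 2 ^ card B * Q"
        using n0 d(1) t by (simp add: Q_def field_simps power2_eq_square)
      finally show ?thesis .
    qed
  next
    fix w w' y
    assume w: "w \<in> Pow B" "w' \<in> Pow B"
    let ?K = "K w w'"
    define D where "D = pairing n d ?K (\<lambda>i j. signs w i j - signs w' i j)"
    define E where "E w = pairing n d ?K (\<lambda>i j. Pw w (d + i) j) - eps * pairing n d ?K (\<lambda>i j. signs w i j)" for w
    have E: "\<bar>E w\<bar> \<le> rem w" for w
    proof -
      have "\<bar>E w\<bar> \<le> eps ^ 3 * sqrt (\<Sum>i<n. \<Sum>j<d. (signs w i j)\<^sup>2) * sqrt (gram_norm n d (signs w))"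
        unfolding E_def Pw_def by (rule fac(2)[OF K eps(1)])
      also have "\<dots> = eps ^ 3 * (sqrt n * sqrt (d * gn w))"
        by (simp add: signs_sq gn_def real_sqrt_mult)
      \<comment> \<open>Only the mean of \<open>gn\<close> is controlled, so the root is made linear
        in \<open>gn\<close>, balanced such that both terms are of order \<open>n * d\<close> on
        average.\<close>
      also have "sqrt (d * gn w) \<le> (n * d + gn w / n) / 2"
      proof -
        have "sqrt ((n * d) * (gn w / n)) \<le> (n * d + gn w / n) / 2"
          using gn0 by (intro arith_geo_mean_sqrt) auto
        then show ?thesis using n0 by simp
      qed
      finally show ?thesis using eps(1) by (simp add: rem_def mult_left_mono)
    qed
    \<comment> \<open>The estimate \<open>P'\<close> cancels, leaving the difference of the signs up
      to linearization errors.\<close>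
    have diff: "pairing n d ?K (\<lambda>i j. P' y (d + i) j - Pw w' (d + i) j) - pairing n d ?K (\<lambda>i j. P' y (d + i) j - Pw w (d + i) j)
        = eps * D + E w - E w'"
      by (simp add: D_def E_def right_diff_distrib sum_subtractf)
    have lw: "\<bar>\<Sum>i<n. \<Sum>j<d. ?K i j * (P' y (d + i) j - Pw v (d + i) j)\<bar> \<le> 2 * d * l v y" for v
      using h_le_l[OF w, of v y] d(1) by (simp add: h_def field_simps)
    have "eps * D \<le> 2 * d * (l w y + l w' y) + \<bar>E w\<bar> + \<bar>E w'\<bar>"
      using diff lw[of w] lw[of w'] by (simp add: distrib_left)
    moreover have "4 * hamming B w w' / t - 2 * (gn w + gn w') / t ^ 3 \<le> D"
    proof -
      have "gram_norm n d (\<lambda>i j. signs w i j - signs w' i j) / (4 * t ^ 3) \<le> 8 * (gn w + gn w') / (4 * t ^ 3)"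
        unfolding gn_def using t by (intro divide_right_mono gram_norm_diff) auto
      also have "\<dots> = 2 * (gn w + gn w') / t ^ 3" using t by (simp add: field_simps)
      finally show ?thesis
        using K_ge[of w w'] unfolding D_def signs_diff_sq B_def[folded d_def, symmetric] by linarith
    qed
    ultimately have "eps * (4 * hamming B w w' / t - 2 * (gn w + gn w') / t ^ 3)
        \<le> 2 * d * (l w y + l w' y) + \<bar>E w\<bar> + \<bar>E w'\<bar>"
      using mult_left_mono[OF _ eps(1)] by (meson order_trans)
    moreover have expand: "2 * d * (\<beta> * S - err w - err w')
        = eps * (4 * S / t - 2 * (gn w + gn w') / t ^ 3) - rem w - rem w'" for S
      using d(1) t unfolding \<beta>_def err_def by (simp add: field_simps)
    ultimately have "2 * d * (\<beta> * hamming B w w' - err w - err w') \<le> 2 * d * (l w y + l w' y)"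
      using E[of w] E[of w'] expand[of "hamming B w w'"] by linarith
    then show "\<beta> * hamming B w w' - err w - err w' \<le> l w y + l w' y" using d(1) by simp
  qed
  moreover have "min (sqrt n * \<sigma> / lam) \<kappa> * a\<^sup>2 / (4 * \<T>) \<le> \<beta> * card B * (exp (- (\<mu> / 2)))\<^sup>2 / 4 - Q"
  proof -
    define s where "s = sqrt n"
    have s: "0 < s" "real n = s * s" using n0 by (auto simp: s_def)
    define \<delta> where "\<delta> = eps * s"
    have "\<delta> \<le> \<kappa>" unfolding \<delta>_def s_def eps_n by simp
    moreover have "0 \<le> \<delta>" using eps(1) s(1) by (simp add: \<delta>_def)
    ultimately have \<delta>: "0 \<le> \<delta>" "\<delta> \<le> \<kappa>" by auto
    have 1: "\<beta> * card B * (exp (- (\<mu> / 2)))\<^sup>2 / 4 = \<delta> * a\<^sup>2 / (2 * \<T>)"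
      unfolding \<beta>_def d(4) t_def a[symmetric] s_def[symmetric] \<delta>_def using s d(1) \<T>(1) by (simp add: field_simps)
    have 2: "Q = \<delta> * (3 / 2 / \<T> ^ 3 + 5 / 8 * \<delta>\<^sup>2)"
      unfolding Q_def t_def s_def[symmetric] \<delta>_def using s d(1) \<T>(1)
      by (simp add: field_simps power2_eq_square power3_eq_cube)
    have 3: "3 / 2 / \<T> ^ 3 = a\<^sup>2 / (8 * \<T>)"
    proof -
      have "\<T> ^ 3 = \<T> * (12 / a\<^sup>2)" using \<T>(2) by (simp add: power3_eq_cube power2_eq_square)
      then show ?thesis using \<T>(1) a0 by (simp add: field_simps)
    qed
    have "\<delta>\<^sup>2 \<le> a\<^sup>2 / (5 * \<T>)" using power_mono[OF \<delta>(2,1), of 2] \<kappa>(2) by simp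
    then have "3 / 2 / \<T> ^ 3 + 5 / 8 * \<delta>\<^sup>2 \<le> a\<^sup>2 / (8 * \<T>) + 5 / 8 * (a\<^sup>2 / (5 * \<T>))"
      unfolding 3 by simp
    also have "\<dots> = a\<^sup>2 / (4 * \<T>)" using \<T>(1) by (simp add: field_simps)
    finally have "Q \<le> \<delta> * (a\<^sup>2 / (4 * \<T>))" unfolding 2 using \<delta>(1) by (rule mult_left_mono)
    moreover have "\<delta> * a\<^sup>2 / (2 * \<T>) = \<delta> * (a\<^sup>2 / (4 * \<T>)) + \<delta> * a\<^sup>2 / (4 * \<T>)"
      using \<T>(1) by (simp add: field_simps)
    ultimately have "\<delta> * a\<^sup>2 / (4 * \<T>) \<le> \<beta> * card B * (exp (- (\<mu> / 2)))\<^sup>2 / 4 - Q" unfolding 1 by simp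
    then show ?thesis by (simp add: eps_n[symmetric] \<delta>_def s_def)
  qed
  ultimately show ?thesis by (meson ennreal_leI order_trans)
qed

end

section \<open>The minimax lower bounds\<close>

text \<open>Comparability of the ranks makes the row weight of the core at most
  \<open>C0 + 1\<close>, the \<open>1\<close> coming from rounding, and
  \<open>r k \<le> p k / 3\<close> leaves at least \<open>2 * r k\<close> rows for the
  signs.\<close>

lemma spiked_problem_exists:
  fixes p r :: "nat \<Rightarrow> nat" and C0 lam \<sigma> :: real
  assumes k: "k \<in> {1, 2, 3}" and "0 < lam" "0 < \<sigma>" "0 \<le> C0"
    and pr: "\<forall>k\<in>{1, 2, 3}. 1 \<le> p k \<and> 1 \<le> r k \<and> real (r k) \<le> real (p k) / 3"
    and r: "real (Max {r 1, r 2, r 3}) \<le> C0 * real (Min {r 1, r 2, r 3})"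
    and rr: "4 * r 1 \<le> r 2 * r 3" "4 * r 2 \<le> r 3 * r 1" "4 * r 3 \<le> r 1 * r 2"
  obtains T where "spiked_problem p r k lam T (p k - r k) \<sigma> (C0 + 1)"
proof -
  have r3: "3 * r m \<le> p m" if "m \<in> {1, 2, 3}" for m using pr that by fastforce
  have pos: "0 < r k" "0 < r (nxt k)" "0 < r (nxt (nxt k))" using k pr by (auto simp: nxt_def)
  have le: "r k \<le> r (nxt k) * r (nxt (nxt k))" "r (nxt k) \<le> r (nxt (nxt k)) * r k"
    "r (nxt (nxt k)) \<le> r k * r (nxt k)"
    using k rr by (auto simp: nxt_def)
  obtain T where T: "latin_core (r k) (r (nxt k)) (r (nxt (nxt k))) T"
    and card: "\<And>i. card {(a, b). (i, a, b) \<in> T} \<le> max (r k) (max (r (nxt k)) (r (nxt (nxt k)))) div r k + 1"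
    by (rule latin_core_exists[OF pos le]) (rule that)
  have fam: "spiked_family p r k lam T"
  proof
    fix m :: nat
    assume m: "m \<in> {1, 2, 3}"
    show "1 \<le> r m \<and> r m \<le> p m" using bspec[OF pr m] r3[OF m] by linarith
  qed (fact k, fact \<open>0 < lam\<close>, fact T)
  interpret F: spiked_family p r k lam T by (rule fam)
  have max: "max (r k) (max (r (nxt k)) (r (nxt (nxt k)))) = Max {r 1, r 2, r 3}"
    using k by (elim insertE emptyE) (simp_all add: nxt_def max.left_commute max.commute)
  have min: "Min {r 1, r 2, r 3} \<le> r k" using k by auto
  have "F.mult j \<le> C0 + 1" for j
  proof -
    have "real (Max {r 1, r 2, r 3} div r k) \<le> real (Max {r 1, r 2, r 3}) / real (r k)"
      by (rule of_nat_div_le_of_nat)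
    also have "\<dots> \<le> C0 * real (r k) / real (r k)"
    proof (rule divide_right_mono)
      have "C0 * real (Min {r 1, r 2, r 3}) \<le> C0 * real (r k)"
        using min \<open>0 \<le> C0\<close> by (intro mult_left_mono) auto
      then show "real (Max {r 1, r 2, r 3}) \<le> C0 * real (r k)" using r by linarith
    qed simp
    also have "\<dots> = C0" using pos by simp
    finally show ?thesis using card[of j] unfolding F.mult_eq_card max by linarith
  qed
  then have "spiked_problem p r k lam T (p k - r k) \<sigma> (C0 + 1)"
    using fam r3[OF k] \<open>0 < \<sigma>\<close> by (auto simp: spiked_problem_def spiked_problem_axioms_def)
  then show ?thesis by (rule that)
qed

theorem theorem3:
  fixes C0 :: real
  assumes "C0 > 0"
  shows "\<exists>c>0. \<forall>(p :: nat \<Rightarrow> nat) (r :: nat \<Rightarrow> nat) (lam :: real) (\<sigma> :: real).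
    (\<forall>k\<in>{1, 2, 3}. 1 \<le> p k \<and> 1 \<le> r k \<and> real (r k) \<le> real (p k) / 3) \<longrightarrow>
    real (Max {p 1, p 2, p 3}) \<le> C0 * real (Min {p 1, p 2, p 3}) \<longrightarrow>
    real (Max {r 1, r 2, r 3}) \<le> C0 * real (Min {r 1, r 2, r 3}) \<longrightarrow>
    4 * r 1 \<le> r 2 * r 3 \<longrightarrow> 4 * r 2 \<le> r 3 * r 1 \<longrightarrow> 4 * r 3 \<le> r 1 * r 2 \<longrightarrow>
    lam > 0 \<longrightarrow> \<sigma> > 0 \<longrightarrow>
    (\<forall>q :: ereal. 1 \<le> q \<longrightarrow> (\<forall>k\<in>{1, 2, 3}. \<forall>U :: tensor \<Rightarrow> real mat.
       (\<forall>X\<in>low_rank_tensors p r lam. left_singular_mat (matricization p k X) (U X)) \<longrightarrow>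
       (INF U'\<in>subspace_estimators p (p k) (r k). SUP X\<in>low_rank_tensors p r lam.
          risk p \<sigma> X (\<lambda>Y. real (r k) powr (- real_of_ereal (1 / q)) *
            sin_theta_norm q (U' Y) (U X)))
       \<ge> ennreal (c * min (sqrt (real (p k)) / (lam / \<sigma>)) 1))) \<and>
    (INF X'\<in>tensor_estimators p. SUP X\<in>low_rank_tensors p r lam.
       risk p \<sigma> X (\<lambda>Y. (frobenius_norm p (\<lambda>x. X' Y x - X x))\<^sup>2))
    \<ge> ennreal (c * \<sigma>\<^sup>2 * real (p 1 * r 1 + p 2 * r 2 + p 3 * r 3)) \<and>
    (INF X'\<in>tensor_estimators p. SUP X\<in>low_rank_tensors p r lam.
       risk p \<sigma> X (\<lambda>Y. (frobenius_norm p (\<lambda>x. X' Y x - X x))\<^sup>2 / (frobenius_norm p X)\<^sup>2))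
    \<ge> ennreal (c * min (real (p 1 + p 2 + p 3) / (lam\<^sup>2 / \<sigma>\<^sup>2)) 1)"
proof -
  define \<mu> where "\<mu> = C0 + 1"
  define a where "a = exp (- (\<mu> / 2))"
  define \<T> where "\<T> = sqrt (12 / a\<^sup>2)"
  define \<kappa> where "\<kappa> = sqrt (a\<^sup>2 / (5 * \<T>))"
  have a: "0 < a" "a < 1" using assms by (auto simp: a_def \<mu>_def)
  have \<T>: "0 < \<T>" "\<T>\<^sup>2 = 12 / a\<^sup>2" using a by (auto simp: \<T>_def)
  have \<kappa>: "0 < \<kappa>" "\<kappa>\<^sup>2 = a\<^sup>2 / (5 * \<T>)" using a \<T> by (auto simp: \<kappa>_def)
  have "\<kappa> \<le> 1"
  proof -
    have "1 \<le> 12 / a\<^sup>2" using a power_le_one[of a 2] by (simp add: le_divide_eq)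
    then have "1 \<le> \<T>" by (simp add: \<T>_def)
    moreover have "a\<^sup>2 \<le> 1" using a by (simp add: power_le_one)
    ultimately have "a\<^sup>2 / (5 * \<T>) \<le> 1" by (simp add: divide_le_eq)
    then show ?thesis by (simp add: \<kappa>_def)
  qed
  \<comment> \<open>The factor \<open>1 / 2\<close> comes from
    \<open>sqrt n \<ge> sqrt (p k) / 2\<close>, and \<open>\<kappa>\<close> from lowering the
    truncation level from \<open>1\<close> to \<open>\<kappa>\<close>, where
    \<open>\<kappa> \<le> 1\<close> is used.\<close>
  define c1 where "c1 = \<kappa> / 2 * a\<^sup>2 / (4 * \<T>)"
  \<comment> \<open>Three products \<open>p m * r m\<close>, each at most
    \<open>C0^2 * p 1 * r 1\<close>, meet the fraction \<open>2 / 3\<close> of rows carrying signs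
    and the factor \<open>1 / 2\<close> of the Frobenius bound.\<close>
  define c2 where "c2 = exp (- \<mu>) / (9 * C0\<^sup>2)"
  \<comment> \<open>The sum of the dimensions is at most \<open>3 * C0 * p 1\<close>, against
    \<open>2 / 3 * p 1\<close> rows carrying signs, whence \<open>2 / (9 * C0)\<close>; the minimum
    with \<open>1\<close> lets the factor pass inside the truncation.\<close>
  define c3 where "c3 = min (2 / (9 * C0)) 1 * exp (- \<mu>) / (4 * \<mu>)"
  define c where "c = min c1 (min c2 c3)"
  have "0 < \<mu>" using assms by (simp add: \<mu>_def)
  have "c > 0" using assms \<kappa> \<T> a \<open>0 < \<mu>\<close> by (simp add: c_def c1_def c2_def c3_def)
  have c_le: "c \<le> c1" "c \<le> c2" "c \<le> c3" by (auto simp: c_def)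
  show ?thesis
  proof (intro exI[of _ c] conjI[OF \<open>c > 0\<close>] allI impI, goal_cases)
    case (1 p r lam \<sigma>)
    note pr = 1(1) and p = 1(2) and r = 1(3) and rr = 1(4-6) and lam = 1(7) and \<sigma> = 1(8)
    have prob: "\<exists>T. spiked_problem p r k lam T (p k - r k) \<sigma> \<mu>" if "k \<in> {1, 2, 3}" for k
      unfolding \<mu>_def by (rule spiked_problem_exists[OF that lam \<sigma> _ pr r rr]) (use assms in simp, blast)
    have n_ge: "2 / 3 * real (p k) \<le> real (p k - r k)" if "k \<in> {1, 2, 3}" for k
    proof -
      have "real (r k) \<le> real (p k) / 3" using pr that by blast
      then show ?thesis by linarith
    qed
    have sin_theta: "ennreal (c * min (sqrt (real (p k)) / (lam / \<sigma>)) 1) \<le> (SUP X\<in>low_rank_tensors p r lam.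
        risk p \<sigma> X (\<lambda>Y. real (r k) powr (- real_of_ereal (1 / q)) * sin_theta_norm q (U' Y) (U X)))"
        (is "ennreal (c * ?m) \<le> _")
      if "1 \<le> q" and k: "k \<in> {1, 2, 3}" and U': "U' \<in> subspace_estimators p (p k) (r k)"
        and U: "\<forall>X\<in>low_rank_tensors p r lam. left_singular_mat (matricization p k X) (U X)" for q k U U'
    proof -
      obtain T where "spiked_problem p r k lam T (p k - r k) \<sigma> \<mu>" using prob[OF k] by blast
      then interpret spiked_problem p r k lam T "p k - r k" \<sigma> \<mu> .
      define n where "n = p k - r k"
      \<comment> \<open>The fraction \<open>2 / 3\<close> is weakened to \<open>1 / 4\<close>, which
        has a rational root.\<close>
      have "sqrt (real (p k) / 4) \<le> sqrt n" unfolding n_def using n_ge[OF k] by (intro real_sqrt_le_mono) linarith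
      then have sq: "sqrt (p k) / 2 \<le> sqrt n" by (simp add: real_sqrt_divide)
      have "c * ?m \<le> c1 * ?m"
        using c_le lam \<sigma> by (intro mult_right_mono) auto
      also have "\<dots> = \<kappa> / 2 * min (sqrt (real (p k)) * \<sigma> / lam) 1 * a\<^sup>2 / (4 * \<T>)"
        by (simp add: c1_def)
      also have "\<dots> \<le> min (sqrt n * \<sigma> / lam) \<kappa> * a\<^sup>2 / (4 * \<T>)"
      proof (intro divide_right_mono mult_right_mono)
        have "\<kappa> / 2 * min (sqrt (real (p k)) * \<sigma> / lam) 1 \<le> \<kappa> / 2 * 1"
          using \<kappa> by (intro mult_left_mono) auto
        then have "\<kappa> / 2 * min (sqrt (real (p k)) * \<sigma> / lam) 1 \<le> \<kappa>" using \<kappa>(1) by linarith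
        moreover have "\<kappa> / 2 * min (sqrt (real (p k)) * \<sigma> / lam) 1 \<le> sqrt n * \<sigma> / lam"
        proof -
          have "\<kappa> / 2 * min (sqrt (real (p k)) * \<sigma> / lam) 1 \<le> 1 / 2 * (sqrt (real (p k)) * \<sigma> / lam)"
            using \<open>\<kappa> \<le> 1\<close> \<kappa>(1) lam \<sigma> by (intro mult_mono) auto
          also have "\<dots> = sqrt (p k) / 2 * (\<sigma> / lam)" by simp
          also have "\<dots> \<le> sqrt n * (\<sigma> / lam)" using sq lam \<sigma> by (intro mult_right_mono) auto
          finally show ?thesis by simp
        qed
        ultimately show "\<kappa> / 2 * min (sqrt (real (p k)) * \<sigma> / lam) 1 \<le> min (sqrt n * \<sigma> / lam) \<kappa>" by simp
      qed (use \<T> in auto)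
      finally have le: "c * ?m \<le> min (sqrt n * \<sigma> / lam) \<kappa> * a\<^sup>2 / (4 * \<T>)" .
      show ?thesis
        by (rule order_trans[OF ennreal_leI[OF le[unfolded n_def]] sin_theta_minimax[OF U' \<open>1 \<le> q\<close> _ a_def \<T> \<kappa>]])
           (use U in blast)
    qed
    \<comment> \<open>Signs in mode 1 alone serve both Frobenius bounds: the other dimensions and
      ranks are at most \<open>C0\<close> times those of mode 1.\<close>
    obtain T where "spiked_problem p r 1 lam T (p 1 - r 1) \<sigma> \<mu>" using prob[of 1] by blast
    then interpret spiked_problem p r 1 lam T "p 1 - r 1" \<sigma> \<mu> .
    define n1 where "n1 = p 1 - r 1"
    have n1: "2 / 3 * real (p 1) \<le> real n1" unfolding n1_def by (rule n_ge) simp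
    have p1: "real (p m) \<le> C0 * real (p 1)" and r1: "real (r m) \<le> C0 * real (r 1)" if "m \<in> {1, 2, 3}" for m
    proof -
      have "real (p m) \<le> real (Max {p 1, p 2, p 3})" "real (r m) \<le> real (Max {r 1, r 2, r 3})"
        using that by (auto simp del: Max_insert intro!: Max_ge)
      moreover have "C0 * real (Min {p 1, p 2, p 3}) \<le> C0 * real (p 1)"
        "C0 * real (Min {r 1, r 2, r 3}) \<le> C0 * real (r 1)"
        using assms by auto
      ultimately show "real (p m) \<le> C0 * real (p 1)" "real (r m) \<le> C0 * real (r 1)" using p r by linarith+
    qed
    have frobenius: "c * \<sigma>\<^sup>2 * real (p 1 * r 1 + p 2 * r 2 + p 3 * r 3)
        \<le> \<sigma>\<^sup>2 * real n1 * real (r 1) * exp (- \<mu>) / 2"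
    proof -
      have pm: "real (p m * r m) \<le> C0\<^sup>2 * (real (p 1) * real (r 1))" if "m \<in> {1, 2, 3}" for m
        using mult_mono[OF p1[OF that] r1[OF that]] assms by (simp add: power2_eq_square mult_ac)
      have "real (p 1 * r 1 + p 2 * r 2 + p 3 * r 3) \<le> 3 * (C0\<^sup>2 * (real (p 1) * real (r 1)))"
        using pm[of 1] pm[of 2] pm[of 3] by simp
      then have "c * \<sigma>\<^sup>2 * real (p 1 * r 1 + p 2 * r 2 + p 3 * r 3)
          \<le> c2 * \<sigma>\<^sup>2 * (3 * (C0\<^sup>2 * (real (p 1) * real (r 1))))"
        using c_le \<open>c > 0\<close> by (intro mult_mono) auto
      also have "\<dots> = \<sigma>\<^sup>2 * (2 / 3 * real (p 1)) * real (r 1) * exp (- \<mu>) / 2"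
        using assms by (simp add: c2_def field_simps)
      also have "\<dots> \<le> \<sigma>\<^sup>2 * real n1 * real (r 1) * exp (- \<mu>) / 2"
        using n1 by (intro divide_right_mono mult_right_mono mult_left_mono) auto
      finally show ?thesis .
    qed
    have relative: "c * min (real (p 1 + p 2 + p 3) / (lam\<^sup>2 / \<sigma>\<^sup>2)) 1
        \<le> min (n1 * \<sigma>\<^sup>2 / lam\<^sup>2) 1 * exp (- \<mu>) / (4 * \<mu>)"
    proof -
      define s where "s = min (2 / (9 * C0)) 1"
      have s: "0 < s" "s \<le> 1" "s \<le> 2 / (9 * C0)" using assms by (auto simp: s_def)
      define S where "S = real (p 1 + p 2 + p 3)"
      have "S \<le> 3 * C0 * real (p 1)" using p1[of 1] p1[of 2] p1[of 3] by (simp add: S_def)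
      then have "2 / (9 * C0) * S \<le> 2 / (9 * C0) * (3 * C0 * real (p 1))"
        using assms by (intro mult_left_mono) auto
      also have "\<dots> = 2 / 3 * real (p 1)" using assms by simp
      finally have "2 / (9 * C0) * S \<le> real n1" using n1 by linarith
      moreover have "s * S \<le> 2 / (9 * C0) * S" using s by (intro mult_right_mono) (auto simp: S_def)
      ultimately have sS: "s * S \<le> real n1" by linarith
      have "s * min (S / (lam\<^sup>2 / \<sigma>\<^sup>2)) 1 \<le> min (n1 * \<sigma>\<^sup>2 / lam\<^sup>2) 1"
      proof (rule min.boundedI)
        have "s * min (S / (lam\<^sup>2 / \<sigma>\<^sup>2)) 1 \<le> s * (S / (lam\<^sup>2 / \<sigma>\<^sup>2))"
          using s by (intro mult_left_mono) auto
        also have "\<dots> = s * S * (\<sigma>\<^sup>2 / lam\<^sup>2)" by simp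
        also have "\<dots> \<le> n1 * (\<sigma>\<^sup>2 / lam\<^sup>2)" using sS by (intro mult_right_mono) auto
        finally show "s * min (S / (lam\<^sup>2 / \<sigma>\<^sup>2)) 1 \<le> n1 * \<sigma>\<^sup>2 / lam\<^sup>2" by simp
        have "s * min (S / (lam\<^sup>2 / \<sigma>\<^sup>2)) 1 \<le> s * 1"
          using s by (intro mult_left_mono) auto
        then show "s * min (S / (lam\<^sup>2 / \<sigma>\<^sup>2)) 1 \<le> 1" using s by linarith
      qed
      then have "s * min (S / (lam\<^sup>2 / \<sigma>\<^sup>2)) 1 * (exp (- \<mu>) / (4 * \<mu>)) \<le> min (n1 * \<sigma>\<^sup>2 / lam\<^sup>2) 1 * (exp (- \<mu>) / (4 * \<mu>))"
        using \<open>0 < \<mu>\<close> by (intro mult_right_mono) auto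
      moreover have "c * min (S / (lam\<^sup>2 / \<sigma>\<^sup>2)) 1 \<le> c3 * min (S / (lam\<^sup>2 / \<sigma>\<^sup>2)) 1"
        using c_le by (intro mult_right_mono) (auto simp: S_def)
      ultimately show ?thesis unfolding S_def[symmetric] by (simp add: c3_def s_def mult_ac)
    qed
    show ?case
    proof (intro conjI allI impI ballI INF_greatest, goal_cases)
      case (1 q k U U')
      then show ?case by (intro sin_theta) auto
    next
      case (2 X')
      then show ?case
        by (rule order_trans[OF ennreal_leI[OF frobenius[unfolded n1_def]] frobenius_minimax])
    next
      case (3 X')
      then show ?case
        by (rule order_trans[OF ennreal_leI[OF relative[unfolded n1_def]] relative_frobenius_minimax])
    qed
  qed
qed

end
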